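(* Let $I=[0,1]$, let $\{I_i\}_i$ be a finite partition of $I$ (up to finitely many points) by open intervals, and let $T\colon \bigcup_i I_i\to I$. Suppose that: - for some $r>0$, $T$ is piecewise $C^{r+1}$ and expanding, Markovian with $k$ branches, all of them onto, and $$\exp\big(P_{top}(-(r+1)\log|DT|)\big)<\frac1k;$$ - the Lebesgue measure $m$ on $I$ is $T$-invariant; - $B$ is a Banach space of functions continuously embedded in $L^1(I)$ whose norm $\|\cdot\|_B$ is natural; - the transfer operator $L$ of $T$ with respect to $m$ leaves $B$ invariant, and $L\colon B\to B$ is a bounded operator with spectral gap; - for every interval $J\subset I$ we have $1_J\in B$. Then one of the following cases occurs: I. There is $C>0$ such that $\frac1C\le\|1_P\|_B\le C$ for every interval $P\subset I$, and $r_{ess}(L,B)\ge \frac1k$. II. There are $s\in(0,1)$ and $C>0$ such that $\frac1C|P|^{1-s}\le\|1_P\|_B\le C|P|^{1-s}$ for every interval $P\subset I$, the Besov space $B^s_{1,1}$ is continuously embedded in $B$, and $$r_{ess}(L,B)\ \ge\ \frac{1}{\Theta^\infty(1-s)}.$$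
   Context: $|A|$ denotes the Lebesgue measure of $A$; functions are complex-valued and identified when equal $m$-a.e.; intervals have positive length and may be open, closed or half-open. Piecewise $C^{r+1}$, with $k$ branches all onto: there are $k$ intervals $I_i$, and each $T|_{I_i}$ extends to a $C^{r+1}$ diffeomorphism from $\overline{I_i}$ onto $I$. Expanding: there is $\lambda_0>1$ with $|DT(x)|\ge\lambda_0$ for all $x\in\bigcup_i I_i$. Let $\mathcal{P}^n=\{I^n_i\}_i$ be the collection of intervals of monotonicity (branches) of $T^n$. Topological pressure: for a potential $\phi$ (here $\phi=-(r+1)\log|DT|$), $P_{top}(\phi)=\lim_{n\to\infty}\frac1n\log\sum_{P\in\mathcal{P}^n}\sup_{x\in P}\exp\big(\sum_{j=0}^{n-1}\phi(T^jx)\big)$. $\Theta^\infty$: put $\theta^n_i=\sup_{x\in I^n_i}1/|DT^n(x)|$ and, for $\gamma>0$, $\Theta^n(\gamma)=\sum_i(\theta^n_i)^\gamma$; this is sub-multiplicative in $n$ and $\Theta^\infty(\gamma)=\lim_{n\to\infty}(\Theta^n(\gamma))^{1/n}$. Transfer operator: $L\colon L^1(I)\to L^1(I)$, $(L\phi)(x)=\sum_{T(y)=x}\phi(y)/|DT(y)|$; equivalently $\int \psi\, L\phi\,dm=\int (\psi\circ T)\,\phi\,dm$ for all $\psi\in L^\infty(I)$, $\phi\in L^1(I)$. A Banach space of functions continuously embedded in $L^1(I)$ is a complex linear subspace $B\subset L^1(I)$ with a complete norm $\|\cdot\|_B$ such that the inclusion into $L^1(I)$ is bounded. Spectral gap: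 $1$ is a simple isolated eigenvalue of $L\colon B\to B$ and the rest of the spectrum is contained in a disc centred at $0$ of radius strictly less than $1$. Essential spectral radius: $r_{ess}(L,B)$ is the infimum of the $r'\ge0$ such that every point of the spectrum of $L\colon B\to B$ with modulus $>r'$ is an isolated eigenvalue of finite algebraic multiplicity. Natural norms: a pseudo-norm (seminorm) $n(\cdot)$ on a space $B$ of functions on $I$ is purely natural if there are $t\in\mathbb{R}$ (the degree of homogeneity) and $C>0$ such that, whenever $u\colon\mathbb{R}\to\mathbb{R}$ is an invertible affine transformation and $\phi\colon I\to\mathbb{C}$, $\phi\in B$, satisfies $u^{-1}(\operatorname{supp}\phi)\subset I$, then $\phi\circ u\in B$ and $\frac1C|u'|^t n(\phi)\le n(\phi\circ u)\le C|u'|^t n(\phi)$; here $\phi$ is extended by $0$ outside $I$, so that $\phi\circ u$ is a function on $I$. A pseudo-norm $n$ on $B$ is natural if it is a finite sum $n(\phi)=\sum_{i\le j}n_i(\phi)$ of purely natural pseudo-norms $n_i$, with degrees of homogeneity $t_i$. Besov space: for $s\in(0,1)$, $B^s_{1,1}=B^s_{1,1}(I)$ is the classical Besov space on $I$, which is described (with equivalent norm) as the space of all $\psi\in L^1(I)$ that can be written as $\psi=\sum_{n=0}^\infty c_n|Q_n|^{s-1}1_{Q_n}$ with convergence in $L^1(I)$, where the $Q_n$ are subintervals of $I$, $c_n\in\mathbb{C}$ and $\sum_n|c_n|<\infty$; the norm is $|\psi|_{B^s_{1,1}(I)}=\inf\sum_n|c_n|$ over all such representations. *)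

theory Defs
  imports "HOL-Analysis.Analysis"
begin

section \<open>Intervals, piecewise smooth maps\<close>

text \<open>The unit interval is \<open>{0..1}\<close> throughout. Intervals have positive length; they may be open, closed
  or half-open.\<close>

definition subintervals :: "real set set" where
  "subintervals = {J. is_interval J \<and> J \<subseteq> {0..1} \<and> (\<exists>a\<in>J. \<exists>b\<in>J. a < b)}"

definition interval_partition :: "real set set \<Rightarrow> bool" where
  "interval_partition \<I> \<longleftrightarrow>
     finite \<I> \<and> (\<forall>J\<in>\<I>. J \<in> subintervals \<and> open J) \<and> disjoint \<I> \<and> finite ({0..1} - \<Union>\<I>)"

text \<open>Class \<open>C\<^sup>s\<close> for real \<open>s\<close>: with \<open>q = \<lfloor>s\<rfloor>\<close>, the function is \<open>q\<close> times continuously differentiable (with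
  one-sided derivatives at the end points when \<open>S\<close> is a compact interval) and, if \<open>s\<close> is not an
  integer, the \<open>q\<close>-th derivative is Hoelder continuous with exponent \<open>s - q\<close>. For integer \<open>s\<close> this is
  the usual class.\<close>

definition C_class_on :: "real \<Rightarrow> real set \<Rightarrow> (real \<Rightarrow> real) \<Rightarrow> bool" where
  "C_class_on s S f \<longleftrightarrow>
     (\<exists>D :: nat \<Rightarrow> real \<Rightarrow> real.
        (\<forall>x\<in>S. D 0 x = f x) \<and>
        (\<forall>i < nat \<lfloor>s\<rfloor>. \<forall>x\<in>S. (D i has_real_derivative D (Suc i) x) (at x within S)) \<and>
        continuous_on S (D (nat \<lfloor>s\<rfloor>)) \<and>
        (frac s > 0 \<longrightarrow>
          (\<exists>H. \<forall>x\<in>S. \<forall>y\<in>S. \<bar>D (nat \<lfloor>s\<rfloor>) x - D (nat \<lfloor>s\<rfloor>) y\<bar> \<le> H * \<bar>x - y\<bar> powr frac s)))"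

definition C_diffeo :: "real \<Rightarrow> real set \<Rightarrow> real set \<Rightarrow> (real \<Rightarrow> real) \<Rightarrow> bool" where
  "C_diffeo s S S' f \<longleftrightarrow>
     bij_betw f S S' \<and> C_class_on s S f \<and> C_class_on s S' (the_inv_into S f)"

text \<open>The map is a total function on the reals; only its values on \<open>\<Union>\<I>\<close> matter. All branches are onto.\<close>

definition piecewise_C_full_branches :: "real \<Rightarrow> real set set \<Rightarrow> (real \<Rightarrow> real) \<Rightarrow> bool" where
  "piecewise_C_full_branches s \<I> T \<longleftrightarrow>
     (\<forall>J\<in>\<I>. \<exists>f. (\<forall>x\<in>J. f x = T x) \<and> C_diffeo s (closure J) {0..1} f)"

definition expanding :: "real set set \<Rightarrow> (real \<Rightarrow> real) \<Rightarrow> bool" where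
  "expanding \<I> T \<longleftrightarrow> (\<exists>l0>1. \<forall>x\<in>\<Union>\<I>. \<bar>deriv T x\<bar> \<ge> l0)"

definition lebesgue_invariant :: "real set set \<Rightarrow> (real \<Rightarrow> real) \<Rightarrow> bool" where
  "lebesgue_invariant \<I> T \<longleftrightarrow>
     (\<forall>A \<in> sets (lebesgue_on {0..1}).
        {x \<in> \<Union>\<I>. T x \<in> A} \<in> sets lebesgue \<and>
        emeasure lebesgue {x \<in> \<Union>\<I>. T x \<in> A} = emeasure lebesgue A)"

text \<open>The intervals of monotonicity of \<open>T\<^sup>n\<close> are the nonempty cylinders of length \<open>n\<close>; on them
  \<open>x, T x, \<dots>, T\<^sup>n\<^sup>-\<^sup>1 x\<close> all lie in \<open>\<Union>\<I>\<close>, so that \<open>T\<^sup>n\<close> is defined there.\<close>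

definition cylinder :: "(real \<Rightarrow> real) \<Rightarrow> real set list \<Rightarrow> real set" where
  "cylinder T w = {x \<in> {0..1}. \<forall>j < length w. (T ^^ j) x \<in> w ! j}"

definition branches :: "real set set \<Rightarrow> (real \<Rightarrow> real) \<Rightarrow> nat \<Rightarrow> real set set" where
  "branches \<I> T n = {cylinder T w | w. length w = n \<and> set w \<subseteq> \<I>} - {{}}"

definition P_top :: "real set set \<Rightarrow> (real \<Rightarrow> real) \<Rightarrow> (real \<Rightarrow> real) \<Rightarrow> real" where
  "P_top \<I> T \<phi> =
     lim (\<lambda>n. 1 / real n * ln (\<Sum>P\<in>branches \<I> T n. SUP x\<in>P. exp (\<Sum>j<n. \<phi> ((T ^^ j) x))))"

definition Theta :: "real set set \<Rightarrow> (real \<Rightarrow> real) \<Rightarrow> nat \<Rightarrow> real \<Rightarrow> real" where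
  "Theta \<I> T n \<gamma> = (\<Sum>P\<in>branches \<I> T n. (SUP x\<in>P. 1 / \<bar>deriv (T ^^ n) x\<bar>) powr \<gamma>)"

definition Theta_inf :: "real set set \<Rightarrow> (real \<Rightarrow> real) \<Rightarrow> real \<Rightarrow> real" where
  "Theta_inf \<I> T \<gamma> = lim (\<lambda>n. root n (Theta \<I> T n \<gamma>))"

definition transfer_op ::
    "real set set \<Rightarrow> (real \<Rightarrow> real) \<Rightarrow> (real \<Rightarrow> complex) \<Rightarrow> real \<Rightarrow> complex" where
  "transfer_op \<I> T \<phi> x = (\<Sum>y\<in>{y \<in> \<Union>\<I>. T y = x}. \<phi> y / of_real \<bar>deriv T y\<bar>)"


section \<open>Banach spaces of functions inside \<open>L\<^sup>1\<close>\<close>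

text \<open>Elements of \<open>L\<^sup>1\<close> are represented by functions \<open>real \<Rightarrow> complex\<close>, whose values outside \<open>{0..1}\<close> are
  irrelevant; equality of elements is \<open>ae_eq\<close>. A space of functions is a set of representatives that
  is closed under \<open>ae_eq\<close>, and norms and operators respect \<open>ae_eq\<close>.\<close>

definition ae_eq :: "(real \<Rightarrow> complex) \<Rightarrow> (real \<Rightarrow> complex) \<Rightarrow> bool" (infix "\<approx>" 50) where
  "f \<approx> g \<longleftrightarrow> (AE x in lebesgue_on {0..1}. f x = g x)"

definition L1 :: "(real \<Rightarrow> complex) set" where
  "L1 = {f. integrable (lebesgue_on {0..1}) f}"

definition L1_norm :: "(real \<Rightarrow> complex) \<Rightarrow> real" where
  "L1_norm f = (\<integral>x. norm (f x) \<partial>lebesgue_on {0..1})"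

definition function_space :: "(real \<Rightarrow> complex) set \<Rightarrow> bool" where
  "function_space B \<longleftrightarrow>
     B \<subseteq> L1 \<and> (\<lambda>x. 0) \<in> B \<and>
     (\<forall>f\<in>B. \<forall>g\<in>B. (\<lambda>x. f x + g x) \<in> B) \<and>
     (\<forall>c. \<forall>f\<in>B. (\<lambda>x. c * f x) \<in> B) \<and>
     (\<forall>f\<in>B. \<forall>g. f \<approx> g \<longrightarrow> g \<in> B)"

definition pseudo_norm_on :: "(real \<Rightarrow> complex) set \<Rightarrow> ((real \<Rightarrow> complex) \<Rightarrow> real) \<Rightarrow> bool" where
  "pseudo_norm_on B n \<longleftrightarrow>
     (\<forall>f\<in>B. n f \<ge> 0) \<and>
     (\<forall>f\<in>B. \<forall>g\<in>B. n (\<lambda>x. f x + g x) \<le> n f + n g) \<and>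
     (\<forall>c. \<forall>f\<in>B. n (\<lambda>x. c * f x) = norm c * n f) \<and>
     (\<forall>f\<in>B. \<forall>g\<in>B. f \<approx> g \<longrightarrow> n f = n g)"

definition banach_in_L1 :: "(real \<Rightarrow> complex) set \<Rightarrow> ((real \<Rightarrow> complex) \<Rightarrow> real) \<Rightarrow> bool" where
  "banach_in_L1 B N \<longleftrightarrow>
     function_space B \<and> pseudo_norm_on B N \<and>
     (\<forall>f\<in>B. N f = 0 \<longrightarrow> f \<approx> (\<lambda>x. 0)) \<and>
     (\<forall>F :: nat \<Rightarrow> real \<Rightarrow> complex.
        (\<forall>i. F i \<in> B) \<and> (\<forall>e>0. \<exists>M. \<forall>i\<ge>M. \<forall>j\<ge>M. N (\<lambda>x. F i x - F j x) < e) \<longrightarrow>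
        (\<exists>f\<in>B. (\<lambda>i. N (\<lambda>x. F i x - f x)) \<longlonglongrightarrow> 0)) \<and>
     (\<exists>C. \<forall>f\<in>B. L1_norm f \<le> C * N f)"

definition zero_ext :: "(real \<Rightarrow> complex) \<Rightarrow> real \<Rightarrow> complex" where
  "zero_ext \<phi> x = (if x \<in> {0..1} then \<phi> x else 0)"

text \<open>Since functions are identified almost everywhere, the support is the essential one: the
  complement of the largest open set on which the function vanishes almost everywhere.\<close>

definition ess_supp :: "(real \<Rightarrow> complex) \<Rightarrow> real set" where
  "ess_supp \<phi> = - \<Union>{U. open U \<and> (AE x in lebesgue. x \<in> U \<longrightarrow> zero_ext \<phi> x = 0)}"

definition purely_natural :: "(real \<Rightarrow> complex) set \<Rightarrow> ((real \<Rightarrow> complex) \<Rightarrow> real) \<Rightarrow> bool" where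
  "purely_natural B n \<longleftrightarrow>
     pseudo_norm_on B n \<and>
     (\<exists>t C :: real. C > 0 \<and>
        (\<forall>a b :: real. \<forall>\<phi>\<in>B. a \<noteq> 0 \<and> (\<lambda>x. a * x + b) -` ess_supp \<phi> \<subseteq> {0..1} \<longrightarrow>
           (\<lambda>x. zero_ext \<phi> (a * x + b)) \<in> B \<and>
           1 / C * \<bar>a\<bar> powr t * n \<phi> \<le> n (\<lambda>x. zero_ext \<phi> (a * x + b)) \<and>
           n (\<lambda>x. zero_ext \<phi> (a * x + b)) \<le> C * \<bar>a\<bar> powr t * n \<phi>))"

definition natural_norm :: "(real \<Rightarrow> complex) set \<Rightarrow> ((real \<Rightarrow> complex) \<Rightarrow> real) \<Rightarrow> bool" where
  "natural_norm B N \<longleftrightarrow>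
     (\<exists>(j :: nat) n. (\<forall>i\<le>j. purely_natural B (n i)) \<and> (\<forall>\<phi>\<in>B. N \<phi> = (\<Sum>i\<le>j. n i \<phi>)))"


section \<open>Spectral theory\<close>

definition bounded_op ::
    "(real \<Rightarrow> complex) set \<Rightarrow> ((real \<Rightarrow> complex) \<Rightarrow> real) \<Rightarrow>
     ((real \<Rightarrow> complex) \<Rightarrow> real \<Rightarrow> complex) \<Rightarrow> bool" where
  "bounded_op B N A \<longleftrightarrow>
     (\<forall>f\<in>B. A f \<in> B) \<and>
     (\<forall>f\<in>B. \<forall>g\<in>B. f \<approx> g \<longrightarrow> A f \<approx> A g) \<and>
     (\<forall>f\<in>B. \<forall>g\<in>B. A (\<lambda>x. f x + g x) \<approx> (\<lambda>x. A f x + A g x)) \<and>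
     (\<forall>c. \<forall>f\<in>B. A (\<lambda>x. c * f x) \<approx> (\<lambda>x. c * A f x)) \<and>
     (\<exists>C. \<forall>f\<in>B. N (A f) \<le> C * N f)"

definition spectrum ::
    "(real \<Rightarrow> complex) set \<Rightarrow> ((real \<Rightarrow> complex) \<Rightarrow> real) \<Rightarrow>
     ((real \<Rightarrow> complex) \<Rightarrow> real \<Rightarrow> complex) \<Rightarrow> complex set" where
  "spectrum B N A =
     {z. \<not> (\<exists>R. bounded_op B N R \<and>
              (\<forall>f\<in>B. R (\<lambda>x. z * f x - A f x) \<approx> f \<and> (\<lambda>x. z * R f x - A (R f) x) \<approx> f))}"

definition eigenvalue ::
    "(real \<Rightarrow> complex) set \<Rightarrow> ((real \<Rightarrow> complex) \<Rightarrow> real \<Rightarrow> complex) \<Rightarrow> complex \<Rightarrow> bool" where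
  "eigenvalue B A z \<longleftrightarrow> (\<exists>f\<in>B. \<not> f \<approx> (\<lambda>x. 0) \<and> A f \<approx> (\<lambda>x. z * f x))"

definition has_dim :: "(real \<Rightarrow> complex) set \<Rightarrow> nat \<Rightarrow> bool" where
  "has_dim E d \<longleftrightarrow>
     (\<exists>e :: nat \<Rightarrow> real \<Rightarrow> complex.
        (\<forall>i<d. e i \<in> E) \<and>
        (\<forall>c. (\<lambda>x. \<Sum>i<d. c i * e i x) \<approx> (\<lambda>x. 0) \<longrightarrow> (\<forall>i<d. c i = 0)) \<and>
        (\<forall>f\<in>E. \<exists>c. f \<approx> (\<lambda>x. \<Sum>i<d. c i * e i x)))"

text \<open>The spectral (Riesz) projection of an isolated point \<open>z\<close> of the spectrum: the bounded projection,
  unique up to \<open>ae_eq\<close>, that commutes with \<open>A\<close> and splits the spectrum into \<open>{z}\<close> (on its range) and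
  the rest (on its kernel). The algebraic multiplicity of \<open>z\<close> is the dimension of its range. (The
  generalised eigenspace is not enough in infinite dimension: \<open>A - z\<close> may be quasi-nilpotent without
  being nilpotent on the range.)\<close>

definition spectral_projection ::
    "(real \<Rightarrow> complex) set \<Rightarrow> ((real \<Rightarrow> complex) \<Rightarrow> real) \<Rightarrow>
     ((real \<Rightarrow> complex) \<Rightarrow> real \<Rightarrow> complex) \<Rightarrow> complex \<Rightarrow>
     ((real \<Rightarrow> complex) \<Rightarrow> real \<Rightarrow> complex) \<Rightarrow> bool" where
  "spectral_projection B N A z proj \<longleftrightarrow>
     bounded_op B N proj \<and>
     (\<forall>f\<in>B. proj (proj f) \<approx> proj f) \<and>
     (\<forall>f\<in>B. A (proj f) \<approx> proj (A f)) \<and>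
     spectrum {f \<in> B. proj f \<approx> f} N A = {z} \<and>
     spectrum {f \<in> B. proj f \<approx> (\<lambda>x. 0)} N A = spectrum B N A - {z}"

definition isolated_eigenvalue_of_mult ::
    "(real \<Rightarrow> complex) set \<Rightarrow> ((real \<Rightarrow> complex) \<Rightarrow> real) \<Rightarrow>
     ((real \<Rightarrow> complex) \<Rightarrow> real \<Rightarrow> complex) \<Rightarrow> complex \<Rightarrow> nat \<Rightarrow> bool" where
  "isolated_eigenvalue_of_mult B N A z d \<longleftrightarrow>
     eigenvalue B A z \<and> z isolated_in spectrum B N A \<and>
     (\<exists>proj. spectral_projection B N A z proj \<and> has_dim {f \<in> B. proj f \<approx> f} d)"

definition spectral_gap ::
    "(real \<Rightarrow> complex) set \<Rightarrow> ((real \<Rightarrow> complex) \<Rightarrow> real) \<Rightarrow>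
     ((real \<Rightarrow> complex) \<Rightarrow> real \<Rightarrow> complex) \<Rightarrow> bool" where
  "spectral_gap B N A \<longleftrightarrow>
     isolated_eigenvalue_of_mult B N A 1 1 \<and> (\<exists>\<rho><1. spectrum B N A - {1} \<subseteq> cball 0 \<rho>)"

definition r_ess ::
    "(real \<Rightarrow> complex) set \<Rightarrow> ((real \<Rightarrow> complex) \<Rightarrow> real) \<Rightarrow>
     ((real \<Rightarrow> complex) \<Rightarrow> real \<Rightarrow> complex) \<Rightarrow> real" where
  "r_ess B N A =
     Inf {r'. r' \<ge> 0 \<and>
       (\<forall>z \<in> spectrum B N A. norm z > r' \<longrightarrow> (\<exists>d. isolated_eigenvalue_of_mult B N A z d))}"


section \<open>The Besov space \<open>B\<^sup>s\<^sub>1\<^sub>,\<^sub>1\<close>, by its atomic description\<close>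

definition besov_rep ::
    "real \<Rightarrow> (real \<Rightarrow> complex) \<Rightarrow> (nat \<Rightarrow> complex) \<Rightarrow> (nat \<Rightarrow> real set) \<Rightarrow> bool" where
  "besov_rep s \<psi> c Q \<longleftrightarrow>
     (\<forall>n. Q n \<in> subintervals) \<and> summable (\<lambda>n. norm (c n)) \<and>
     (\<lambda>M. L1_norm (\<lambda>x. \<psi> x -
        (\<Sum>n<M. c n * of_real (measure lebesgue (Q n) powr (s - 1)) * indicator (Q n) x)))
       \<longlonglongrightarrow> 0"

definition besov :: "real \<Rightarrow> (real \<Rightarrow> complex) set" where
  "besov s = {\<psi> \<in> L1. \<exists>c Q. besov_rep s \<psi> c Q}"

definition besov_norm :: "real \<Rightarrow> (real \<Rightarrow> complex) \<Rightarrow> real" where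
  "besov_norm s \<psi> = Inf {\<Sum>n. norm (c n) | c. \<exists>Q. besov_rep s \<psi> c Q}"

end

theory Submission
  imports Defs "HOL-Complex_Analysis.Cauchy_Integral_Formula"
begin

text \<open>
  Rescaling the unit interval, naturality gives \<open>N (1\<^sub>P) \<asymp> |P|\<^sup>\<alpha>\<close> for a single exponent \<open>\<alpha> \<in> [0, 1]\<close>, and
  \<open>s = 1 - \<alpha>\<close>. For an interval \<open>J\<close>, the preimage under \<open>T\<^sup>n\<close> is a union of intervals, one in each branch,
  so the indicators \<open>g\<^sub>n\<close> of these preimages grow in norm at most like \<open>k\<^sup>n\<close>, \<open>\<Theta>\<^sup>n(\<alpha>)\<close> or a constant, if
  \<open>\<alpha>\<close> is \<open>0\<close>, between \<open>0\<close> and \<open>1\<close>, or \<open>1\<close>; moreover \<open>L g\<^sub>n\<^sub>+\<^sub>1 = g\<^sub>n\<close> because \<open>L 1 = 1\<close>. Hence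
  \<open>u(z) = \<Sum>\<^sub>n z\<^sup>n g\<^sub>n\<close> solves \<open>(z - L) u(z) = - L g\<^sub>0\<close> in a disc of some radius \<open>\<rho>\<close>, and the same for
  linear combinations of intervals. If the essential spectral radius were less than \<open>\<rho>\<close>, only finitely
  many eigenvalues of finite multiplicity would have modulus at least \<open>\<rho>\<close>. A nontrivial combination
  \<open>g\<^sub>0\<close> of disjoint intervals with \<open>L g\<^sub>0\<close> in the kernels of their spectral projections exists by linear
  algebra; for it the resolvent extends \<open>u\<close> to an entire function that vanishes at infinity. By Liouville
  \<open>u = 0\<close>, but \<open>u(0) = g\<^sub>0 \<noteq> 0\<close>. The case \<open>\<alpha> = 1\<close> gives essential spectral radius at least \<open>1\<close> and
  contradicts the spectral gap.
\<close>

text \<open>The disc of radius \<rho> may consist entirely of spectrum, so inside it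
  \<open>u\<close> is available only as a power series. Outside it comes from the resolvent, and at
  the finitely many eigenvalues from the resolvent on the kernel of the spectral projection. These
  pieces need no matching along the circle: where \<open>z - L\<close> has a bounded left inverse on
  a space \<open>K\<close>, any family of solutions in \<open>K\<close> near \<open>z\<close> is
  differentiable at \<open>z\<close>, since the equations at \<open>w\<close> and \<open>z\<close>
  express \<open>u(w) - u(z)\<close> as \<open>z - w\<close> times that inverse applied to
  \<open>u(w)\<close>. Near an eigenvalue, uniqueness off the spectrum forces the solutions into the
  kernel. Spaces are sets of representatives, not normed types, so analyticity is tested through one
  scalar functional: the integral over an interval whose coefficient in \<open>u(0)\<close> is
  nonzero. The number of intervals is one more than the total algebraic multiplicity of the
  eigenvalues of modulus at least \<rho>; this is where finite multiplicity is consumed. An open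
  branch maps exactly onto \<open>{0<..<1}\<close>, so preimages are taken of
  \<open>J \<inter> {0<..<1}\<close>, a change by a null set.\<close>

no_notation eqpoll (infixl "\<approx>" 50)

section \<open>Function spaces modulo null sets\<close>

lemma ae_eq_refl [simp]: "f \<approx> f"
  by (simp add: ae_eq_def)

lemma ae_eq_sym: "f \<approx> g \<Longrightarrow> g \<approx> f"
  unfolding ae_eq_def by (erule eventually_mono) simp

lemma ae_eq_trans [trans]: assumes "f \<approx> g" "g \<approx> h" shows "f \<approx> h"
  using assms unfolding ae_eq_def by eventually_elim simp

lemma ae_eq_add: 
  assumes "f \<approx> f'" "g \<approx> g'" shows "(\<lambda>x. f x + g x) \<approx> (\<lambda>x. f' x + g' x)"
  using assms unfolding ae_eq_def by eventually_elim simp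

lemma ae_eq_diff: 
  assumes "f \<approx> f'" "g \<approx> g'" shows "(\<lambda>x. f x - g x) \<approx> (\<lambda>x. f' x - g' x)"
  using assms unfolding ae_eq_def by eventually_elim simp

lemma ae_eq_scale: "f \<approx> f' \<Longrightarrow> (\<lambda>x. c * f x) \<approx> (\<lambda>x. c * f' x)"
  unfolding ae_eq_def by (erule eventually_mono) simp

lemma ae_eq_sum:
  "(\<And>i. i \<in> S \<Longrightarrow> f i \<approx> g i) \<Longrightarrow> (\<lambda>x. \<Sum>i\<in>S. f i x) \<approx> (\<lambda>x. \<Sum>i\<in>S. g i x)"
  by (induction S rule: infinite_finite_induct) (auto intro!: ae_eq_add)

lemma function_spaceD:
  assumes "function_space B"
  shows "B \<subseteq> L1" "(\<lambda>x. 0) \<in> B"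
    "\<And>f g. f \<in> B \<Longrightarrow> g \<in> B \<Longrightarrow> (\<lambda>x. f x + g x) \<in> B"
    "\<And>c f. f \<in> B \<Longrightarrow> (\<lambda>x. c * f x) \<in> B"
    "\<And>f g. f \<in> B \<Longrightarrow> f \<approx> g \<Longrightarrow> g \<in> B"
  using assms unfolding function_space_def by blast+

lemma function_space_diff:
  assumes "function_space B" "f \<in> B" "g \<in> B"
  shows "(\<lambda>x. f x - g x) \<in> B"
  using function_spaceD(3)[OF assms(1,2) function_spaceD(4)[OF assms(1,3), of "-1"]] by simp

lemma function_space_sum:
  assumes "function_space B" "\<And>i. i \<in> S \<Longrightarrow> f i \<in> B"
  shows "(\<lambda>x. \<Sum>i\<in>S. f i x) \<in> B"
  using assms(2)
  by (induction S rule: infinite_finite_induct)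
    (simp_all add: function_spaceD(2,3)[OF assms(1)])

lemma bounded_opD:
  assumes "bounded_op B N A"
  shows "\<And>f. f \<in> B \<Longrightarrow> A f \<in> B"
    "\<And>f g. f \<in> B \<Longrightarrow> g \<in> B \<Longrightarrow> f \<approx> g \<Longrightarrow> A f \<approx> A g"
    "\<And>f g. f \<in> B \<Longrightarrow> g \<in> B \<Longrightarrow> A (\<lambda>x. f x + g x) \<approx> (\<lambda>x. A f x + A g x)"
    "\<And>c f. f \<in> B \<Longrightarrow> A (\<lambda>x. c * f x) \<approx> (\<lambda>x. c * A f x)"
proof -
  note * = assms[unfolded bounded_op_def]
  show "A f \<in> B" if "f \<in> B" for f using that by (rule *[THEN conjunct1, rule_format])
  note * = *[THEN conjunct2]
  show "A f \<approx> A g" if "f \<in> B" "g \<in> B" "f \<approx> g" for f g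
    using that by (rule *[THEN conjunct1, rule_format])
  note * = *[THEN conjunct2]
  show "A (\<lambda>x. f x + g x) \<approx> (\<lambda>x. A f x + A g x)" if "f \<in> B" "g \<in> B" for f g
    using that by (rule *[THEN conjunct1, rule_format])
  note * = *[THEN conjunct2]
  show "A (\<lambda>x. c * f x) \<approx> (\<lambda>x. c * A f x)" if "f \<in> B" for c f
    using that by (rule *[THEN conjunct1, rule_format])
qed

lemma bounded_op_bound:
  assumes "bounded_op B N A" "\<And>f. f \<in> B \<Longrightarrow> N f \<ge> 0"
  obtains C where "C > 0" "\<And>f. f \<in> B \<Longrightarrow> N (A f) \<le> C * N f"
proof -
  obtain C where C: "\<And>f. f \<in> B \<Longrightarrow> N (A f) \<le> C * N f"
    using assms(1)[unfolded bounded_op_def, THEN conjunct2, THEN conjunct2, THEN conjunct2,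
        THEN conjunct2] by auto
  have "N (A f) \<le> max C 1 * N f" if "f \<in> B" for f
    using C[OF that] mult_right_mono[OF max.cobounded1[of C 1] assms(2)[OF that]] by linarith
  then show thesis
    by (intro that[of "max C 1"]) auto
qed

lemma bounded_op_diff:
  assumes "function_space B" "bounded_op B N A" "f \<in> B" "g \<in> B"
  shows "A (\<lambda>x. f x - g x) \<approx> (\<lambda>x. A f x - A g x)"
proof -
  have "A (\<lambda>x. f x + (-1) * g x) \<approx> (\<lambda>x. A f x + A (\<lambda>x. (-1) * g x) x)"
    by (intro bounded_opD(3)[OF assms(2)] assms function_spaceD(4)[OF assms(1)])
  also have "\<dots> \<approx> (\<lambda>x. A f x + (-1) * A g x)"
    by (intro ae_eq_add ae_eq_refl bounded_opD(4)[OF assms(2)] assms)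
  finally show ?thesis by simp
qed

lemma bounded_op_zero:
  assumes "function_space B" "bounded_op B N A"
  shows "A (\<lambda>x. 0) \<approx> (\<lambda>x. 0)"
  using bounded_opD(4)[OF assms(2) function_spaceD(2)[OF assms(1)], of 0] by simp

lemma bounded_op_sum:
  assumes "function_space B" "bounded_op B N A" "\<And>i. i \<in> S \<Longrightarrow> f i \<in> B"
  shows "A (\<lambda>x. \<Sum>i\<in>S. c i * f i x) \<approx> (\<lambda>x. \<Sum>i\<in>S. c i * A (f i) x)"
  using assms(3)
proof (induction S rule: infinite_finite_induct)
  case (insert i S)
  have "A (\<lambda>x. c i * f i x + (\<Sum>i\<in>S. c i * f i x)) \<approx>
      (\<lambda>x. A (\<lambda>x. c i * f i x) x + A (\<lambda>x. \<Sum>i\<in>S. c i * f i x) x)"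
  proof (rule bounded_opD(3)[OF assms(2)])
    show "(\<lambda>x. c i * f i x) \<in> B" "(\<lambda>x. \<Sum>i\<in>S. c i * f i x) \<in> B"
      using insert.prems function_spaceD(4)[OF assms(1)]
      by (auto intro!: function_space_sum[OF assms(1)])
  qed
  also have "\<dots> \<approx> (\<lambda>x. c i * A (f i) x + (\<Sum>i\<in>S. c i * A (f i) x))"
    using insert by (intro ae_eq_add bounded_opD(4)[OF assms(2)]) auto
  finally show ?case
    using insert.hyps by simp
qed (use bounded_op_zero[OF assms(1,2)] in simp_all)

text \<open>Meant for spectral projections: at an isolated eigenvalue the resolvent survives only on
  such a kernel, which therefore has to be a space in its own right.\<close>

lemma function_space_kernel:
  assumes "function_space B" "bounded_op B N A"
  shows "function_space {f \<in> B. A f \<approx> (\<lambda>x. 0)}"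
proof -
  note fs = function_spaceD[OF assms(1)] and bo = bounded_opD[OF assms(2)]
  have add: "A (\<lambda>x. f x + g x) \<approx> (\<lambda>x. 0)"
    if "f \<in> B" "A f \<approx> (\<lambda>x. 0)" "g \<in> B" "A g \<approx> (\<lambda>x. 0)" for f g
    using ae_eq_trans[OF bo(3)[OF that(1,3)] ae_eq_add[OF that(2,4)]] by simp
  have scale: "A (\<lambda>x. c * f x) \<approx> (\<lambda>x. 0)" if "f \<in> B" "A f \<approx> (\<lambda>x. 0)" for c f
    using ae_eq_trans[OF bo(4)[OF that(1)] ae_eq_scale[OF that(2)]] by simp
  have cong: "A g \<approx> (\<lambda>x. 0)" if "f \<in> B" "A f \<approx> (\<lambda>x. 0)" "f \<approx> g" for f g
    by (rule ae_eq_trans[OF ae_eq_sym[OF bo(2)[OF that(1) fs(5)[OF that(1,3)] that(3)]] that(2)])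
  have "{f \<in> B. A f \<approx> (\<lambda>x. 0)} \<subseteq> L1" using fs(1) by auto
  moreover have "(\<lambda>x. 0) \<in> {f \<in> B. A f \<approx> (\<lambda>x. 0)}"
    using fs(2) bounded_op_zero[OF assms] by simp
  moreover have "(\<lambda>x. f x + g x) \<in> {f \<in> B. A f \<approx> (\<lambda>x. 0)}"
    if "f \<in> {f \<in> B. A f \<approx> (\<lambda>x. 0)}" "g \<in> {f \<in> B. A f \<approx> (\<lambda>x. 0)}" for f g
    using that add[of f g] fs(3)[of f g] by simp
  moreover have "(\<lambda>x. c * f x) \<in> {f \<in> B. A f \<approx> (\<lambda>x. 0)}"
    if "f \<in> {f \<in> B. A f \<approx> (\<lambda>x. 0)}" for c f
    using that scale[of f c] fs(4)[of f c] by simp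
  moreover have "g \<in> {f \<in> B. A f \<approx> (\<lambda>x. 0)}"
    if "f \<in> {f \<in> B. A f \<approx> (\<lambda>x. 0)}" "f \<approx> g" for f g
    using that cong[of f g] fs(5)[of f g] by simp
  ultimately show ?thesis
    unfolding function_space_def by (intro conjI ballI allI impI)
qed

lemma banach_in_L1D:
  assumes "banach_in_L1 B N"
  shows "function_space B" "pseudo_norm_on B N" "\<forall>f\<in>B. N f = 0 \<longrightarrow> f \<approx> (\<lambda>x. 0)"
    "\<forall>F. (\<forall>i. F i \<in> B) \<and> (\<forall>e>0. \<exists>M. \<forall>i\<ge>M. \<forall>j\<ge>M. N (\<lambda>x. F i x - F j x) < e) \<longrightarrow>
        (\<exists>f\<in>B. (\<lambda>i. N (\<lambda>x. F i x - f x)) \<longlonglongrightarrow> 0)"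
    "\<exists>C. \<forall>f\<in>B. L1_norm f \<le> C * N f"
proof -
  note * = assms[unfolded banach_in_L1_def]
  show "function_space B" by (rule *[THEN conjunct1])
  note * = *[THEN conjunct2]
  show "pseudo_norm_on B N" by (rule *[THEN conjunct1])
  note * = *[THEN conjunct2]
  show "\<forall>f\<in>B. N f = 0 \<longrightarrow> f \<approx> (\<lambda>x. 0)" by (rule *[THEN conjunct1])
  note * = *[THEN conjunct2]
  show "\<forall>F. (\<forall>i. F i \<in> B) \<and> (\<forall>e>0. \<exists>M. \<forall>i\<ge>M. \<forall>j\<ge>M. N (\<lambda>x. F i x - F j x) < e) \<longrightarrow>
        (\<exists>f\<in>B. (\<lambda>i. N (\<lambda>x. F i x - f x)) \<longlonglongrightarrow> 0)" by (rule *[THEN conjunct1])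
  show "\<exists>C. \<forall>f\<in>B. L1_norm f \<le> C * N f" by (rule *[THEN conjunct2])
qed

lemma pseudo_norm_onD:
  assumes "pseudo_norm_on B N"
  shows "\<And>f. f \<in> B \<Longrightarrow> N f \<ge> 0"
    "\<And>f g. f \<in> B \<Longrightarrow> g \<in> B \<Longrightarrow> N (\<lambda>x. f x + g x) \<le> N f + N g"
    "\<And>c f. f \<in> B \<Longrightarrow> N (\<lambda>x. c * f x) = norm c * N f"
    "\<And>f g. f \<in> B \<Longrightarrow> g \<in> B \<Longrightarrow> f \<approx> g \<Longrightarrow> N f = N g"
proof -
  note * = assms[unfolded pseudo_norm_on_def]
  show "N f \<ge> 0" if "f \<in> B" for f using that by (rule *[THEN conjunct1, rule_format])
  note * = *[THEN conjunct2]
  show "N (\<lambda>x. f x + g x) \<le> N f + N g" if "f \<in> B" "g \<in> B" for f g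
    using that by (rule *[THEN conjunct1, rule_format])
  note * = *[THEN conjunct2]
  show "N (\<lambda>x. c * f x) = norm c * N f" if "f \<in> B" for c f
    using that by (rule *[THEN conjunct1, rule_format])
  show "N f = N g" if "f \<in> B" "g \<in> B" "f \<approx> g" for f g
    using that by (rule *[THEN conjunct2, rule_format])
qed

locale L1_banach =
  fixes B :: "(real \<Rightarrow> complex) set" and N :: "(real \<Rightarrow> complex) \<Rightarrow> real"
  assumes banach: "banach_in_L1 B N"
begin

lemma space: "function_space B"
  by (rule banach_in_L1D(1)[OF banach])

lemmas mem_zero = function_spaceD(2)[OF space]
lemmas mem_add = function_spaceD(3)[OF space]
lemmas mem_scale = function_spaceD(4)[OF space]
lemmas mem_cong = function_spaceD(5)[OF space]
lemmas mem_diff = function_space_diff[OF space]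
lemmas mem_sum = function_space_sum[OF space]

lemmas N_nonneg = pseudo_norm_onD(1)[OF banach_in_L1D(2)[OF banach]]
lemmas N_add = pseudo_norm_onD(2)[OF banach_in_L1D(2)[OF banach]]
lemmas N_scale = pseudo_norm_onD(3)[OF banach_in_L1D(2)[OF banach]]

lemma N_cong: "f \<in> B \<Longrightarrow> f \<approx> g \<Longrightarrow> N f = N g"
  by (rule pseudo_norm_onD(4)[OF banach_in_L1D(2)[OF banach] _ mem_cong])

lemma N_zero [simp]: "N (\<lambda>x. 0) = 0"
  using N_scale[OF mem_zero, of 0] by simp

lemma N_eq_0_iff:
  assumes "f \<in> B" shows "N f = 0 \<longleftrightarrow> f \<approx> (\<lambda>x. 0)"
  using assms banach_in_L1D(3)[OF banach] N_cong[OF assms, of "\<lambda>x. 0"] by auto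

lemma N_minus: "f \<in> B \<Longrightarrow> g \<in> B \<Longrightarrow> N (\<lambda>x. f x - g x) = N (\<lambda>x. g x - f x)"
  using N_scale[OF mem_diff[of g f], of "-1"] by simp

lemma N_diff: "f \<in> B \<Longrightarrow> g \<in> B \<Longrightarrow> N (\<lambda>x. f x - g x) \<le> N f + N g"
  using N_add[of f "\<lambda>x. (-1) * g x"] N_scale[of g "-1"] mem_scale[of g "-1"] by simp

lemma N_sum: "(\<And>i. i \<in> S \<Longrightarrow> f i \<in> B) \<Longrightarrow> N (\<lambda>x. \<Sum>i\<in>S. f i x) \<le> (\<Sum>i\<in>S. N (f i))"
proof (induction S rule: infinite_finite_induct)
  case (insert i S)
  then show ?case
    using N_add[of "f i" "\<lambda>x. \<Sum>i\<in>S. f i x"] mem_sum[of S f] by simp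
qed auto

lemma L1_norm_bound:
  obtains C where "C > 0" "\<And>f. f \<in> B \<Longrightarrow> L1_norm f \<le> C * N f"
proof -
  obtain C where C: "\<And>f. f \<in> B \<Longrightarrow> L1_norm f \<le> C * N f"
    using banach_in_L1D(5)[OF banach] by blast
  have "L1_norm f \<le> max C 1 * N f" if "f \<in> B" for f
    using C[OF that] mult_right_mono[OF max.cobounded1[of C 1] N_nonneg[OF that]] by linarith
  then show thesis
    by (intro that[of "max C 1"]) auto
qed

text \<open>Completeness in the shape used for power series in the spectral parameter and for atomic
  expansions: the triangle inequality bounds blocks of consecutive terms by blocks of the numerical
  series.\<close>

lemma series_converges:
  assumes f: "\<And>n. f n \<in> B" and sm: "summable (\<lambda>n. N (f n))"
  obtains g where "g \<in> B" "(\<lambda>M. N (\<lambda>x. (\<Sum>n<M. f n x) - g x)) \<longlonglongrightarrow> 0"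
proof -
  define S where "S M = (\<lambda>x. \<Sum>n<M. f n x)" for M :: nat
  have S: "S M \<in> B" for M
    unfolding S_def using f by (intro mem_sum) auto
  have le: "N (\<lambda>x. S i x - S j x) \<le> (\<Sum>n=j..<i. N (f n))" if "j \<le> i" for i j
  proof -
    have "(\<lambda>x. S i x - S j x) = (\<lambda>x. \<Sum>n=j..<i. f n x)"
      using sum_diff_nat_ivl[of 0 j i] that by (auto simp: S_def atLeast0LessThan)
    then show ?thesis using N_sum[of "{j..<i}" f] f by simp
  qed
  have "\<exists>M. \<forall>i\<ge>M. \<forall>j\<ge>M. N (\<lambda>x. S i x - S j x) < e" if "e > 0" for e
  proof -
    obtain M where M: "\<And>m n. m \<ge> M \<Longrightarrow> norm (\<Sum>n=m..<n. N (f n)) < e"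
      using sm \<open>e > 0\<close> unfolding summable_Cauchy by blast
    have "N (\<lambda>x. S i x - S j x) < e" if "i \<ge> M" "j \<ge> M" "j \<le> i" for i j
      using le[OF that(3)] M[OF that(2), of i] by simp
    then show ?thesis
      by (metis N_minus S nle_le)
  qed
  then have "\<exists>f\<in>B. (\<lambda>i. N (\<lambda>x. S i x - f x)) \<longlonglongrightarrow> 0"
    using S by (intro banach_in_L1D(4)[OF banach, THEN spec, THEN mp]) auto
  then obtain g where "g \<in> B" "(\<lambda>i. N (\<lambda>x. S i x - g x)) \<longlonglongrightarrow> 0" ..
  then show thesis by (intro that[of g]) (simp_all add: S_def)
qed

end


section \<open>Linear algebra for the choice of coefficients\<close>

text \<open>Gaussian elimination as an induction on the equations, over all coefficient families at
  once. A row that vanishes on \<open>S\<close> imposes nothing; otherwise a pivot column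
  \<open>p\<close> is removed and the other rows are corrected by multiples of row
  \<open>d\<close>.\<close>

lemma homogeneous_system_nontrivial:
  fixes a :: "'l \<Rightarrow> 'j \<Rightarrow> 'f::field"
  assumes "finite D" "finite S" "card D < card S"
  shows "\<exists>c. (\<exists>j\<in>S. c j \<noteq> 0) \<and> (\<forall>l\<in>D. (\<Sum>j\<in>S. c j * a l j) = 0)"
  using assms
proof (induction D arbitrary: S a rule: finite_induct)
  case empty
  then obtain j where "j \<in> S" by (auto simp: card_gt_0_iff)
  then show ?case by (intro exI[of _ "\<lambda>_. 1"]) auto
next
  case (insert d D)
  show ?case
  proof (cases "\<forall>j\<in>S. a d j = 0")
    case True
    then have "\<exists>c. (\<exists>j\<in>S. c j \<noteq> 0) \<and> (\<forall>l\<in>D. (\<Sum>j\<in>S. c j * a l j) = 0)"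
      using insert.hyps insert.prems by (intro insert.IH) auto
    then show ?thesis using True by auto
  next
    case False
    then obtain p where p: "p \<in> S" "a d p \<noteq> 0" by auto
    have "card D < card (S - {p})" using insert p by auto
    then obtain c where c: "\<exists>j\<in>S - {p}. c j \<noteq> 0"
      "\<And>l. l \<in> D \<Longrightarrow> (\<Sum>j\<in>S - {p}. c j * (a l j - a l p * a d j / a d p)) = 0"
      using insert.IH[of "S - {p}" "\<lambda>l j. a l j - a l p * a d j / a d p"] insert.prems by auto
    \<comment> \<open>The value of the pivot unknown that makes equation \<open>d\<close> hold; by
      the correction of the other rows, their equations then hold as well.\<close>
    define q where "q = - (\<Sum>j\<in>S - {p}. c j * a d j) / a d p"
    define c' where "c' = c(p := q)"
    have sm: "(\<Sum>j\<in>S. c' j * a l j) = q * a l p + (\<Sum>j\<in>S - {p}. c j * a l j)" for l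
      using insert.prems p by (subst sum.remove[of S p]) (auto simp: c'_def)
    have "(\<Sum>j\<in>S. c' j * a l j) = 0" if "l \<in> D" for l
    proof -
      have "(\<Sum>j\<in>S - {p}. c j * a l j) - a l p / a d p * (\<Sum>j\<in>S - {p}. c j * a d j) = 0"
        using c(2)[OF that] by (simp add: sum_distrib_left sum_subtractf[symmetric] algebra_simps)
      then show ?thesis unfolding sm q_def by (simp add: field_simps)
    qed
    moreover have "(\<Sum>j\<in>S. c' j * a d j) = 0"
      unfolding sm q_def using p by simp
    moreover have "\<exists>j\<in>S. c' j \<noteq> 0" using c(1) by (auto simp: c'_def)
    ultimately show ?thesis by blast
  qed
qed

section \<open>Scalar tests of solutions with values in \<open>B\<close>\<close>

text \<open>Solutions depending on a complex parameter are only ever tested on the numbers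
  \<open>\<Phi> f\<close>, so that scalar complex analysis applies to them. The sign of
  \<open>b\<close> is left open, hence \<open>\<bar>b\<bar>\<close> in the estimates.\<close>

locale L1_functional = L1_banach +
  fixes \<Phi> :: "(real \<Rightarrow> complex) \<Rightarrow> complex" and b :: real
  assumes fun_add: "f \<in> B \<Longrightarrow> g \<in> B \<Longrightarrow> \<Phi> (\<lambda>x. f x + g x) = \<Phi> f + \<Phi> g"
    and fun_scale: "f \<in> B \<Longrightarrow> \<Phi> (\<lambda>x. c * f x) = c * \<Phi> f"
    and fun_bound: "f \<in> B \<Longrightarrow> norm (\<Phi> f) \<le> b * N f"
begin

lemma fun_diff: "f \<in> B \<Longrightarrow> g \<in> B \<Longrightarrow> \<Phi> (\<lambda>x. f x - g x) = \<Phi> f - \<Phi> g"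
  using fun_add[of f "\<lambda>x. (-1) * g x"] mem_scale[of g "-1"] fun_scale[of g "-1"] by simp

lemma fun_cong: assumes "f \<in> B" "f \<approx> g" shows "\<Phi> f = \<Phi> g"
proof -
  have g: "g \<in> B" using assms mem_cong by blast
  have "N (\<lambda>x. f x - g x) = 0"
    using ae_eq_diff[OF assms(2) ae_eq_refl[of g]] N_eq_0_iff[OF mem_diff[OF assms(1) g]] by simp
  then show ?thesis
    using fun_bound[OF mem_diff[OF assms(1) g]] fun_diff[OF assms(1) g] by simp
qed

lemma fun_sum: "(\<And>i. i \<in> S \<Longrightarrow> f i \<in> B) \<Longrightarrow> \<Phi> (\<lambda>x. \<Sum>i\<in>S. f i x) = (\<Sum>i\<in>S. \<Phi> (f i))"
proof (induction S rule: infinite_finite_induct)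
  case (insert i S)
  then show ?case using fun_add[of "f i" "\<lambda>x. \<Sum>i\<in>S. f i x"] mem_sum[of S f] by simp
qed (use fun_scale[OF mem_zero, of 0] in auto)

text \<open>Subtracting the equations at \<open>w\<close> and \<open>z\<close> gives
  \<open>(z - A) (U w - U z) = (z - w) U w\<close>, and the left inverse \<open>R\<close> turns this
  into a difference quotient with limit \<open>- \<Phi> (R (U z))\<close>. The points
  \<open>w\<close> may themselves lie in the spectrum and the solutions \<open>U w\<close> may come
  from anywhere, which allows \<open>U\<close> to be pieced together from unrelated
  constructions.\<close>

lemma resolvent_solution_differentiable:
  assumes A: "bounded_op B N A" and K: "function_space K" "K \<subseteq> B"
    and R: "bounded_op K N R" "\<And>f. f \<in> K \<Longrightarrow> R (\<lambda>x. z * f x - A f x) \<approx> f"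
    and U: "\<And>w. dist w z < \<delta> \<Longrightarrow> U w \<in> K"
      "\<And>w. dist w z < \<delta> \<Longrightarrow> (\<lambda>x. w * U w x - A (U w) x) \<approx> h"
    and "\<delta> > 0"
  shows "(\<lambda>w. \<Phi> (U w)) field_differentiable (at z)"
proof -
  note Kd = function_spaceD[OF K(1)]
  have KN: "f \<in> K \<Longrightarrow> N f \<ge> 0" for f using K(2) N_nonneg by blast
  obtain C where C: "C > 0" "\<And>f. f \<in> K \<Longrightarrow> N (R f) \<le> C * N f"
    using bounded_op_bound[OF R(1) KN] by blast
  have Uz: "U z \<in> K" "(\<lambda>x. z * U z x - A (U z) x) \<approx> h" using U \<open>\<delta> > 0\<close> by auto
  define d where "d w = (\<lambda>x. U w x - U z x)" for w
  have dK: "d w \<in> K" if "dist w z < \<delta>" for w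
    unfolding d_def using function_space_diff[OF K(1) U(1)[OF that] Uz(1)] .
  have RK: "f \<in> K \<Longrightarrow> R f \<in> B" for f using bounded_opD(1)[OF R(1)] K(2) by blast
  \<comment> \<open>No continuity of \<open>U\<close> is known beforehand, so \<open>U w\<close> is
    split as \<open>U z + d w\<close>; the unknown increment reappears on the right, but with the
    small factor \<open>z - w\<close>.\<close>
  have key: "d w \<approx> (\<lambda>x. (z - w) * (R (U z) x + R (d w) x))" if w: "dist w z < \<delta>" for w
  proof -
    have "A (d w) \<approx> (\<lambda>x. A (U w) x - A (U z) x)"
      unfolding d_def using bounded_op_diff[OF space A] U(1)[OF w] Uz(1) K(2) by blast
    with U(2)[OF w] Uz(2) have eq: "(\<lambda>x. (z - w) * U w x) \<approx> (\<lambda>x. z * d w x - A (d w) x)"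
      unfolding ae_eq_def d_def by eventually_elim (simp add: algebra_simps)
    have mem: "(\<lambda>x. (z - w) * U w x) \<in> K" using Kd U w by blast
    have "d w \<approx> R (\<lambda>x. z * d w x - A (d w) x)" using R(2)[OF dK[OF w]] ae_eq_sym by blast
    also have "\<dots> \<approx> R (\<lambda>x. (z - w) * U w x)"
      using bounded_opD(2)[OF R(1) mem Kd(5)[OF mem eq] eq] ae_eq_sym by blast
    also have "\<dots> \<approx> (\<lambda>x. (z - w) * R (U w) x)"
      using bounded_opD(4)[OF R(1)] U w by blast
    also have "\<dots> \<approx> (\<lambda>x. (z - w) * (R (U z) x + R (d w) x))"
    proof (rule ae_eq_scale)
      have "U w = (\<lambda>x. U z x + d w x)" unfolding d_def by simp
      then show "R (U w) \<approx> (\<lambda>x. R (U z) x + R (d w) x)"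
        using bounded_opD(3)[OF R(1) Uz(1) dK[OF w]] by simp
    qed
    finally show ?thesis .
  qed
  \<comment> \<open>The factor 2 comes from absorbing the term in \<open>N (d w)\<close>, whose
    coefficient is at most 1/2 close to \<open>z\<close>.\<close>
  define M where "M = 2 * C * N (U z)"
  have small: "N (d w) \<le> norm (z - w) * M"
    if w: "dist w z < \<delta>" "norm (z - w) * C \<le> 1 / 2" for w
  proof -
    have mem: "d w \<in> B" "R (U z) \<in> B" "R (d w) \<in> B"
      using Uz(1) dK[OF w(1)] K(2) RK by auto
    have "N (d w) = norm (z - w) * N (\<lambda>x. R (U z) x + R (d w) x)"
      unfolding N_cong[OF mem(1) key[OF w(1)]] by (rule N_scale[OF mem_add[OF mem(2,3)]])
    also have "\<dots> \<le> norm (z - w) * (C * N (U z) + C * N (d w))"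
      using N_add[OF RK[OF Uz(1)] RK[OF dK[OF w(1)]]] C(2)[OF Uz(1)] C(2)[OF dK[OF w(1)]]
      by (intro mult_left_mono) auto
    also have "\<dots> = norm (z - w) * C * N (U z) + (norm (z - w) * C) * N (d w)"
      by (simp add: algebra_simps)
    also have "\<dots> \<le> norm (z - w) * C * N (U z) + 1 / 2 * N (d w)"
      using w(2) KN[OF dK[OF w(1)]] by (intro add_left_mono mult_right_mono) auto
    finally show ?thesis unfolding M_def by simp
  qed
  have quot: "(\<Phi> (U w) - \<Phi> (U z)) / (w - z) = - \<Phi> (R (U z)) - \<Phi> (R (d w))"
    if w: "dist w z < \<delta>" "w \<noteq> z" for w
  proof -
    have mem: "U w \<in> B" "U z \<in> B" "d w \<in> B" "R (U z) \<in> B" "R (d w) \<in> B"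
      using U(1)[OF w(1)] Uz(1) dK[OF w(1)] K(2) RK by auto
    have "\<Phi> (U w) - \<Phi> (U z) = \<Phi> (d w)"
      unfolding d_def using fun_diff[OF mem(1,2)] by (rule sym)
    also have "\<dots> = \<Phi> (\<lambda>x. (z - w) * (R (U z) x + R (d w) x))"
      by (rule fun_cong[OF mem(3) key[OF w(1)]])
    also have "\<dots> = (z - w) * (\<Phi> (R (U z)) + \<Phi> (R (d w)))"
      unfolding fun_scale[OF mem_add[OF mem(4,5)]] fun_add[OF mem(4,5)] ..
    finally show ?thesis using w(2) by (simp add: field_simps)
  qed
  have cl: "norm (\<Phi> f) \<le> \<bar>b\<bar> * N f" if "f \<in> B" for f
    using fun_bound[OF that] mult_right_mono[OF abs_ge_self[of b] N_nonneg[OF that]] by linarith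
  have ev1: "eventually (\<lambda>w. dist w z < \<delta> \<and> norm (z - w) * C \<le> 1 / 2 \<and> w \<noteq> z) (at z)"
    unfolding eventually_at
  proof (intro exI[of _ "min \<delta> (1 / (2 * C))"] conjI ballI impI)
    show "0 < min \<delta> (1 / (2 * C))" using C(1) \<open>\<delta> > 0\<close> by simp
    fix w assume "w \<noteq> z \<and> dist w z < min \<delta> (1 / (2 * C))"
    then show "dist w z < \<delta>" "w \<noteq> z" "norm (z - w) * C \<le> 1 / 2"
      using C(1) by (auto simp: dist_norm norm_minus_commute field_simps)
  qed
  have "((\<lambda>w. \<Phi> (R (d w))) \<longlongrightarrow> 0) (at z)"
  proof (rule Lim_null_comparison)
    show "eventually (\<lambda>w. norm (\<Phi> (R (d w))) \<le> \<bar>b\<bar> * C * M * norm (z - w)) (at z)"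
      using ev1
    proof eventually_elim
      case (elim w)
      have "norm (\<Phi> (R (d w))) \<le> \<bar>b\<bar> * N (R (d w))" using cl RK dK elim by blast
      also have "\<dots> \<le> \<bar>b\<bar> * (C * (norm (z - w) * M))"
        using C(2)[OF dK] small[of w] elim C(1)
        by (intro mult_left_mono) (auto intro: order_trans[OF C(2)[OF dK]] mult_left_mono)
      finally show ?case by (simp add: algebra_simps)
    qed
    have "((\<lambda>w. \<bar>b\<bar> * C * M * norm (z - w)) \<longlongrightarrow> \<bar>b\<bar> * C * M * norm (z - z)) (at z)"
      by (intro tendsto_intros)
    then show "((\<lambda>w. \<bar>b\<bar> * C * M * norm (z - w)) \<longlongrightarrow> 0) (at z)" by simp
  qed
  then have "((\<lambda>w. - \<Phi> (R (U z)) - \<Phi> (R (d w))) \<longlongrightarrow> - \<Phi> (R (U z)) - 0) (at z)"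
    by (intro tendsto_intros)
  moreover have "eventually (\<lambda>w. - \<Phi> (R (U z)) - \<Phi> (R (d w)) = (\<Phi> (U w) - \<Phi> (U z)) / (w - z)) (at z)"
    using ev1 by eventually_elim (simp add: quot)
  ultimately have "((\<lambda>w. (\<Phi> (U w) - \<Phi> (U z)) / (w - z)) \<longlongrightarrow> - \<Phi> (R (U z)) - 0) (at z)"
    by (rule Lim_transform_eventually)
  then have "((\<lambda>w. \<Phi> (U w)) has_field_derivative (- \<Phi> (R (U z)) - 0)) (at z)"
    by (simp add: has_field_derivative_iff)
  then show ?thesis unfolding field_differentiable_def ..
qed

end

section \<open>Resolvents and entire solutions\<close>

lemma not_in_spectrum_unique:
  assumes "function_space B" "bounded_op B N A" "z \<notin> spectrum B N A"
    and "v \<in> B" "(\<lambda>x. z * v x - A v x) \<approx> (\<lambda>x. 0)"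
  shows "v \<approx> (\<lambda>x. 0)"
proof -
  obtain R where R: "bounded_op B N R" "\<And>f. f \<in> B \<Longrightarrow> R (\<lambda>x. z * f x - A f x) \<approx> f"
    using assms(3) unfolding spectrum_def by blast
  have mem: "(\<lambda>x. z * v x - A v x) \<in> B"
    using function_space_diff[OF assms(1) function_spaceD(4)[OF assms(1,4)] bounded_opD(1)[OF assms(2,4)]] .
  have "v \<approx> R (\<lambda>x. z * v x - A v x)" by (rule ae_eq_sym[OF R(2)[OF assms(4)]])
  also have "\<dots> \<approx> R (\<lambda>x. 0)"
    by (rule bounded_opD(2)[OF R(1) mem function_spaceD(2)[OF assms(1)] assms(5)])
  also have "\<dots> \<approx> (\<lambda>x. 0)" by (rule bounded_op_zero[OF assms(1) R(1)])
  finally show ?thesis .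
qed

context L1_banach
begin

text \<open>Eigenvalues are bounded by the operator bound, so an infinite set would have a limit
  point \<open>w\<close>, of modulus at least \<open>\<rho>\<close> and hence beyond
  \<open>r'\<close>. If \<open>w\<close> is in the spectrum, this contradicts isolation. If not, the
  resolvent at \<open>w\<close> would magnify eigenvectors for \<open>z\<close> near
  \<open>w\<close> by the factor \<open>1 / norm (w - z)\<close>, contradicting its
  boundedness.\<close>

lemma finite_spectrum_outside_disc:
  assumes A: "bounded_op B N A" and "r' < \<rho>"
    and ev: "\<And>z. z \<in> spectrum B N A \<Longrightarrow> norm z > r' \<Longrightarrow>
      eigenvalue B A z \<and> z isolated_in spectrum B N A"
  shows "finite {z \<in> spectrum B N A. \<rho> \<le> norm z}" (is "finite ?S")
proof (rule ccontr)
  assume inf: "infinite ?S"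
  have eig: "\<exists>f\<in>B. N f > 0 \<and> A f \<approx> (\<lambda>x. z * f x)" if "z \<in> ?S" for z
  proof -
    have "eigenvalue B A z" using ev[of z] that \<open>r' < \<rho>\<close> by simp
    then obtain f where f: "f \<in> B" "\<not> f \<approx> (\<lambda>x. 0)" "A f \<approx> (\<lambda>x. z * f x)"
      unfolding eigenvalue_def by blast
    moreover have "N f > 0" using N_nonneg[OF f(1)] N_eq_0_iff[OF f(1)] f(2) by linarith
    ultimately show ?thesis by blast
  qed
  obtain C where C: "C > 0" "\<And>f. f \<in> B \<Longrightarrow> N (A f) \<le> C * N f"
    using bounded_op_bound[OF A N_nonneg] by blast
  have "?S \<subseteq> cball 0 C"
  proof
    fix z assume "z \<in> ?S"
    then obtain f where f: "f \<in> B" "N f > 0" "A f \<approx> (\<lambda>x. z * f x)" using eig by blast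
    have "norm z * N f \<le> C * N f"
      using C(2)[OF f(1)] N_cong[OF bounded_opD(1)[OF A f(1)] f(3)] N_scale[OF f(1), of z] by simp
    then show "z \<in> cball 0 C" using f(2) by simp
  qed
  then obtain w where w: "w islimpt ?S"
    using Heine_Borel_imp_Bolzano_Weierstrass[OF compact_cball inf] by blast
  have "closed {z :: complex. \<rho> \<le> norm z}"
    by (intro closed_Collect_le continuous_intros)
  moreover have "w islimpt {z. \<rho> \<le> norm z}" by (rule islimpt_subset[OF w]) auto
  ultimately have wr: "\<rho> \<le> norm w" unfolding closed_limpt by blast
  show False
  proof (cases "w \<in> spectrum B N A")
    case True
    then have "w isolated_in spectrum B N A" using ev wr \<open>r' < \<rho>\<close> by auto
    moreover have "w islimpt spectrum B N A" by (rule islimpt_subset[OF w]) auto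
    ultimately show False by (simp add: isolated_in_islimpt_iff)
  next
    case False
    then obtain R where R: "bounded_op B N R" "\<And>f. f \<in> B \<Longrightarrow> R (\<lambda>x. w * f x - A f x) \<approx> f"
      unfolding spectrum_def by blast
    obtain D where D: "D > 0" "\<And>f. f \<in> B \<Longrightarrow> N (R f) \<le> D * N f"
      using bounded_op_bound[OF R(1) N_nonneg] by blast
    \<comment> \<open>At distance less than \<open>1 / D\<close> from \<open>w\<close>, the identity
      \<open>f = (w - z) R f\<close> is incompatible with the bound \<open>D\<close> on
      \<open>R\<close>.\<close>
    obtain z where z: "z \<in> ?S" "dist z w < 1 / D"
      using w D(1) unfolding islimpt_approachable by (meson zero_less_divide_1_iff)
    obtain f where f: "f \<in> B" "N f > 0" "A f \<approx> (\<lambda>x. z * f x)" using eig z by blast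
    have eq: "(\<lambda>x. (w - z) * f x) \<approx> (\<lambda>x. w * f x - A f x)"
      using ae_eq_diff[OF ae_eq_refl[of "\<lambda>x. w * f x"] ae_eq_sym[OF f(3)]]
      by (simp add: algebra_simps)
    have mem: "(\<lambda>x. (w - z) * f x) \<in> B" by (rule mem_scale[OF f(1)])
    have "f \<approx> R (\<lambda>x. w * f x - A f x)" by (rule ae_eq_sym[OF R(2)[OF f(1)]])
    also have "\<dots> \<approx> R (\<lambda>x. (w - z) * f x)"
      by (rule ae_eq_sym[OF bounded_opD(2)[OF R(1) mem mem_cong[OF mem eq] eq]])
    also have "\<dots> \<approx> (\<lambda>x. (w - z) * R f x)" by (rule bounded_opD(4)[OF R(1) f(1)])
    finally have "N f = norm (w - z) * N (R f)"
      using N_cong[OF f(1)] N_scale[OF bounded_opD(1)[OF R(1) f(1)]] by simp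
    also have "\<dots> \<le> norm (w - z) * (D * N f)"
      using D(2)[OF f(1)] by (intro mult_left_mono) auto
    also have "\<dots> = (dist z w * D) * N f" by (simp add: dist_norm norm_minus_commute)
    also have "\<dots> < 1 * N f"
      using z(2) D(1) f(2) by (intro mult_strict_right_mono) (auto simp: field_simps)
    finally show False by simp
  qed
qed

end

context L1_functional
begin

lemma fun_bound_abs: assumes "f \<in> B" shows "norm (\<Phi> f) \<le> \<bar>b\<bar> * N f"
  using fun_bound[OF assms] mult_right_mono[OF abs_ge_self[of b] N_nonneg[OF assms]] by linarith

text \<open>\<open>A\<close> shifts partial sums: \<open>A (S (Suc M))\<close> is
  \<open>A (G 0) + z S M\<close>, and the equation appears in the limit. The closed disc is covered
  because the norms are summable at the radius \<open>\<rho>\<close> itself.\<close>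

lemma power_series_solution:
  assumes A: "bounded_op B N A" and G: "\<And>n. G n \<in> B" "\<And>n. A (G (Suc n)) \<approx> G n"
    and sm: "summable (\<lambda>n. \<rho> ^ n * N (G n))" and z: "norm z \<le> \<rho>"
  shows "\<exists>g\<in>B. (\<lambda>x. z * g x - A g x) \<approx> (\<lambda>x. - A (G 0) x) \<and> (\<lambda>n. z ^ n * \<Phi> (G n)) sums \<Phi> g"
proof -
  have "\<rho> \<ge> 0" using z norm_ge_zero order_trans by blast
  define F where "F n = (\<lambda>x. z ^ n * G n x)" for n
  define S where "S M = (\<lambda>x. \<Sum>n<M. F n x)" for M :: nat
  have F: "F n \<in> B" for n unfolding F_def by (rule mem_scale[OF G(1)])
  have S: "S M \<in> B" for M unfolding S_def by (intro mem_sum F)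
  have "summable (\<lambda>n. N (F n))"
  proof (rule summable_comparison_test'[OF sm, of 0])
    fix n
    have "N (F n) = norm z ^ n * N (G n)"
      unfolding F_def N_scale[OF G(1)] by (simp add: norm_power)
    also have "\<dots> \<le> \<rho> ^ n * N (G n)"
      using z N_nonneg[OF G(1)] by (intro mult_right_mono power_mono) auto
    finally show "norm (N (F n)) \<le> \<rho> ^ n * N (G n)" using N_nonneg[OF F] by simp
  qed
  then obtain g where g: "g \<in> B" and lim: "(\<lambda>M. N (\<lambda>x. S M x - g x)) \<longlonglongrightarrow> 0"
    using series_converges[of F] F unfolding S_def by metis
  have FS: "\<Phi> (S M) = (\<Sum>n<M. z ^ n * \<Phi> (G n))" for M
    unfolding S_def fun_sum[OF F] unfolding F_def fun_scale[OF G(1)] ..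
  have "(\<lambda>M. \<Phi> (S M) - \<Phi> g) \<longlonglongrightarrow> 0"
  proof (rule Lim_null_comparison[OF always_eventually])
    show "\<forall>M. norm (\<Phi> (S M) - \<Phi> g) \<le> \<bar>b\<bar> * N (\<lambda>x. S M x - g x)"
      using fun_bound_abs[OF mem_diff[OF S g]] unfolding fun_diff[OF S g] by blast
    show "(\<lambda>M. \<bar>b\<bar> * N (\<lambda>x. S M x - g x)) \<longlonglongrightarrow> 0" by (rule tendsto_mult_right_zero[OF lim])
  qed
  then have sums: "(\<lambda>n. z ^ n * \<Phi> (G n)) sums \<Phi> g"
    unfolding sums_def FS by (simp add: LIM_zero_iff)
  obtain C where C: "C > 0" "\<And>f. f \<in> B \<Longrightarrow> N (A f) \<le> C * N f"
    using bounded_op_bound[OF A N_nonneg] by blast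
  have AS: "A (S (Suc M)) \<approx> (\<lambda>x. A (G 0) x + z * S M x)" for M
  proof -
    have "A (S (Suc M)) \<approx> (\<lambda>x. \<Sum>n<Suc M. z ^ n * A (G n) x)"
      unfolding S_def F_def by (rule bounded_op_sum[OF space A G(1)])
    also have "\<dots> = (\<lambda>x. A (G 0) x + (\<Sum>n<M. z * z ^ n * A (G (Suc n)) x))"
      by (simp only: sum.lessThan_Suc_shift) simp
    also have "\<dots> \<approx> (\<lambda>x. A (G 0) x + (\<Sum>n<M. z * z ^ n * G n x))"
      by (intro ae_eq_add ae_eq_refl ae_eq_sum ae_eq_scale G(2))
    finally show ?thesis unfolding S_def F_def by (simp add: sum_distrib_left mult.assoc)
  qed
  \<comment> \<open>The residual of the equation is one fixed element, bounded for every
    \<open>M\<close> by multiples of two distances of partial sums from \<open>g\<close>; so its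
    norm is 0.\<close>
  define D where "D = (\<lambda>x. z * g x - A g x + A (G 0) x)"
  have AB: "f \<in> B \<Longrightarrow> A f \<in> B" for f by (rule bounded_opD(1)[OF A])
  have D: "D \<in> B" unfolding D_def by (intro mem_add mem_diff mem_scale AB G(1) g)
  have bound: "N D \<le> norm z * N (\<lambda>x. S M x - g x) + C * N (\<lambda>x. S (Suc M) x - g x)" for M
  proof -
    have d: "(\<lambda>x. S M x - g x) \<in> B" for M by (rule mem_diff[OF S g])
    have "A (\<lambda>x. S (Suc M) x - g x) \<approx> (\<lambda>x. A (S (Suc M)) x - A g x)"
      by (rule bounded_op_diff[OF space A S g])
    with AS[of M] have "D \<approx> (\<lambda>x. A (\<lambda>x. S (Suc M) x - g x) x - z * (S M x - g x))"
      unfolding ae_eq_def D_def by eventually_elim (simp add: algebra_simps)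
    then have "N D = N (\<lambda>x. A (\<lambda>x. S (Suc M) x - g x) x - z * (S M x - g x))"
      by (rule N_cong[OF D])
    also have "\<dots> \<le> N (A (\<lambda>x. S (Suc M) x - g x)) + norm z * N (\<lambda>x. S M x - g x)"
      using N_diff[OF AB[OF d[of "Suc M"]] mem_scale[OF d[of M], of z]] unfolding N_scale[OF d] .
    finally show ?thesis using C(2)[OF d[of "Suc M"]] by simp
  qed
  have "(\<lambda>M. norm z * N (\<lambda>x. S M x - g x) + C * N (\<lambda>x. S (Suc M) x - g x)) \<longlonglongrightarrow> 0"
    using tendsto_add[OF tendsto_mult_right_zero[OF lim] tendsto_mult_right_zero[OF LIMSEQ_Suc[OF lim]]]
    by simp
  then have "N D \<le> 0"
    by (rule LIMSEQ_le_const) (use bound in blast)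
  then have "D \<approx> (\<lambda>x. 0)" using N_eq_0_iff[OF D] N_nonneg[OF D] by simp
  then have "(\<lambda>x. z * g x - A g x) \<approx> (\<lambda>x. - A (G 0) x)"
    unfolding ae_eq_def D_def by eventually_elim (simp add: eq_neg_iff_add_eq_0)
  with g sums show ?thesis by blast
qed

text \<open>Once \<open>norm z\<close> is at least twice the operator bound, the term
  \<open>A (U z)\<close> costs at most half of \<open>z * U z\<close>. Solutions therefore decay
  like \<open>1 / norm z\<close>, and Liouville's theorem applies.\<close>

lemma entire_solution_vanishes:
  assumes A: "bounded_op B N A" and U: "\<And>z. U z \<in> B" "\<And>z. (\<lambda>x. z * U z x - A (U z) x) \<approx> h"
    and hol: "(\<lambda>z. \<Phi> (U z)) holomorphic_on UNIV"
  shows "\<Phi> (U z) = 0"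
proof (rule Liouville_weak_0[OF hol])
  obtain C where C: "C > 0" "\<And>f. f \<in> B \<Longrightarrow> N (A f) \<le> C * N f"
    using bounded_op_bound[OF A N_nonneg] by blast
  have AB: "f \<in> B \<Longrightarrow> A f \<in> B" for f by (rule bounded_opD(1)[OF A])
  have h: "h \<in> B" by (rule mem_cong[OF mem_diff[OF mem_scale[OF U(1)] AB[OF U(1)]] U(2)[of 0]])
  have bd: "norm (\<Phi> (U z)) \<le> 2 * \<bar>b\<bar> * N h / norm z" if z: "norm z \<ge> 2 * C" for z
  proof -
    have "(\<lambda>x. z * U z x) \<approx> (\<lambda>x. h x + A (U z) x)"
      using U(2)[of z] unfolding ae_eq_def by eventually_elim (auto simp: algebra_simps)
    then have "norm z * N (U z) = N (\<lambda>x. h x + A (U z) x)"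
      using N_cong[OF mem_scale[OF U(1)]] N_scale[OF U(1)] by metis
    also have "\<dots> \<le> N h + C * N (U z)"
      using N_add[OF h AB[OF U(1)[of z]]] C(2)[OF U(1)[of z]] by linarith
    also have "\<dots> \<le> N h + norm z / 2 * N (U z)"
      using z N_nonneg[OF U(1)[of z]] by (intro add_left_mono mult_right_mono) auto
    finally have "norm z * N (U z) \<le> 2 * N h" by simp
    moreover have "norm z > 0" using z C(1) by linarith
    ultimately have "N (U z) \<le> 2 * N h / norm z" by (simp add: pos_le_divide_eq mult.commute)
    then have "\<bar>b\<bar> * N (U z) \<le> \<bar>b\<bar> * (2 * N h / norm z)" by (intro mult_left_mono) auto
    then show ?thesis using fun_bound_abs[OF U(1)[of z]] by (simp add: mult_ac)
  qed
  show "((\<lambda>z. \<Phi> (U z)) \<longlongrightarrow> 0) at_infinity"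
  proof (rule Lim_null_comparison)
    show "\<forall>\<^sub>F z in at_infinity. norm (\<Phi> (U z)) \<le> 2 * \<bar>b\<bar> * N h / norm z"
      unfolding eventually_at_infinity using bd by blast
    show "((\<lambda>z::complex. 2 * \<bar>b\<bar> * N h / norm z) \<longlongrightarrow> 0) at_infinity"
      by (intro tendsto_divide_0[OF tendsto_const] filterlim_at_top_imp_at_infinity filterlim_norm_at_top)
  qed
qed

end


text \<open>Boundedness is the embedding into \<open>L1\<close>. The set \<open>E\<close> is left
  free so that it can later be the interval whose coefficient is to be detected.\<close>

lemma integral_functional:
  assumes "banach_in_L1 B N" "E \<in> sets lebesgue"
  obtains b where "L1_functional B N (\<lambda>f. \<integral>x. indicator E x * f x \<partial>lebesgue_on {0..1}) b"
proof -
  interpret L1_banach B N using assms(1) by unfold_locales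
  obtain C where C: "C > 0" "\<And>f. f \<in> B \<Longrightarrow> L1_norm f \<le> C * N f"
    using L1_norm_bound by blast
  have int: "integrable (lebesgue_on {0..1}) f" if "f \<in> B" for f
    using that function_spaceD(1)[OF space] unfolding L1_def by blast
  have E: "E \<inter> {0..1} \<in> sets (lebesgue_on {0..1})"
    using assms(2) by (auto simp: sets_restrict_space)
  have int': "integrable (lebesgue_on {0..1}) (\<lambda>x. indicator E x * f x)" if "f \<in> B" for f
  proof -
    have "integrable (lebesgue_on {0..1}) (\<lambda>x. indicator (E \<inter> {0..1}) x *\<^sub>R f x)"
      by (rule integrable_mult_indicator[OF E int[OF that]])
    then show ?thesis
      by (rule Bochner_Integration.integrable_cong[THEN iffD1, OF refl, rotated])
        (auto simp: indicator_def)
  qed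
  show thesis
  proof (intro that[of C] L1_functional.intro L1_functional_axioms.intro L1_banach_axioms)
    fix f g c assume f: "f \<in> B"
    show "(\<integral>x. indicator E x * (c * f x) \<partial>lebesgue_on {0..1}) =
        c * (\<integral>x. indicator E x * f x \<partial>lebesgue_on {0..1})"
      by (subst integral_mult_right_zero[symmetric]) (simp add: mult_ac)
    have "norm (\<integral>x. indicator E x * f x \<partial>lebesgue_on {0..1}) \<le>
        (\<integral>x. norm (indicator E x * f x) \<partial>lebesgue_on {0..1})"
      by (rule integral_norm_bound)
    also have "\<dots> \<le> L1_norm f"
      unfolding L1_norm_def
      by (intro integral_mono integrable_norm int' int f) (auto simp: norm_mult indicator_def)
    finally show "norm (\<integral>x. indicator E x * f x \<partial>lebesgue_on {0..1}) \<le> C * N f"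
      using C(2)[OF f] by simp
    assume g: "g \<in> B"
    show "(\<integral>x. indicator E x * (f x + g x) \<partial>lebesgue_on {0..1}) =
        (\<integral>x. indicator E x * f x \<partial>lebesgue_on {0..1}) + (\<integral>x. indicator E x * g x \<partial>lebesgue_on {0..1})"
      unfolding distrib_left by (rule Bochner_Integration.integral_add[OF int'[OF f] int'[OF g]])
  qed
qed

text \<open>The projection commutes with \<open>A\<close>, so \<open>p u\<close> solves the
  homogeneous equation at \<open>w\<close>. The projection belongs to \<open>z\<close>, whereas
  \<open>w\<close> is any point off the spectrum, in the application one close to
  \<open>z\<close>.\<close>

lemma spectral_projection_kernel:
  assumes "function_space B" "bounded_op B N A" "spectral_projection B N A z p"
    and w: "w \<notin> spectrum B N A" and u: "u \<in> B" "(\<lambda>x. w * u x - A u x) \<approx> h"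
    and h: "p h \<approx> (\<lambda>x. 0)"
  shows "p u \<approx> (\<lambda>x. 0)"
proof -
  have p: "bounded_op B N p" and comm: "A (p u) \<approx> p (A u)"
    using assms(3) u(1) unfolding spectral_projection_def by blast+
  note mem = function_spaceD[OF assms(1)]
  have wu: "(\<lambda>x. w * u x) \<in> B" "A u \<in> B" "(\<lambda>x. w * u x - A u x) \<in> B"
    using mem(4)[OF u(1)] bounded_opD(1)[OF assms(2) u(1)] function_space_diff[OF assms(1)] by blast+
  have "(\<lambda>x. w * p u x - A (p u) x) \<approx> (\<lambda>x. w * p u x - p (A u) x)"
    by (intro ae_eq_diff ae_eq_refl comm)
  also have "\<dots> \<approx> (\<lambda>x. p (\<lambda>x. w * u x) x - p (A u) x)"
    by (intro ae_eq_diff ae_eq_refl ae_eq_sym[OF bounded_opD(4)[OF p u(1)]])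
  also have "\<dots> \<approx> p (\<lambda>x. w * u x - A u x)"
    by (rule ae_eq_sym[OF bounded_op_diff[OF assms(1) p wu(1,2)]])
  also have "\<dots> \<approx> p h" by (rule bounded_opD(2)[OF p wu(3) mem(5)[OF wu(3) u(2)] u(2)])
  also have "\<dots> \<approx> (\<lambda>x. 0)" by (rule h)
  finally show ?thesis
    by (rule not_in_spectrum_unique[OF assms(1,2) w bounded_opD(1)[OF p u(1)]])
qed

section \<open>Intervals\<close>

text \<open>With \<open>Inf P\<close> and \<open>Sup P\<close> as end points, the open, closed and
  half-open cases take one common form, differing from \<open>{p..q}\<close> by at most two
  points.\<close>

lemma subintervalE:
  assumes "P \<in> subintervals"
  obtains p q where "0 \<le> p" "p < q" "q \<le> 1" "{p<..<q} \<subseteq> P" "P \<subseteq> {p..q}"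
proof -
  obtain a b where ab: "a \<in> P" "b \<in> P" "a < b" and P: "is_interval P" "P \<subseteq> {0..1}"
    using assms unfolding subintervals_def by blast
  have bdd: "bdd_below P" "bdd_above P"
    using bdd_below_mono[OF bdd_below_Icc P(2)] bdd_above_mono[OF bdd_above_Icc P(2)] by auto
  have P01: "x \<in> P \<Longrightarrow> 0 \<le> x \<and> x \<le> 1" for x using P(2) by auto
  show thesis
  proof (rule that[of "Inf P" "Sup P"])
    show "0 \<le> Inf P" "Sup P \<le> 1"
      using ab P01 by (auto intro!: cInf_greatest cSup_least)
    show "Inf P < Sup P"
      using cInf_lower[OF ab(1) bdd(1)] cSup_upper[OF ab(2) bdd(2)] ab(3) by linarith
    show "P \<subseteq> {Inf P..Sup P}" using cInf_lower[OF _ bdd(1)] cSup_upper[OF _ bdd(2)] by auto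
    show "{Inf P<..<Sup P} \<subseteq> P"
    proof
      fix x assume x: "x \<in> {Inf P<..<Sup P}"
      then obtain c d where "c \<in> P" "c < x" "d \<in> P" "x < d"
        using cInf_less_iff[of P x] less_cSup_iff[of P x] bdd ab by auto
      then show "x \<in> P" using P(1) unfolding is_interval_1 by (meson less_imp_le)
    qed
  qed
qed

lemma subintervalI:
  assumes "0 \<le> p" "p < q" "q \<le> 1" "{p<..<q} \<subseteq> P" "P \<subseteq> {p..q}"
  shows "P \<in> subintervals"
proof -
  obtain u v where "p < u" "u < v" "v < q" using assms(2) dense by meson
  then have "u \<in> P" "v \<in> P" "u < v" using assms(4) by auto
  moreover have "is_interval P"
    unfolding is_interval_1
  proof (intro ballI allI impI)
    fix a b x assume a: "a \<in> P" "b \<in> P" "a \<le> x \<and> x \<le> b"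
    show "x \<in> P"
    proof (cases "x = a \<or> x = b")
      case False
      then have "x \<in> {p<..<q}" using a assms(5) by force
      then show ?thesis using assms(4) by blast
    qed (use a in auto)
  qed
  ultimately show ?thesis using assms unfolding subintervals_def by fastforce
qed

lemma interval_ends_eq:
  fixes p q :: real
  assumes "{p<..<q} \<subseteq> P" "P \<subseteq> {p..q}" "x \<notin> {p, q}"
  shows "x \<in> P \<longleftrightarrow> x \<in> {p..q}"
  using assms by (metis atLeastAtMost_iff greaterThanLessThan_iff insert_iff less_eq_real_def subsetD)

lemma interval_lebesgue:
  fixes p q :: real
  assumes "p \<le> q" "{p<..<q} \<subseteq> P" "P \<subseteq> {p..q}"
  shows "P \<in> sets lebesgue" "measure lebesgue P = q - p" "emeasure lebesgue P = ennreal (q - p)"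
proof -
  have ae: "AE x in lebesgue. x \<in> P \<longleftrightarrow> x \<in> {p..q}"
  proof (rule AE_I'[of "{p, q}"])
    show "{p, q} \<in> null_sets lebesgue"
      by (simp add: negligible_iff_null_sets[symmetric])
  qed (use interval_ends_eq[OF assms(2,3)] in auto)
  have "P = {p<..<q} \<union> (P \<inter> {p, q})" using assms(2,3) interval_ends_eq[OF assms(2,3)] by auto
  moreover have "P \<inter> {p, q} \<in> sets lebesgue"
    by (intro negligible_imp_sets negligible_finite) simp
  ultimately show P: "P \<in> sets lebesgue" by (metis sets.Un lmeasurable_interval(2) fmeasurableD)
  have "emeasure lebesgue P = emeasure lebesgue {p..q}"
    by (rule emeasure_eq_AE[OF ae P]) simp
  then show e: "emeasure lebesgue P = ennreal (q - p)" using assms(1) by simp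
  show "measure lebesgue P = q - p" unfolding measure_def e using assms(1) by simp
qed

lemma indicator_ae_eq_Icc:
  fixes p q :: real
  assumes "{p<..<q} \<subseteq> P" "P \<subseteq> {p..q}"
  shows "indicator P \<approx> indicator {p..q}"
proof -
  have "AE x in lebesgue. indicator P x = (indicator {p..q} x :: complex)"
  proof (rule AE_I'[of "{p, q}"])
    show "{p, q} \<in> null_sets lebesgue" by (simp add: negligible_iff_null_sets[symmetric])
  qed (use interval_ends_eq[OF assms] in \<open>auto simp: indicator_def\<close>)
  then show ?thesis unfolding ae_eq_def
    by (auto simp: AE_restrict_space_iff elim: eventually_mono)
qed

lemma subinterval_measurable: "P \<in> subintervals \<Longrightarrow> P \<in> sets lebesgue"
  by (metis subintervalE interval_lebesgue(1) less_imp_le)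

lemma integral_indicator_subset:
  fixes P :: "real set"
  assumes "P \<in> sets lebesgue" "P \<subseteq> {0..1}"
  shows "(\<integral>x. indicator P x \<partial>lebesgue_on {0..1}) = (of_real (measure lebesgue P) :: complex)"
proof -
  have "(\<integral>x. indicator P x \<partial>lebesgue_on {0..1}) =
      (\<integral>x. complex_of_real (indicator P x) \<partial>lebesgue_on {0..1})"
    by (intro Bochner_Integration.integral_cong) (auto simp: indicator_def)
  then show ?thesis
    using assms measure_restrict_space[of "{0..1}" lebesgue P] by (simp add: Int_absorb2)
qed

lemma L1_norm_indicator:
  assumes "P \<in> sets lebesgue" "P \<subseteq> {0..1}"
  shows "L1_norm (indicator P) = measure lebesgue P"
proof -
  have "L1_norm (indicator P) = (\<integral>x. indicator P x \<partial>lebesgue_on {0..1})"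
    unfolding L1_norm_def by (intro Bochner_Integration.integral_cong) (auto simp: indicator_def)
  then show ?thesis using assms measure_restrict_space[of "{0..1}" lebesgue P] by (simp add: Int_absorb2)
qed

section \<open>A lower bound for the essential spectral radius\<close>

text \<open>The dynamics enters only through \<open>V J\<close>, a backward orbit under
  \<open>A\<close> of the indicator of \<open>J\<close>. The bound \<open>a n\<close> is uniform in
  \<open>J\<close>, so it passes, up to a factor, to finite combinations whose intervals and
  coefficients are fixed only after the spectral data are known.\<close>

lemma essential_spectrum_bound:
  assumes B: "banach_in_L1 B N" and A: "bounded_op B N A"
    and V: "\<And>J n. J \<in> subintervals \<Longrightarrow> V J n \<in> B"
      "\<And>J. J \<in> subintervals \<Longrightarrow> V J 0 \<approx> indicator J"
      "\<And>J n. J \<in> subintervals \<Longrightarrow> A (V J (Suc n)) \<approx> V J n"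
      "\<And>J n. J \<in> subintervals \<Longrightarrow> N (V J n) \<le> a n"
    and a: "summable (\<lambda>n. \<rho> ^ n * a n)" and "0 \<le> r'"
    and spec: "\<And>z. z \<in> spectrum B N A \<Longrightarrow> norm z > r' \<Longrightarrow>
      \<exists>d. isolated_eigenvalue_of_mult B N A z d"
  shows "\<rho> \<le> r'"
proof (rule ccontr)
  assume "\<not> \<rho> \<le> r'"
  then have r: "r' < \<rho>" "\<rho> > 0" using \<open>0 \<le> r'\<close> by auto
  interpret L1_banach B N using B by unfold_locales
  define S where "S = {z \<in> spectrum B N A. \<rho> \<le> norm z}"
  have iso: "eigenvalue B A z \<and> z isolated_in spectrum B N A"
    if "z \<in> spectrum B N A" "norm z > r'" for z
    using spec[OF that] unfolding isolated_eigenvalue_of_mult_def by blast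
  have finS: "finite S"
    unfolding S_def by (rule finite_spectrum_outside_disc[OF A r(1) iso])
  have "\<forall>z\<in>S. \<exists>p. spectral_projection B N A z p \<and> (\<exists>d. has_dim {f \<in> B. p f \<approx> f} d)"
    using spec r unfolding S_def isolated_eigenvalue_of_mult_def by fastforce
  from bchoice[OF this] obtain P where PS: "\<forall>z\<in>S. spectral_projection B N A z (P z) \<and>
      (\<exists>d. has_dim {f \<in> B. P z f \<approx> f} d)" ..
  have P: "spectral_projection B N A z (P z)"
    and dim: "\<exists>d. has_dim {f \<in> B. P z f \<approx> f} d" if "z \<in> S" for z
    using PS that by auto
  have "\<forall>z\<in>S. \<exists>d. has_dim {f \<in> B. P z f \<approx> f} d" using dim by blast
  from bchoice[OF this] obtain d where d: "\<forall>z\<in>S. has_dim {f \<in> B. P z f \<approx> f} (d z)" ..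
  \<comment> \<open>In terms of a family spanning the range of \<open>P z\<close>, the vector
    condition that \<open>P z\<close> kills the right-hand side follows from \<open>d z\<close>
    scalar equations.\<close>
  have "\<forall>z\<in>S. \<exists>e. \<forall>f\<in>{f \<in> B. P z f \<approx> f}. \<exists>c. f \<approx> (\<lambda>x. \<Sum>i<d z. c i * e i x)"
  proof
    fix z assume "z \<in> S"
    then have "has_dim {f \<in> B. P z f \<approx> f} (d z)" using d by blast
    then obtain e where "\<forall>f\<in>{f \<in> B. P z f \<approx> f}. \<exists>c. f \<approx> (\<lambda>x. \<Sum>i<d z. c i * e i x)"
      unfolding has_dim_def by (elim exE conjE)
    then show "\<exists>e. \<forall>f\<in>{f \<in> B. P z f \<approx> f}. \<exists>c. f \<approx> (\<lambda>x. \<Sum>i<d z. c i * e i x)"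
      by (intro exI[of _ e])
  qed
  from bchoice[OF this] obtain e where
    e': "\<forall>z\<in>S. \<forall>f\<in>{f \<in> B. P z f \<approx> f}. \<exists>c. f \<approx> (\<lambda>x. \<Sum>i<d z. c i * e z i x)" ..
  have e: "\<exists>c. f \<approx> (\<lambda>x. \<Sum>i<d z. c i * e z i x)" if "z \<in> S" "f \<in> B" "P z f \<approx> f" for z f
    using e'[rule_format, of z f] that by simp
  have Pb: "bounded_op B N (P z)" "\<And>f. f \<in> B \<Longrightarrow> P z (P z f) \<approx> P z f" if "z \<in> S" for z
    using P[OF that] unfolding spectral_projection_def by auto
  define D where "D = (SIGMA z:S. {..<d z})"
  have "finite D" unfolding D_def using finS by auto
  \<comment> \<open>One interval more than there are scalar equations: the size of \<open>D\<close>
    is the total multiplicity of the points of \<open>S\<close>. The intervals are those of an equal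
    subdivision of the unit interval.\<close>
  define M where "M = Suc (card D)"
  define J where "J j = {real j / M<..<(real j + 1) / M}" for j
  have J01: "0 \<le> real j / M \<and> real j / M < (real j + 1) / M \<and> (real j + 1) / M \<le> 1" if "j < M" for j
    using that by (auto simp: field_simps M_def)
  have J: "J j \<in> subintervals" if "j < M" for j
    unfolding J_def using J01[OF that]
    by (intro subintervalI[of "real j / M" "(real j + 1) / M"]) auto
  have AV: "A (V (J j) 0) \<in> B" if "j < M" for j
    by (rule bounded_opD(1)[OF A V(1)[OF J[OF that]]])
  have "\<exists>c. z \<in> S \<longrightarrow> j < M \<longrightarrow> P z (A (V (J j) 0)) \<approx> (\<lambda>x. \<Sum>i<d z. c i * e z i x)" for z j
    using e[of z "P z (A (V (J j) 0))"] Pb bounded_opD(1)[OF Pb(1)] AV by blast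
  then obtain q where q: "\<And>z j. z \<in> S \<Longrightarrow> j < M \<Longrightarrow>
      P z (A (V (J j) 0)) \<approx> (\<lambda>x. \<Sum>i<d z. q z j i * e z i x)"
    by metis
  obtain c j0 where c: "j0 < M" "c j0 \<noteq> 0"
    "\<And>z i. z \<in> S \<Longrightarrow> i < d z \<Longrightarrow> (\<Sum>j<M. c j * q z j i) = 0"
  proof -
    have "card D < card {..<M}" by (simp add: M_def)
    from homogeneous_system_nontrivial[OF \<open>finite D\<close> finite_lessThan this,
        of "\<lambda>l j. q (fst l) j (snd l)"]
    show thesis using that unfolding D_def by force
  qed
  define G where "G n = (\<lambda>x. \<Sum>j<M. c j * V (J j) n x)" for n
  have VB: "V (J j) n \<in> B" if "j \<in> {..<M}" for j n using V(1) J that by simp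
  have G: "G n \<in> B" for n unfolding G_def by (intro mem_sum mem_scale VB)
  have AG: "A (G (Suc n)) \<approx> G n" for n
  proof -
    have "A (G (Suc n)) \<approx> (\<lambda>x. \<Sum>j<M. c j * A (V (J j) (Suc n)) x)"
      unfolding G_def by (rule bounded_op_sum[OF space A VB])
    also have "\<dots> \<approx> G n"
      unfolding G_def using V(3) J by (intro ae_eq_sum ae_eq_scale) auto
    finally show ?thesis .
  qed
  have sm: "summable (\<lambda>n. \<rho> ^ n * N (G n))"
  proof (rule summable_comparison_test'[OF summable_mult[OF a, of "\<Sum>j<M. norm (c j)"], of 0])
    fix n
    have "N (G n) \<le> (\<Sum>j<M. N (\<lambda>x. c j * V (J j) n x))"
      unfolding G_def by (intro N_sum mem_scale VB)
    also have "\<dots> = (\<Sum>j<M. norm (c j) * N (V (J j) n))"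
      by (intro sum.cong refl N_scale VB)
    also have "\<dots> \<le> (\<Sum>j<M. norm (c j) * a n)"
      using V(4) J by (intro sum_mono mult_left_mono) auto
    finally have "N (G n) \<le> (\<Sum>j<M. norm (c j)) * a n" by (simp add: sum_distrib_right)
    then have "\<rho> ^ n * N (G n) \<le> \<rho> ^ n * ((\<Sum>j<M. norm (c j)) * a n)"
      using r by (intro mult_left_mono) auto
    then show "norm (\<rho> ^ n * N (G n)) \<le> (\<Sum>j<M. norm (c j)) * (\<rho> ^ n * a n)"
      using r N_nonneg[OF G] by (simp add: abs_mult mult_ac)
  qed
  define h where "h = (\<lambda>x. - A (G 0) x)"
  have AG0: "A (G 0) \<in> B" by (rule bounded_opD(1)[OF A G])
  have h: "h \<in> B" using mem_scale[OF AG0, of "-1"] unfolding h_def by simp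
  have Ph: "P z h \<approx> (\<lambda>x. 0)" if z: "z \<in> S" for z
  proof -
    have AV': "A (V (J j) 0) \<in> B" if "j \<in> {..<M}" for j using AV that by simp
    have 1: "A (G 0) \<approx> (\<lambda>x. \<Sum>j<M. c j * A (V (J j) 0) x)"
      unfolding G_def by (rule bounded_op_sum[OF space A VB])
    have "P z (A (G 0)) \<approx> P z (\<lambda>x. \<Sum>j<M. c j * A (V (J j) 0) x)"
      by (rule bounded_opD(2)[OF Pb(1)[OF z] AG0 mem_cong[OF AG0 1] 1])
    also have "\<dots> \<approx> (\<lambda>x. \<Sum>j<M. c j * P z (A (V (J j) 0)) x)"
      by (rule bounded_op_sum[OF space Pb(1)[OF z] AV'])
    also have "\<dots> \<approx> (\<lambda>x. \<Sum>j<M. c j * (\<Sum>i<d z. q z j i * e z i x))"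
      using q[OF z] by (intro ae_eq_sum ae_eq_scale) auto
    also have "\<dots> = (\<lambda>x. \<Sum>i<d z. (\<Sum>j<M. c j * q z j i) * e z i x)"
      unfolding sum_distrib_left sum_distrib_right by (subst sum.swap) (simp add: mult.assoc)
    also have "\<dots> = (\<lambda>x. 0)" using c(3)[OF z] by simp
    finally have 2: "P z (A (G 0)) \<approx> (\<lambda>x. 0)" .
    have "P z h \<approx> (\<lambda>x. (-1) * P z (A (G 0)) x)"
      using bounded_opD(4)[OF Pb(1)[OF z] AG0, of "-1"] unfolding h_def by simp
    also have "\<dots> \<approx> (\<lambda>x. (-1) * 0)" by (rule ae_eq_scale[OF 2])
    finally show ?thesis by simp
  qed
  \<comment> \<open>The functional is the integral over an interval with nonzero coefficient; by
    disjointness it sees \<open>G 0\<close> as \<open>c j0 / M\<close>.\<close>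
  have "J j0 \<in> sets lebesgue" unfolding J_def by simp
  then obtain b where "L1_functional B N (\<lambda>f. \<integral>x. indicator (J j0) x * f x \<partial>lebesgue_on {0..1}) b"
    using integral_functional[OF B] by blast
  then interpret L1_functional B N "\<lambda>f. \<integral>x. indicator (J j0) x * f x \<partial>lebesgue_on {0..1}" b .
  define \<Phi> where "\<Phi> = (\<lambda>f. \<integral>x. indicator (J j0) x * f x \<partial>lebesgue_on {0..1 :: real} :: complex)"
  have \<Phi>G: "\<Phi> (G 0) \<noteq> 0"
  proof -
    have eq: "\<Phi> (V (J j) 0) = (if j = j0 then of_real (1 / M) else 0)" if "j < M" for j
    proof -
      have "\<Phi> (V (J j) 0) = \<Phi> (indicator (J j))"
        using fun_cong[OF V(1,2)[OF J[OF that]]] unfolding \<Phi>_def .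
      also have "\<dots> = (\<integral>x. indicator (J j0 \<inter> J j) x \<partial>lebesgue_on {0..1})"
        unfolding \<Phi>_def by (simp add: indicator_inter_arith)
      also have "\<dots> = (if j = j0 then of_real (1 / M) else 0)"
      proof (cases "j = j0")
        case True
        have "(\<integral>x. indicator (J j0) x \<partial>lebesgue_on {0..1}) =
            complex_of_real ((real j0 + 1) / M - real j0 / M)"
          using integral_indicator_subset[of "J j0"] subinterval_measurable[OF J[OF c(1)]]
            J[OF c(1)] J01[OF c(1)] interval_lebesgue(2)[of "real j0 / M" "(real j0 + 1) / M" "J j0"]
          unfolding subintervals_def J_def by (auto simp: greaterThanLessThan_subseteq_atLeastAtMost_iff)
        then show ?thesis using True by (simp add: diff_divide_distrib[symmetric])
      next
        case False
        have "x \<notin> J j0 \<inter> J j" for x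
        proof
          assume "x \<in> J j0 \<inter> J j"
          then have "real j0 < x * M" "x * M < real j0 + 1" "real j < x * M" "x * M < real j + 1"
            unfolding J_def M_def by (auto simp: field_simps)
          then have "real j < real j0 + 1" "real j0 < real j + 1" by linarith+
          then show False using False by linarith
        qed
        then have "J j0 \<inter> J j = {}" by blast
        then show ?thesis using False by simp
      qed
      finally show ?thesis .
    qed
    have "\<Phi> (G 0) = (\<Sum>j<M. \<Phi> (\<lambda>x. c j * V (J j) 0 x))"
      unfolding G_def \<Phi>_def by (rule fun_sum) (intro mem_scale VB)
    also have "\<dots> = (\<Sum>j<M. c j * \<Phi> (V (J j) 0))"
      unfolding \<Phi>_def by (intro sum.cong refl fun_scale VB)
    also have "\<dots> = (\<Sum>j<M. if j = j0 then c j * of_real (1 / M) else 0)"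
      by (intro sum.cong) (auto simp: eq)
    also have "\<dots> = c j0 * of_real (1 / M)" using c(1) by simp
    moreover have "of_real (1 / M) \<noteq> (0 :: complex)" by (simp only: of_real_eq_0_iff) (simp add: M_def)
    ultimately show ?thesis using c(2) by simp
  qed
  \<comment> \<open>Three sources of solutions: the power series in the open disc, where points of
    the spectrum need not be isolated; the resolvent on the kernel of \<open>P z\<close> at points
    of \<open>S\<close>; the full resolvent elsewhere.\<close>
  have "\<exists>u. u \<in> B \<and> (\<lambda>x. z * u x - A u x) \<approx> h \<and>
      (norm z < \<rho> \<longrightarrow> (\<lambda>n. z ^ n * \<Phi> (G n)) sums \<Phi> u) \<and> (z \<in> S \<longrightarrow> P z u \<approx> (\<lambda>x. 0))" for z
  proof (cases "norm z < \<rho>")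
    case True
    then have "z \<notin> S" unfolding S_def by simp
    then show ?thesis
      using power_series_solution[OF A G AG sm, of z] True unfolding h_def \<Phi>_def by auto
  next
    case False
    show ?thesis
    proof (cases "z \<in> S")
      case True
      let ?K = "{f \<in> B. P z f \<approx> (\<lambda>x. 0)}"
      have "z \<notin> spectrum ?K N A"
        using P[OF True] unfolding spectral_projection_def by auto
      then obtain R where R: "bounded_op ?K N R"
        "\<And>f. f \<in> ?K \<Longrightarrow> (\<lambda>x. z * R f x - A (R f) x) \<approx> f"
        unfolding spectrum_def by blast
      have "h \<in> ?K" using h Ph[OF True] by simp
      then show ?thesis
        using R(2)[of h] bounded_opD(1)[OF R(1), of h] False by (intro exI[of _ "R h"]) auto
    next
      case nS: False
      then have "z \<notin> spectrum B N A" using False unfolding S_def by simp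
      then obtain R where R: "bounded_op B N R"
        "\<And>f. f \<in> B \<Longrightarrow> (\<lambda>x. z * R f x - A (R f) x) \<approx> f"
        unfolding spectrum_def by blast
      then show ?thesis
        using R(2)[of h] bounded_opD(1)[OF R(1), of h] False nS h by (intro exI[of _ "R h"]) auto
    qed
  qed
  then obtain U where U: "\<And>z. U z \<in> B" "\<And>z. (\<lambda>x. z * U z x - A (U z) x) \<approx> h"
    "\<And>z. norm z < \<rho> \<Longrightarrow> (\<lambda>n. z ^ n * \<Phi> (G n)) sums \<Phi> (U z)"
    "\<And>z. z \<in> S \<Longrightarrow> P z (U z) \<approx> (\<lambda>x. 0)"
    by metis
  have "(\<lambda>w. \<Phi> (U w)) field_differentiable (at z)" for z
  proof (cases "norm z < \<rho>")
    case True
    have "(\<lambda>w. \<Phi> (U w)) holomorphic_on ball 0 \<rho>"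
      by (rule power_series_holomorphic[where a = "\<lambda>n. \<Phi> (G n)"])
        (use U(3) in \<open>simp add: mult.commute\<close>)
    then show ?thesis
      using True holomorphic_on_imp_differentiable_at[OF _ open_ball] by simp
  next
    case False
    show ?thesis
    proof (cases "z \<in> S")
      case True
      let ?K = "{f \<in> B. P z f \<approx> (\<lambda>x. 0)}"
      have "z \<notin> spectrum ?K N A"
        using P[OF True] unfolding spectral_projection_def by auto
      then obtain R where R: "bounded_op ?K N R"
        "\<And>f. f \<in> ?K \<Longrightarrow> R (\<lambda>x. z * f x - A f x) \<approx> f"
        unfolding spectrum_def by blast
      have "z isolated_in spectrum B N A"
        using iso[of z] True r unfolding S_def by simp
      then obtain \<delta> where \<delta>: "\<delta> > 0" "\<And>w. w \<in> spectrum B N A \<Longrightarrow> dist z w < \<delta> \<Longrightarrow> w = z"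
        unfolding isolated_in_dist_Ex_iff by blast
      \<comment> \<open>All other points near \<open>z\<close> are off the spectrum, including any
        inside the disc, so the power series solutions there lie in the kernel of \<open>P z\<close>
        as well.\<close>
      have UK: "U w \<in> ?K" if "dist w z < \<delta>" for w
      proof (cases "w = z")
        case True
        then show ?thesis using U(1,4) \<open>z \<in> S\<close> by simp
      next
        case False
        then have "w \<notin> spectrum B N A" using \<delta>(2)[of w] that by (auto simp: dist_commute)
        then have "P z (U w) \<approx> (\<lambda>x. 0)"
          by (rule spectral_projection_kernel[OF space A P[OF True] _ U(1) U(2) Ph[OF True]])
        then show ?thesis using U(1) by simp
      qed
      show ?thesis
        using resolvent_solution_differentiable[OF A
          function_space_kernel[OF space Pb(1)[OF True]] _ R UK U(2) \<delta>(1)]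
        unfolding \<Phi>_def by auto
    next
      case nS: False
      then have "z \<notin> spectrum B N A" using False unfolding S_def by simp
      then obtain R where R: "bounded_op B N R"
        "\<And>f. f \<in> B \<Longrightarrow> R (\<lambda>x. z * f x - A f x) \<approx> f"
        unfolding spectrum_def by blast
      \<comment> \<open>With \<open>K = B\<close> the radius is arbitrary, here 1, since every
        \<open>U w\<close> is a solution in \<open>B\<close>. This covers points of the circle that
        have power series solutions on one side.\<close>
      show ?thesis
        using resolvent_solution_differentiable[OF A space subset_refl R U(1) U(2) zero_less_one]
        unfolding \<Phi>_def .
    qed
  qed
  then have "(\<lambda>w. \<Phi> (U w)) holomorphic_on UNIV"
    by (simp add: holomorphic_on_def field_differentiable_at_within)
  then have "\<Phi> (U 0) = 0"
    using entire_solution_vanishes[OF A U(1,2)] unfolding \<Phi>_def by blast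
  \<comment> \<open>At 0 the series reduces to its first term, as \<open>0 ^ 0 = 1\<close>; so
    \<open>\<Phi> (U 0)\<close> is the nonzero number \<open>\<Phi> (G 0)\<close>.\<close>
  moreover have "(\<lambda>n. 0 ^ n * \<Phi> (G n)) sums \<Phi> (U 0)" using U(3)[of 0] r by simp
  moreover have "(\<lambda>n. \<Phi> (G n) * 0 ^ n) sums \<Phi> (G 0)" by (rule powser_sums_zero)
  ultimately have "\<Phi> (G 0) = 0" using sums_unique2 by (metis (no_types, lifting) mult.commute sums_cong)
  with \<Phi>G show False ..
qed

section \<open>Full branch maps\<close>

text \<open>The form with \<open>min\<close> and \<open>max\<close> spares a case distinction
  between increasing and decreasing branches later on.\<close>

lemma strict_monotone_between:
  fixes f :: "real \<Rightarrow> real"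
  assumes "strict_mono_on S f \<or> strict_antimono_on S f" "x \<in> S" "y \<in> S" "z \<in> S"
  shows "min (f x) (f y) < f z \<and> f z < max (f x) (f y) \<longleftrightarrow> min x y < z \<and> z < max x y"
  using assms(1)
proof
  assume "strict_mono_on S f"
  then have "f u < f v \<longleftrightarrow> u < v" if "u \<in> S" "v \<in> S" for u v
    using that unfolding monotone_on_def
    by (metis linorder_neqE_linordered_idom order_less_asym)
  then show ?thesis using assms(2-4) by (auto simp: min_less_iff_disj less_max_iff_disj)
next
  assume "strict_antimono_on S f"
  then have "f u < f v \<longleftrightarrow> v < u" if "u \<in> S" "v \<in> S" for u v
    using that unfolding monotone_on_def
    by (metis linorder_neqE_linordered_idom order_less_asym)
  then show ?thesis using assms(2-4) by (auto simp: min_less_iff_disj less_max_iff_disj)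
qed

lemma open_subinterval_eq:
  assumes "J \<in> subintervals" "open J"
  obtains a b where "0 \<le> a" "a < b" "b \<le> 1" "J = {a<..<b}"
proof -
  obtain a b where ab: "0 \<le> a" "a < b" "b \<le> 1" "{a<..<b} \<subseteq> J" "J \<subseteq> {a..b}"
    using subintervalE[OF assms(1)] by metis
  have "J \<subseteq> interior {a..b}" using ab(5) assms(2) by (rule interior_maximal)
  then have "J = {a<..<b}" using ab(4) by auto
  with ab show thesis using that by blast
qed

locale full_branch_map =
  fixes \<I> :: "real set set" and T :: "real \<Rightarrow> real" and s :: real
  assumes partition: "interval_partition \<I>"
    and maps: "T ` (\<Union>\<I>) \<subseteq> {0..1}"
    and s: "s \<ge> 1"
    and branches_onto: "piecewise_C_full_branches s \<I> T"
    and expanding: "expanding \<I> T"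
    and invariant: "lebesgue_invariant \<I> T"
begin

lemma finite_\<I>: "finite \<I>" and disjoint_\<I>: "disjoint \<I>"
  and member_\<I>: "J \<in> \<I> \<Longrightarrow> J \<in> subintervals" "J \<in> \<I> \<Longrightarrow> open J"
  using partition unfolding interval_partition_def by blast+

lemma member_eq: "J \<in> \<I> \<Longrightarrow> x \<in> J \<Longrightarrow> J' \<in> \<I> \<Longrightarrow> x \<in> J' \<Longrightarrow> J = J'"
  using disjoint_\<I> unfolding disjoint_def by blast

lemma branch_ends:
  assumes "J \<in> \<I>"
  obtains a b where "0 \<le> a" "a < b" "b \<le> 1" "J = {a<..<b}"
  using open_subinterval_eq[OF member_\<I>[OF assms]] by blast

lemma Union_subset: "\<Union>\<I> \<subseteq> {0<..<1}"
proof
  fix x assume "x \<in> \<Union>\<I>"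
  then obtain J where J: "J \<in> \<I>" "x \<in> J" by blast
  then show "x \<in> {0<..<1}" using branch_ends[OF J(1)] by (metis greaterThanLessThan_iff order_le_less_trans order_less_le_trans)
qed

lemma T_derivative: "x \<in> \<Union>\<I> \<Longrightarrow> (T has_real_derivative deriv T x) (at x)"
proof -
  assume "x \<in> \<Union>\<I>"
  then obtain J where J: "J \<in> \<I>" "x \<in> J" by blast
  obtain f where f: "\<forall>x\<in>J. f x = T x" "C_diffeo s (closure J) {0..1} f"
    using branches_onto J(1) unfolding piecewise_C_full_branches_def by blast
  then obtain D where D: "\<forall>x\<in>closure J. D (0::nat) x = f x"
    "\<forall>i < nat \<lfloor>s\<rfloor>. \<forall>x\<in>closure J. (D i has_real_derivative D (Suc i) x) (at x within closure J)"
    unfolding C_diffeo_def C_class_on_def by blast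
  have "0 < nat \<lfloor>s\<rfloor>" using s by linarith
  then have "(D 0 has_real_derivative D 1 x) (at x within closure J)"
    using D(2) J(2) closure_subset[of J] by auto
  then have "(D 0 has_real_derivative D 1 x) (at x within J)"
    by (rule has_field_derivative_subset[OF _ closure_subset])
  then have "(D 0 has_real_derivative D 1 x) (at x)"
    using at_within_open[OF J(2) member_\<I>(2)[OF J(1)]] by simp
  then have "(T has_real_derivative D 1 x) (at x)"
    using D(1) f(1) J closure_subset[of J]
    by (elim has_field_derivative_transform_within_open[OF _ member_\<I>(2)[OF J(1)]]) auto
  then show "(T has_real_derivative deriv T x) (at x)" by (simp add: DERIV_imp_deriv)
qed

lemma deriv_gt_1: "x \<in> \<Union>\<I> \<Longrightarrow> \<bar>deriv T x\<bar> > 1"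
  using expanding unfolding expanding_def by force

text \<open>Smoothness gives a continuous bijection of closed intervals, which is strictly monotone.
  End points therefore go to end points, and removing them leaves the open branch mapped onto
  \<open>{0<..<1}\<close>.\<close>

lemma branch:
  assumes "J \<in> \<I>"
  shows "bij_betw T J {0<..<1}" "strict_mono_on J T \<or> strict_antimono_on J T"
proof -
  obtain a b where ab: "0 \<le> a" "a < b" "b \<le> 1" "J = {a<..<b}" using branch_ends[OF assms] .
  have cl: "closure J = {a..b}" using ab by simp
  obtain f where f: "\<forall>x\<in>J. f x = T x" "C_diffeo s {a..b} {0..1} f"
    using branches_onto assms cl unfolding piecewise_C_full_branches_def by metis
  have bij: "bij_betw f {a..b} {0..1}" using f(2) unfolding C_diffeo_def by blast
  obtain D where D: "\<forall>x\<in>{a..b}. D (0::nat) x = f x"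
    "\<forall>i < nat \<lfloor>s\<rfloor>. \<forall>x\<in>{a..b}. (D i has_real_derivative D (Suc i) x) (at x within {a..b})"
    using f(2) unfolding C_diffeo_def C_class_on_def by blast
  have "0 < nat \<lfloor>s\<rfloor>" using s by linarith
  then have "continuous_on {a..b} (D 0)"
    using D(2) by (intro DERIV_continuous_on) blast
  then have "continuous_on {a..b} f"
    by (rule continuous_on_eq) (use D(1) in auto)
  then have mono: "strict_mono_on {a..b} f \<or> strict_antimono_on {a..b} f"
    using injective_eq_monotone_map[of "{a..b}" f] bij_betw_imp_inj_on[OF bij] is_interval_cc
    by blast
  have sub: "J \<subseteq> {a..b}" using ab by auto
  have eqT: "x \<in> J \<Longrightarrow> T x = f x" for x using f(1) by simp
  show "strict_mono_on J T \<or> strict_antimono_on J T"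
    using mono
  proof (rule disj_forward)
    assume "strict_mono_on {a..b} f"
    then show "strict_mono_on J T" using sub eqT by (auto simp: monotone_on_def subset_iff)
  next
    assume "strict_antimono_on {a..b} f"
    then show "strict_antimono_on J T" using sub eqT by (auto simp: monotone_on_def subset_iff)
  qed
  have im: "f ` {a..b} = {0..1}" and inj: "inj_on f {a..b}" using bij unfolding bij_betw_def by auto
  have "0 \<in> f ` {a..b}" "1 \<in> f ` {a..b}" unfolding im by auto
  then obtain u v where "u \<in> {a..b}" "0 = f u" "v \<in> {a..b}" "1 = f v" by (elim imageE)
  then have uv: "u \<in> {a..b}" "f u = 0" "v \<in> {a..b}" "f v = 1" by simp_all
  have ran: "x \<in> {a..b} \<Longrightarrow> 0 \<le> f x \<and> f x \<le> 1" for x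
    using imageI[of x "{a..b}" f] unfolding im by simp
  have "{f a, f b} = {0, 1}"
    using mono
  proof
    assume sm: "strict_mono_on {a..b} f"
    have "f a \<le> f u" using monotone_onD[OF sm, of a u] uv(1) ab(2) by (cases "a = u") auto
    moreover have "f v \<le> f b" using monotone_onD[OF sm, of v b] uv(3) ab(2) by (cases "v = b") auto
    ultimately show ?thesis using uv ran[of a] ran[of b] ab(2) by auto
  next
    assume am: "strict_antimono_on {a..b} f"
    have "f b \<le> f u" using monotone_onD[OF am, of u b] uv(1) ab(2) by (cases "u = b") auto
    moreover have "f v \<le> f a" using monotone_onD[OF am, of a v] uv(3) ab(2) by (cases "a = v") auto
    ultimately show ?thesis using uv ran[of a] ran[of b] ab(2) by auto
  qed
  moreover have "J = {a..b} - {a, b}" using ab by auto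
  moreover have "f ` ({a..b} - {a, b}) = f ` {a..b} - f ` {a, b}"
    using ab(2) by (intro inj_on_image_set_diff[OF inj]) auto
  ultimately have "f ` J = {0..1} - {0, 1}" using im by simp
  also have "\<dots> = {0<..<1}" by auto
  finally have "T ` J = {0<..<1}" using eqT by (metis image_cong)
  moreover have "inj_on T J" using inj_on_subset[OF inj sub] eqT inj_on_cong by metis
  ultimately show "bij_betw T J {0<..<1}" unfolding bij_betw_def by blast
qed

section \<open>Preimages of intervals under branches and cylinders\<close>

text \<open>Convexity comes from monotonicity. \<open>E\<close> is kept inside
  \<open>{0<..<1}\<close> because this is the exact image of a branch: two distinct points of
  \<open>E\<close> then have preimages in \<open>J\<close>, which gives positive length.\<close>

lemma branch_preimage:
  assumes "J \<in> \<I>" "E \<in> subintervals" "E \<subseteq> {0<..<1}"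
  shows "{x \<in> J. T x \<in> E} \<in> subintervals"
proof -
  let ?P = "{x \<in> J. T x \<in> E}"
  have iE: "is_interval E" using assms(2) unfolding subintervals_def by blast
  have iJ: "is_interval J" using member_\<I>(1)[OF assms(1)] unfolding subintervals_def by blast
  have "is_interval ?P"
    unfolding is_interval_1
  proof (intro ballI allI impI)
    fix u v x assume uv: "u \<in> ?P" "v \<in> ?P" "u \<le> x \<and> x \<le> v"
    have xJ: "x \<in> J" using iJ uv unfolding is_interval_1 by blast
    show "x \<in> ?P"
    proof (cases "x = u \<or> x = v")
      case False
      then have "min u v < x \<and> x < max u v" using uv by auto
      then have "min (T u) (T v) < T x \<and> T x < max (T u) (T v)"
        using strict_monotone_between[OF branch(2)[OF assms(1)], of u v x] uv xJ by simp
      moreover have "min (T u) (T v) \<in> E" "max (T u) (T v) \<in> E"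
        using uv by (auto simp: min_def max_def)
      ultimately have "T x \<in> E"
        using iE[unfolded is_interval_1, rule_format, of "min (T u) (T v)" "max (T u) (T v)" "T x"]
        by simp
      then show ?thesis using xJ by simp
    qed (use uv in auto)
  qed
  moreover obtain c d where cd: "c \<in> E" "d \<in> E" "c < d" using assms(2) unfolding subintervals_def by blast
  have "c \<in> T ` J" "d \<in> T ` J" using cd assms(3) branch(1)[OF assms(1)] unfolding bij_betw_def by auto
  then obtain c' d' where cd': "c' \<in> J" "T c' = c" "d' \<in> J" "T d' = d" by auto
  then have "c' \<in> ?P" "d' \<in> ?P" "c' \<noteq> d'" using cd by auto
  then have "\<exists>a\<in>?P. \<exists>b\<in>?P. a < b" by (meson linorder_neqE_linordered_idom)
  moreover have "?P \<subseteq> {0..1}"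
    using assms(1) Union_subset by (auto simp: subset_iff intro: less_imp_le)
  ultimately show ?thesis unfolding subintervals_def by simp
qed

lemma cylinder_Nil [simp]: "cylinder T [] = {0..1}"
  unfolding cylinder_def by auto

lemma cylinder_Cons:
  assumes "J \<in> \<I>"
  shows "cylinder T (J # w) = {x \<in> J. T x \<in> cylinder T w}"
proof -
  have "J \<subseteq> {0..1}" "T ` J \<subseteq> {0..1}"
    using assms maps Union_subset by (auto simp: subset_iff intro: less_imp_le)
  then show ?thesis
    unfolding cylinder_def
    by (auto simp: All_less_Suc2 funpow_Suc_right simp del: funpow.simps)
qed

text \<open>Induction on the word, peeling off its first letter. The inclusion in
  \<open>{0<..<1}\<close> is carried along because \<open>branch_preimage\<close> demands it of the
  set that is pulled back next.\<close>

lemma cylinder_preimage: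
  assumes "set w \<subseteq> \<I>" "E \<in> subintervals" "E \<subseteq> {0<..<1}"
  shows "{x \<in> cylinder T w. (T ^^ length w) x \<in> E} \<in> subintervals \<and>
    {x \<in> cylinder T w. (T ^^ length w) x \<in> E} \<subseteq> {0<..<1}"
  using assms(1)
proof (induction w)
  case Nil
  have "{x \<in> cylinder T []. (T ^^ length []) x \<in> E} = E" using assms(3) by auto
  then show ?case using assms by simp
next
  case (Cons J w)
  let ?E = "{x \<in> cylinder T w. (T ^^ length w) x \<in> E}"
  have eq: "{x \<in> cylinder T (J # w). (T ^^ length (J # w)) x \<in> E} = {x \<in> J. T x \<in> ?E}"
    using Cons.prems by (auto simp: cylinder_Cons funpow_Suc_right simp del: funpow.simps)
  show ?case
    unfolding eq using Cons branch_preimage[of J ?E] Union_subset by auto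
qed

section \<open>Derivatives of iterates and contraction factors\<close>

lemma iterate_derivative:
  assumes "\<And>j. j < n \<Longrightarrow> (T ^^ j) x \<in> \<Union>\<I>"
  shows "((T ^^ n) has_real_derivative (\<Prod>j<n. deriv T ((T ^^ j) x))) (at x)"
  using assms
proof (induction n)
  case 0
  show ?case by (simp add: id_def)
next
  case (Suc n)
  have "((\<lambda>x. T ((T ^^ n) x)) has_real_derivative deriv T ((T ^^ n) x) * (\<Prod>j<n. deriv T ((T ^^ j) x))) (at x)"
    using Suc by (intro DERIV_chain2[OF T_derivative]) auto
  then show ?case by (simp add: comp_def mult.commute)
qed

lemma iterate_deriv:
  assumes "\<And>j. j < n \<Longrightarrow> (T ^^ j) x \<in> \<Union>\<I>"
  shows "deriv (T ^^ n) x = (\<Prod>j<n. deriv T ((T ^^ j) x))" "\<bar>deriv (T ^^ n) x\<bar> \<ge> 1"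
proof -
  show eq: "deriv (T ^^ n) x = (\<Prod>j<n. deriv T ((T ^^ j) x))"
    by (rule DERIV_imp_deriv[OF iterate_derivative[OF assms]])
  show "\<bar>deriv (T ^^ n) x\<bar> \<ge> 1"
    unfolding eq abs_prod using deriv_gt_1[OF assms] by (intro prod_ge_1) (auto intro: less_imp_le)
qed

lemma cylinder_orbit: "set w \<subseteq> \<I> \<Longrightarrow> x \<in> cylinder T w \<Longrightarrow> j < length w \<Longrightarrow> (T ^^ j) x \<in> \<Union>\<I>"
  unfolding cylinder_def using nth_mem[of j w] by blast

abbreviation \<theta> :: "nat \<Rightarrow> real set \<Rightarrow> real" where
  "\<theta> n P \<equiv> SUP x\<in>P. 1 / \<bar>deriv (T ^^ n) x\<bar>"

text \<open>Expansion keeps all the values at most 1, so the supremum is over a bounded set.\<close>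

lemma theta_upper:
  assumes "P \<in> branches \<I> T n" "x \<in> P"
  shows "1 / \<bar>deriv (T ^^ n) x\<bar> \<le> \<theta> n P"
proof -
  obtain w where w: "P = cylinder T w" "length w = n" "set w \<subseteq> \<I>"
    using assms(1) unfolding branches_def by blast
  have "1 / \<bar>deriv (T ^^ n) x\<bar> \<le> 1" if "x \<in> P" for x
    using iterate_deriv(2)[of n x] cylinder_orbit[OF w(3)] w that by auto
  then show ?thesis using assms(2) by (intro cSUP_upper bdd_aboveI2) auto
qed

lemma theta_pos:
  assumes "P \<in> branches \<I> T n"
  shows "0 < \<theta> n P"
proof -
  obtain w where w: "P = cylinder T w" "length w = n" "set w \<subseteq> \<I>" and "P \<noteq> {}"
    using assms unfolding branches_def by blast
  then obtain x where x: "x \<in> P" by blast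
  have "0 < 1 / \<bar>deriv (T ^^ n) x\<bar>"
    using iterate_deriv(2)[of n x] cylinder_orbit[OF w(3)] w x by auto
  then show ?thesis using theta_upper[OF assms x] by linarith
qed

lemma unit_interval_subinterval: "{0<..<1} \<in> subintervals"
  by (rule subintervalI[of 0 1]) auto

text \<open>For the length, the mean value theorem: two points of the piece have images at distance
  at most 1, and the segment between them stays in \<open>P\<close>, so their distance is at most
  \<open>1 / \<bar>deriv (T ^^ n) z\<bar>\<close> for some \<open>z\<close> in
  \<open>P\<close>.\<close>

lemma branch_piece:
  assumes P: "P \<in> branches \<I> T n" and E: "E \<in> subintervals" "E \<subseteq> {0<..<1}"
  shows "{x \<in> P. (T ^^ n) x \<in> E} \<in> subintervals"
    "measure lebesgue {x \<in> P. (T ^^ n) x \<in> E} \<le> \<theta> n P"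
proof -
  obtain w where w: "P = cylinder T w" "length w = n" "set w \<subseteq> \<I>"
    using P unfolding branches_def by blast
  let ?Q = "{x \<in> P. (T ^^ n) x \<in> E}"
  show Q: "?Q \<in> subintervals" using cylinder_preimage[OF w(3) E] w by simp
  let ?R = "{x \<in> P. (T ^^ n) x \<in> {0<..<1}}"
  have R: "?R \<in> subintervals"
    using cylinder_preimage[OF w(3) unit_interval_subinterval] w by simp
  have QR: "?Q \<subseteq> ?R" using E(2) by auto
  have dist: "y - x \<le> \<theta> n P" if xy: "x \<in> ?Q" "y \<in> ?Q" "x < y" for x y
  proof -
    have seg: "z \<in> P" if "x \<le> z" "z \<le> y" for z
    proof -
      have "is_interval ?R" using R unfolding subintervals_def by blast
      moreover have "x \<in> ?R" "y \<in> ?R" using xy QR by blast+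
      ultimately have "z \<in> ?R" using that unfolding is_interval_1 by blast
      then show ?thesis by simp
    qed
    have "\<exists>z. x < z \<and> z < y \<and> (T ^^ n) y - (T ^^ n) x = (y - x) * deriv (T ^^ n) z"
    proof (rule MVT2[OF xy(3)])
      fix z assume z: "x \<le> z" "z \<le> y"
      have orb: "j < n \<Longrightarrow> (T ^^ j) z \<in> \<Union>\<I>" for j
        using cylinder_orbit[OF w(3)] w seg[OF z] by auto
      then show "((T ^^ n) has_real_derivative deriv (T ^^ n) z) (at z)"
        using iterate_derivative[of n z] iterate_deriv(1)[of n z] by simp
    qed
    then obtain z where z: "x < z" "z < y" "(T ^^ n) y - (T ^^ n) x = (y - x) * deriv (T ^^ n) z"
      by blast
    have zP: "z \<in> P" using seg z by simp
    have "(y - x) * \<bar>deriv (T ^^ n) z\<bar> = \<bar>(T ^^ n) y - (T ^^ n) x\<bar>"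
      unfolding z(3) using xy(3) by (simp add: abs_mult)
    also have "\<dots> \<le> 1" proof -
      have "(T ^^ n) x \<in> {0<..<1}" "(T ^^ n) y \<in> {0<..<1}" using xy E(2) by blast+
      then show ?thesis by auto
    qed
    finally have "y - x \<le> 1 / \<bar>deriv (T ^^ n) z\<bar>"
      using iterate_deriv(2)[of n z] cylinder_orbit[OF w(3)] w zP by (simp add: field_simps)
    also have "\<dots> \<le> \<theta> n P" by (rule theta_upper[OF P zP])
    finally show ?thesis .
  qed
  obtain p q where pq: "0 \<le> p" "p < q" "q \<le> 1" "{p<..<q} \<subseteq> ?Q" "?Q \<subseteq> {p..q}"
    by (rule subintervalE[OF Q])
  have "q - p \<le> \<theta> n P"
  proof (rule ccontr)
    assume neg: "\<not> q - p \<le> \<theta> n P"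
    \<comment> \<open>The end points \<open>p\<close> and \<open>q\<close> need not belong to the
      piece. Moving inward by \<open>\<epsilon> / 3\<close> on each side reaches points of it whose
      distance still exceeds \<open>\<theta> n P\<close>, namely by
      \<open>\<epsilon> / 3\<close>.\<close>
    define \<epsilon> where "\<epsilon> = q - p - \<theta> n P"
    have e: "\<epsilon> > 0" "\<epsilon> < q - p"
      using neg theta_pos[OF P] unfolding \<epsilon>_def by linarith+
    then have "p + \<epsilon> / 3 \<in> {p<..<q}" "q - \<epsilon> / 3 \<in> {p<..<q}" by auto
    then have "p + \<epsilon> / 3 \<in> ?Q" "q - \<epsilon> / 3 \<in> ?Q" using pq(4) by blast+
    moreover have "p + \<epsilon> / 3 < q - \<epsilon> / 3" using e by linarith
    ultimately have "(q - \<epsilon> / 3) - (p + \<epsilon> / 3) \<le> \<theta> n P" by (rule dist)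
    then show False using e(1) \<epsilon>_def by argo
  qed
  then show "measure lebesgue ?Q \<le> \<theta> n P"
    using interval_lebesgue(2)[OF _ pq(4,5)] pq(2) by simp
qed

lemma finite_branches: "finite (branches \<I> T n)"
  and card_branches: "card (branches \<I> T n) \<le> card \<I> ^ n"
proof -
  let ?W = "{w. set w \<subseteq> \<I> \<and> length w = n}"
  have W: "finite ?W" "card ?W = card \<I> ^ n"
    using finite_lists_length_eq[OF finite_\<I>] card_lists_length_eq[OF finite_\<I>] by auto
  have sub: "branches \<I> T n \<subseteq> cylinder T ` ?W" unfolding branches_def by auto
  show "finite (branches \<I> T n)" by (rule finite_subset[OF sub finite_imageI[OF W(1)]])
  have "card (branches \<I> T n) \<le> card (cylinder T ` ?W)"
    by (rule card_mono[OF finite_imageI[OF W(1)] sub])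
  also have "\<dots> \<le> card \<I> ^ n" using card_image_le[OF W(1)] W(2) by metis
  finally show "card (branches \<I> T n) \<le> card \<I> ^ n" .
qed

section \<open>Itineraries and preimages under iterates\<close>

lemma word_unique:
  assumes "x \<in> cylinder T w" "x \<in> cylinder T w'" "length w = length w'" "set w \<subseteq> \<I>" "set w' \<subseteq> \<I>"
  shows "w = w'"
proof (rule nth_equalityI[OF assms(3)])
  fix j assume "j < length w"
  then have j: "w ! j \<in> \<I>" "w' ! j \<in> \<I>" "(T ^^ j) x \<in> w ! j" "(T ^^ j) x \<in> w' ! j"
    using assms nth_mem[of j w] nth_mem[of j w'] unfolding cylinder_def by auto
  show "w ! j = w' ! j" by (rule member_eq[OF j(1,3,2,4)])
qed

lemma branch_unique:
  assumes "P \<in> branches \<I> T n" "Q \<in> branches \<I> T n" "x \<in> P" "x \<in> Q"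
  shows "P = Q"
  using assms word_unique unfolding branches_def by blast

text \<open>The preimage under the iterate, on the set where the iterate is defined. Cutting
  \<open>J\<close> down to \<open>{0<..<1}\<close> is what makes its part in each branch an interval
  of positive length; for \<open>n = 0\<close> it changes \<open>J\<close> by a null set
  only.\<close>

definition pullback :: "real set \<Rightarrow> nat \<Rightarrow> real set" where
  "pullback J n = {x. (\<forall>j<n. (T ^^ j) x \<in> \<Union>\<I>) \<and> (T ^^ n) x \<in> J \<inter> {0<..<1}}"

lemma pullback_Suc: "y \<in> \<Union>\<I> \<Longrightarrow> y \<in> pullback J (Suc n) \<longleftrightarrow> T y \<in> pullback J n"
  unfolding pullback_def
  by (auto simp: All_less_Suc2 funpow_Suc_right simp del: funpow.simps)

text \<open>A point of the preimage has exactly one itinerary, so exactly one summand is nonzero.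
  This reduces the norm of a preimage to norms of intervals.\<close>

lemma indicator_pullback:
  "indicator (pullback J n) x =
    (\<Sum>P\<in>branches \<I> T n. indicator {x \<in> P. (T ^^ n) x \<in> J \<inter> {0<..<1}} x :: complex)"
proof (cases "x \<in> pullback J n")
  case True
  have orb: "\<forall>j<n. (T ^^ j) x \<in> \<Union>\<I>" using True unfolding pullback_def by blast
  have "\<forall>j. \<exists>J. j < n \<longrightarrow> J \<in> \<I> \<and> (T ^^ j) x \<in> J" using orb by blast
  from choice[OF this] obtain f where f: "\<And>j. j < n \<Longrightarrow> f j \<in> \<I> \<and> (T ^^ j) x \<in> f j" by blast
  \<comment> \<open>Cylinders are confined to the unit interval by definition. For
    \<open>n = 0\<close> no branch is visited that would place \<open>x\<close> there, but then
    \<open>x\<close> itself lies in the target \<open>{0<..<1}\<close>.\<close>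
  have "x \<in> {0..1}"
  proof (cases n)
    case 0
    then show ?thesis using True unfolding pullback_def by auto
  next
    case (Suc m)
    then have "x \<in> \<Union>\<I>" using orb[rule_format, of 0] by simp
    then show ?thesis using Union_subset by auto
  qed
  then have xc: "x \<in> cylinder T (map f [0..<n])" unfolding cylinder_def using f by auto
  then have P: "cylinder T (map f [0..<n]) \<in> branches \<I> T n" (is "?P \<in> _")
    unfolding branches_def using f
    by (intro DiffI CollectI exI[of _ "map f [0..<n]"]) auto
  have Tn: "(T ^^ n) x \<in> J \<inter> {0<..<1}" using True unfolding pullback_def by blast
  have "(\<Sum>P\<in>branches \<I> T n. indicator {x \<in> P. (T ^^ n) x \<in> J \<inter> {0<..<1}} x :: complex) =
      (\<Sum>P\<in>branches \<I> T n. if P = ?P then 1 else 0)"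
  proof (rule sum.cong[OF refl])
    fix P' assume "P' \<in> branches \<I> T n"
    then have "x \<in> P' \<longleftrightarrow> P' = ?P" using branch_unique[OF _ P _ xc] xc by blast
    then show "indicator {x \<in> P'. (T ^^ n) x \<in> J \<inter> {0<..<1}} x = (if P' = ?P then 1 else 0 :: complex)"
      using Tn by (simp add: indicator_def)
  qed
  also have "\<dots> = 1" using P finite_branches by simp
  finally show ?thesis using True by simp
next
  case False
  have "x \<notin> {x \<in> P. (T ^^ n) x \<in> J \<inter> {0<..<1}}" if P: "P \<in> branches \<I> T n" for P
  proof
    assume x: "x \<in> {x \<in> P. (T ^^ n) x \<in> J \<inter> {0<..<1}}"
    obtain w where w: "P = cylinder T w" "length w = n" "set w \<subseteq> \<I>"
      using P unfolding branches_def by blast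
    then have "\<forall>j<n. (T ^^ j) x \<in> \<Union>\<I>" using cylinder_orbit[OF w(3)] x by blast
    then show False using False x unfolding pullback_def by blast
  qed
  then have "(\<Sum>P\<in>branches \<I> T n. indicator {x \<in> P. (T ^^ n) x \<in> J \<inter> {0<..<1}} x) = (0 :: complex)"
    by (intro sum.neutral ballI indicator_simps(2))
  then show ?thesis using False by simp
qed

section \<open>Invariance of Lebesgue measure as a pointwise identity\<close>

text \<open>Invariance applied to \<open>{u<..<v}\<close>: each branch contributes the open interval
  between the two preimages, in either orientation, and these intervals are disjoint.\<close>

lemma inverse_branches_length:
  assumes y: "\<And>J u. J \<in> \<I> \<Longrightarrow> 0 < u \<Longrightarrow> u < 1 \<Longrightarrow> y J u \<in> J \<and> T (y J u) = u"
    and "0 < u" "u < v" "v < 1"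
  shows "(\<Sum>J\<in>\<I>. \<bar>y J v - y J u\<bar>) = v - u"
proof -
  let ?E = "\<lambda>J. {z \<in> J. T z \<in> {u<..<v}}"
  have E: "?E J = {min (y J u) (y J v)<..<max (y J u) (y J v)}" if J: "J \<in> \<I>" for J
  proof -
    have yJ: "y J u \<in> J" "y J v \<in> J" and Ty: "T (y J u) = u" "T (y J v) = v"
      using y[OF J] assms(2-4) by auto
    obtain a b where ab: "J = {a<..<b}" by (rule branch_ends[OF J])
    have iff: "z \<in> {u<..<v} \<longleftrightarrow> min u v < z \<and> z < max u v" for z using assms(3) by auto
    have "T z \<in> {u<..<v} \<longleftrightarrow> z \<in> {min (y J u) (y J v)<..<max (y J u) (y J v)}" if "z \<in> J" for z
      using strict_monotone_between[OF branch(2)[OF J] yJ that] unfolding iff Ty by simp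
    moreover have "{min (y J u) (y J v)<..<max (y J u) (y J v)} \<subseteq> J"
      using yJ unfolding ab by auto
    ultimately show ?thesis by blast
  qed
  have ms: "measure lebesgue (?E J) = \<bar>y J v - y J u\<bar>" if "J \<in> \<I>" for J
    unfolding E[OF that] by (simp add: min_def max_def)
  have "(\<Union>J\<in>\<I>. ?E J) = {x \<in> \<Union>\<I>. T x \<in> {u<..<v}}" by blast
  moreover have "{u<..<v} \<in> sets (lebesgue_on {0..1})"
    using assms(2-4) by (auto simp: sets_restrict_space intro!: image_eqI[of _ _ "{u<..<v}"])
  ultimately have "emeasure lebesgue (\<Union>J\<in>\<I>. ?E J) = emeasure lebesgue {u<..<v}"
    using invariant unfolding lebesgue_invariant_def by auto
  then have "measure lebesgue (\<Union>J\<in>\<I>. ?E J) = v - u"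
    using assms(3) by (simp add: measure_def)
  moreover have "measure lebesgue (\<Union>J\<in>\<I>. ?E J) = (\<Sum>J\<in>\<I>. measure lebesgue (?E J))"
  proof (rule measure_finite_Union[OF finite_\<I>])
    show "?E ` \<I> \<subseteq> sets lebesgue" using E by auto
    show "disjoint_family_on ?E \<I>"
      unfolding disjoint_family_on_def using member_eq by blast
    show "emeasure lebesgue (?E J) \<noteq> \<infinity>" if "J \<in> \<I>" for J
      unfolding E[OF that] by simp
  qed
  ultimately show ?thesis using ms by simp
qed

text \<open>Differentiating the total length of the preimages of an interval in one of its end points.\<close>

lemma sum_inverse_deriv:
  assumes x: "0 < x" "x < 1"
  shows "(\<Sum>y\<in>{y \<in> \<Union>\<I>. T y = x}. 1 / \<bar>deriv T y\<bar>) = 1"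
proof -
  define y where "y J u = the_inv_into J T u" for J u
  have y: "y J u \<in> J \<and> T (y J u) = u" if J: "J \<in> \<I>" and u: "0 < u" "u < 1" for J u
  proof -
    have "u \<in> T ` J" "inj_on T J" using branch(1)[OF J] u unfolding bij_betw_def by auto
    then show ?thesis
      unfolding y_def using the_inv_into_into[of T J u J] f_the_inv_into_f[of T J u] by auto
  qed
  note len = inverse_branches_length[of y, OF y]
  have len': "(\<Sum>J\<in>\<I>. \<bar>y J v - y J x\<bar>) = \<bar>v - x\<bar>" if "0 < v" "v < 1" for v
  proof (cases v x rule: linorder_cases)
    case less
    then show ?thesis using len[OF _ _ _ \<open>0 < v\<close> less x(2)] by (simp add: abs_minus_commute)
  next
    case greater
    then show ?thesis using len[OF _ _ _ x(1) greater that(2)] by simp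
  qed simp
  \<comment> \<open>One term is at most the whole sum, so invariance itself supplies the continuity
    of the inverse branches at \<open>x\<close> that their differentiation requires.\<close>
  have lip: "\<bar>y J v - y J x\<bar> \<le> \<bar>v - x\<bar>" if "J \<in> \<I>" "0 < v" "v < 1" for J v
    using member_le_sum[OF that(1), of "\<lambda>J. \<bar>y J v - y J x\<bar>"] finite_\<I> len'[OF that(2,3)] by simp
  have ev: "\<forall>\<^sub>F v in at x. v \<in> {0<..<1} \<and> v \<noteq> x"
    using x by (intro eventually_conj eventually_at_in_open' eventually_neq_at_within) auto
  have lim: "((\<lambda>v. \<bar>y J v - y J x\<bar> / \<bar>v - x\<bar>) \<longlongrightarrow> 1 / \<bar>deriv T (y J x)\<bar>) (at x)" if J: "J \<in> \<I>" for J
  proof -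
    have yJ: "y J x \<in> \<Union>\<I>" using y[OF J x] J by blast
    have "((\<lambda>v. y J v - y J x) \<longlongrightarrow> 0) (at x)"
    proof (rule Lim_null_comparison)
      show "\<forall>\<^sub>F v in at x. norm (y J v - y J x) \<le> \<bar>v - x\<bar>"
        using ev by eventually_elim (simp add: lip[OF J])
      have "((\<lambda>v. \<bar>v - x\<bar>) \<longlongrightarrow> \<bar>x - x\<bar>) (at x)" by (intro tendsto_intros)
      then show "((\<lambda>v. \<bar>v - x\<bar>) \<longlongrightarrow> 0) (at x)" by simp
    qed
    then have "continuous (at x) (y J)" unfolding continuous_at by (rule LIM_zero_cancel)
    then have "(y J has_real_derivative inverse (deriv T (y J x))) (at x)"
      using deriv_gt_1[OF yJ] x y[OF J]
      by (intro has_field_derivative_inverse_basic[where f = T and t = "{0<..<1}"] T_derivative[OF yJ])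
        auto
    then have "((\<lambda>v. \<bar>(y J v - y J x) / (v - x)\<bar>) \<longlongrightarrow> \<bar>inverse (deriv T (y J x))\<bar>) (at x)"
      unfolding has_field_derivative_iff by (rule tendsto_rabs)
    then show ?thesis by (simp add: abs_divide abs_inverse inverse_eq_divide)
  qed
  have "((\<lambda>v. \<Sum>J\<in>\<I>. \<bar>y J v - y J x\<bar> / \<bar>v - x\<bar>) \<longlongrightarrow> (\<Sum>J\<in>\<I>. 1 / \<bar>deriv T (y J x)\<bar>)) (at x)"
    by (rule tendsto_sum) (rule lim)
  moreover have "\<forall>\<^sub>F v in at x. (\<Sum>J\<in>\<I>. \<bar>y J v - y J x\<bar> / \<bar>v - x\<bar>) = 1"
    using ev by eventually_elim (simp add: sum_divide_distrib[symmetric] len')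
  ultimately have "((\<lambda>v. 1) \<longlongrightarrow> (\<Sum>J\<in>\<I>. 1 / \<bar>deriv T (y J x)\<bar>)) (at x)"
    by (rule Lim_transform_eventually)
  then have one: "(\<Sum>J\<in>\<I>. 1 / \<bar>deriv T (y J x)\<bar>) = 1"
    by (rule LIM_const_eq[symmetric])
  have "bij_betw (\<lambda>J. y J x) \<I> {y \<in> \<Union>\<I>. T y = x}"
  proof (rule bij_betwI')
    show "y J x = y J' x \<longleftrightarrow> J = J'" if "J \<in> \<I>" "J' \<in> \<I>" for J J'
      using member_eq[of J "y J x" J'] y[OF that(1) x] y[OF that(2) x] that by auto
    show "y J x \<in> {y \<in> \<Union>\<I>. T y = x}" if "J \<in> \<I>" for J using y[OF that x] that by blast
    fix z assume "z \<in> {y \<in> \<Union>\<I>. T y = x}"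
    then obtain J where J: "J \<in> \<I>" "z \<in> J" "T z = x" by blast
    then have "y J x = z"
      using branch(1)[OF J(1)] the_inv_into_f_f[of T J z] unfolding y_def bij_betw_def by blast
    then show "\<exists>J\<in>\<I>. z = y J x" using J(1) by blast
  qed
  from sum.reindex_bij_betw[OF this, of "\<lambda>y. 1 / \<bar>deriv T y\<bar>"] show ?thesis using one by simp
qed

lemma ae_eq_interior:
  assumes "\<And>x. 0 < x \<Longrightarrow> x < 1 \<Longrightarrow> f x = g x"
  shows "f \<approx> g"
proof -
  have "AE x in lebesgue. x \<in> {0..1} \<longrightarrow> f x = g x"
  proof (rule AE_I'[of "{0, 1}"])
    show "{0, 1 :: real} \<in> null_sets lebesgue" by (simp add: negligible_iff_null_sets[symmetric])
    show "{x \<in> space lebesgue. \<not> (x \<in> {0..1} \<longrightarrow> f x = g x)} \<subseteq> {0, 1}"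
    proof
      fix x assume "x \<in> {x \<in> space lebesgue. \<not> (x \<in> {0..1} \<longrightarrow> f x = g x)}"
      then show "x \<in> {0, 1}" using assms[of x] by force
    qed
  qed
  then show ?thesis unfolding ae_eq_def by (simp add: AE_restrict_space_iff)
qed

text \<open>By \<open>pullback_Suc\<close> the indicator is constant on the fibre over
  \<open>x\<close>, so it factors out and leaves weights that sum to 1 by
  \<open>sum_inverse_deriv\<close>.\<close>

lemma transfer_op_pullback:
  "transfer_op \<I> T (indicator (pullback J (Suc n))) \<approx> indicator (pullback J n)"
proof (rule ae_eq_interior)
  fix x :: real assume x: "0 < x" "x < 1"
  have "transfer_op \<I> T (indicator (pullback J (Suc n))) x =
      (\<Sum>y\<in>{y \<in> \<Union>\<I>. T y = x}. indicator (pullback J n) x * of_real (1 / \<bar>deriv T y\<bar>))"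
    unfolding transfer_op_def
  proof (rule sum.cong[OF refl])
    fix y assume y: "y \<in> {y \<in> \<Union>\<I>. T y = x}"
    then have "y \<in> pullback J (Suc n) \<longleftrightarrow> x \<in> pullback J n" using pullback_Suc by blast
    then show "indicator (pullback J (Suc n)) y / complex_of_real \<bar>deriv T y\<bar> =
        indicator (pullback J n) x * complex_of_real (1 / \<bar>deriv T y\<bar>)"
      by (simp add: indicator_def)
  qed
  also have "\<dots> = indicator (pullback J n) x * of_real (\<Sum>y\<in>{y \<in> \<Union>\<I>. T y = x}. 1 / \<bar>deriv T y\<bar>)"
    by (simp add: sum_distrib_left)
  also have "\<dots> = indicator (pullback J n) x" by (simp only: sum_inverse_deriv[OF x]) simp
  finally show "transfer_op \<I> T (indicator (pullback J (Suc n))) x = indicator (pullback J n) x" .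
qed

end

section \<open>The growth rate of the branch contractions\<close>

text \<open>Fekete's lemma in multiplicative form, with the infimum of the roots as limit. Working
  without logarithms admits sequences with zero terms.\<close>

lemma submultiplicative_root_converges:
  fixes a :: "nat \<Rightarrow> real"
  assumes nonneg: "\<And>n. 0 \<le> a n" and sub: "\<And>m n. a (m + n) \<le> a m * a n"
  obtains L where "0 \<le> L" "(\<lambda>n. root n (a n)) \<longlonglongrightarrow> L"
proof -
  define L where "L = (INF n\<in>{1..}. root n (a n))"
  have bdd: "bdd_below ((\<lambda>n. root n (a n)) ` {1..})"
    using nonneg by (intro bdd_belowI2[of _ 0]) auto
  have L0: "0 \<le> L" unfolding L_def using nonneg by (intro cINF_greatest) auto
  have "(\<lambda>n. root n (a n)) \<longlonglongrightarrow> L"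
  proof (rule order_tendstoI)
    fix y assume "y < L"
    have "y < root n (a n)" if "n \<ge> 1" for n
    proof -
      have "L \<le> root n (a n)" unfolding L_def using that by (intro cINF_lower bdd) auto
      then show ?thesis using \<open>y < L\<close> by linarith
    qed
    then show "\<forall>\<^sub>F n in sequentially. y < root n (a n)"
      unfolding eventually_sequentially by blast
  next
    fix y assume "L < y"
    then have "\<exists>m\<in>{1..}. root m (a m) < y"
      unfolding L_def by (subst (asm) cINF_less_iff[OF _ bdd]) auto
    then obtain m where m: "m \<ge> 1" "root m (a m) < y" by auto
    \<comment> \<open>The gap between \<open>x\<close> and \<open>y\<close> leaves room for the
      factor \<open>root n M\<close>, which tends to 1.\<close>
    obtain x where x: "root m (a m) < x" "x < y" using dense[OF m(2)] by blast
    have x0: "x > 0" using x(1) nonneg[of m] by (meson order_le_less_trans real_root_ge_zero)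
    have am: "a m \<le> x ^ m"
    proof -
      have "a m = root m (a m) ^ m" using m(1) nonneg[of m] by simp
      also have "\<dots> \<le> x ^ m" using x(1) m(1) nonneg[of m] by (intro power_mono) auto
      finally show ?thesis .
    qed
    \<comment> \<open>Bounds the remainders in the division of \<open>n\<close> by \<open>m\<close>:
      each \<open>a i\<close> with \<open>i < m\<close> is at most \<open>M * x ^ i\<close>. The
      summand 1 keeps \<open>M\<close> positive.\<close>
    define M where "M = 1 + (\<Sum>i<m. a i / x ^ i)"
    have sum0: "(\<Sum>i<m. a i / x ^ i) \<ge> 0" using nonneg x0 by (intro sum_nonneg) auto
    then have M: "M > 0" unfolding M_def by linarith
    have rem: "a i \<le> M * x ^ i" if "i < m" for i
    proof -
      have "a i / x ^ i \<le> (\<Sum>i<m. a i / x ^ i)"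
        using that nonneg x0 by (intro member_le_sum) auto
      then have "a i / x ^ i \<le> M" unfolding M_def by linarith
      then show ?thesis using x0 by (simp add: divide_le_eq)
    qed
    have step: "a (q * m + i) \<le> x ^ (q * m) * a i" for q i
    proof (induction q)
      case (Suc q)
      have "a (Suc q * m + i) \<le> a m * a (q * m + i)" using sub[of m "q * m + i"] by (simp add: add.assoc)
      also have "\<dots> \<le> x ^ m * (x ^ (q * m) * a i)"
        using am Suc nonneg x0 by (intro mult_mono) auto
      finally show ?case by (simp add: power_add mult.assoc)
    qed simp
    have bound: "a n \<le> M * x ^ n" for n
    proof -
      have n: "n = n div m * m + n mod m" by simp
      have "a n \<le> x ^ (n div m * m) * a (n mod m)" using step[of "n div m" "n mod m"] n by metis
      also have "\<dots> \<le> x ^ (n div m * m) * (M * x ^ (n mod m))"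
        using rem[of "n mod m"] m(1) x0 by (intro mult_left_mono) auto
      also have "\<dots> = M * x ^ (n div m * m + n mod m)" by (simp only: power_add mult_ac)
      finally show ?thesis by simp
    qed
    have "(\<lambda>n. root n M * x) \<longlonglongrightarrow> 1 * x"
      by (intro tendsto_mult LIMSEQ_root_const M tendsto_const)
    then have "\<forall>\<^sub>F n in sequentially. root n M * x < y"
      using x(2) by (intro order_tendstoD(2)[of _ x]) auto
    moreover have "\<forall>\<^sub>F n in sequentially. n \<ge> 1" by (rule eventually_ge_at_top)
    ultimately show "\<forall>\<^sub>F n in sequentially. root n (a n) < y"
    proof eventually_elim
      case (elim n)
      have "root n (a n) \<le> root n (M * x ^ n)" using elim bound by (intro real_root_le_mono) auto
      also have "\<dots> = root n M * x" using elim x0 by (simp add: real_root_mult real_root_power_cancel)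
      finally show ?case using elim by linarith
    qed
  qed
  with L0 that show thesis by blast
qed

context full_branch_map
begin

lemma cylinder_append:
  assumes "set v \<subseteq> \<I>"
  shows "cylinder T (v @ w) = {x \<in> cylinder T v. (T ^^ length v) x \<in> cylinder T w}"
  using assms
proof (induction v)
  case Nil
  then show ?case by (auto simp: cylinder_def)
next
  case (Cons J v)
  then show ?case
    by (auto simp: cylinder_Cons funpow_Suc_right simp del: funpow.simps)
qed

lemma branches_add:
  assumes "P \<in> branches \<I> T (m + n)"
  obtains P1 P2 where "P1 \<in> branches \<I> T m" "P2 \<in> branches \<I> T n" "P = {x \<in> P1. (T ^^ m) x \<in> P2}"
proof -
  obtain w where w: "P = cylinder T w" "length w = m + n" "set w \<subseteq> \<I>" and ne: "P \<noteq> {}"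
    using assms unfolding branches_def by blast
  let ?v = "take m w" and ?u = "drop m w"
  have v: "set ?v \<subseteq> \<I>" "length ?v = m" and u: "set ?u \<subseteq> \<I>" "length ?u = n"
    using w set_take_subset[of m w] set_drop_subset[of m w] by auto
  have P: "P = {x \<in> cylinder T ?v. (T ^^ m) x \<in> cylinder T ?u}"
    using cylinder_append[OF v(1), of ?u] w(1) v(2) by simp
  then have "cylinder T ?v \<noteq> {}" "cylinder T ?u \<noteq> {}" using ne by auto
  then have "cylinder T ?v \<in> branches \<I> T m" "cylinder T ?u \<in> branches \<I> T n"
    unfolding branches_def using v u by blast+
  with P show thesis using that by blast
qed

text \<open>The chain rule factors the derivative at every point of \<open>P\<close>, and each
  factor is bounded by its own supremum.\<close>

lemma theta_add:
  assumes P: "P \<in> branches \<I> T (m + n)"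
    and P1: "P1 \<in> branches \<I> T m" and P2: "P2 \<in> branches \<I> T n"
    and eq: "P = {x \<in> P1. (T ^^ m) x \<in> P2}"
  shows "\<theta> (m + n) P \<le> \<theta> m P1 * \<theta> n P2"
proof (rule cSUP_least)
  show "P \<noteq> {}" using P unfolding branches_def by blast
  fix x assume x: "x \<in> P"
  obtain w where w: "P = cylinder T w" "length w = m + n" "set w \<subseteq> \<I>"
    using P unfolding branches_def by blast
  have orb: "(T ^^ j) x \<in> \<Union>\<I>" if "j < m + n" for j
    using cylinder_orbit[OF w(3), of x j] w x that by simp
  have orb2: "(T ^^ j) ((T ^^ m) x) \<in> \<Union>\<I>" if "j < n" for j
    using orb[of "j + m"] that by (simp add: funpow_add)
  have "deriv (T ^^ (m + n)) x = (\<Prod>j<m + n. deriv T ((T ^^ j) x))"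
    by (rule iterate_deriv(1)) (rule orb)
  also have "\<dots> = (\<Prod>j<m. deriv T ((T ^^ j) x)) * (\<Prod>j<n. deriv T ((T ^^ (m + j)) x))"
    by (induction n) (simp_all add: mult.assoc)
  also have "\<dots> = deriv (T ^^ m) x * deriv (T ^^ n) ((T ^^ m) x)"
    using iterate_deriv(1)[of m x] iterate_deriv(1)[of n "(T ^^ m) x"] orb orb2
    by (simp add: funpow_add add.commute)
  finally have "1 / \<bar>deriv (T ^^ (m + n)) x\<bar> =
      (1 / \<bar>deriv (T ^^ m) x\<bar>) * (1 / \<bar>deriv (T ^^ n) ((T ^^ m) x)\<bar>)"
    by (simp add: abs_mult)
  also have "\<dots> \<le> \<theta> m P1 * \<theta> n P2"
    using x eq theta_pos[OF P1] by (intro mult_mono theta_upper P1 P2) auto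
  finally show "1 / \<bar>deriv (T ^^ (m + n)) x\<bar> \<le> \<theta> m P1 * \<theta> n P2" .
qed

lemma Theta_nonneg: "0 \<le> Theta \<I> T n \<gamma>"
  unfolding Theta_def by (intro sum_nonneg) auto

text \<open>Every branch of order \<open>m + n\<close> comes from a pair of branches of orders
  \<open>m\<close> and \<open>n\<close>, so the sum is at most the sum over all pairs, which is the
  product. The bound on each term survives the power because
  \<open>\<gamma> \<ge> 0\<close>.\<close>

lemma Theta_submultiplicative:
  assumes "0 \<le> \<gamma>"
  shows "Theta \<I> T (m + n) \<gamma> \<le> Theta \<I> T m \<gamma> * Theta \<I> T n \<gamma>"
proof -
  define g where "g = (\<lambda>(P1, P2). {x \<in> P1. (T ^^ m) x \<in> P2})"
  \<comment> \<open>Only pairs that produce an actual branch, so that no supremum over an empty set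
    occurs in the comparison.\<close>
  define X where "X = {Q \<in> branches \<I> T m \<times> branches \<I> T n. g Q \<in> branches \<I> T (m + n)}"
  have XF: "finite (branches \<I> T m \<times> branches \<I> T n)" using finite_branches by blast
  then have finX: "finite X" unfolding X_def by simp
  have "branches \<I> T (m + n) \<subseteq> g ` X"
  proof
    fix P assume P: "P \<in> branches \<I> T (m + n)"
    obtain P1 P2 where Q: "P1 \<in> branches \<I> T m" "P2 \<in> branches \<I> T n"
      "P = {x \<in> P1. (T ^^ m) x \<in> P2}" by (rule branches_add[OF P])
    then have "P = g (P1, P2)" "(P1, P2) \<in> X" using P unfolding X_def g_def by auto
    then show "P \<in> g ` X" by blast
  qed
  then have gX: "branches \<I> T (m + n) = g ` X" unfolding X_def by blast
  have "Theta \<I> T (m + n) \<gamma> = (\<Sum>P\<in>g ` X. \<theta> (m + n) P powr \<gamma>)"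
    unfolding Theta_def gX ..
  also have "\<dots> \<le> (\<Sum>Q\<in>X. \<theta> (m + n) (g Q) powr \<gamma>)"
    using sum_image_le[OF finX, of "\<lambda>P. \<theta> (m + n) P powr \<gamma>" g] by (simp add: comp_def)
  also have "\<dots> \<le> (\<Sum>Q\<in>X. \<theta> m (fst Q) powr \<gamma> * \<theta> n (snd Q) powr \<gamma>)"
  proof (rule sum_mono)
    fix Q assume Q: "Q \<in> X"
    then have Q': "fst Q \<in> branches \<I> T m" "snd Q \<in> branches \<I> T n" "g Q \<in> branches \<I> T (m + n)"
      unfolding X_def by auto
    have "g Q = {x \<in> fst Q. (T ^^ m) x \<in> snd Q}" unfolding g_def by (simp add: case_prod_beta)
    then have "\<theta> (m + n) (g Q) \<le> \<theta> m (fst Q) * \<theta> n (snd Q)" by (rule theta_add[OF Q'(3,1,2)])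
    then have "\<theta> (m + n) (g Q) powr \<gamma> \<le> (\<theta> m (fst Q) * \<theta> n (snd Q)) powr \<gamma>"
      using assms theta_pos[OF Q'(3)] by (intro powr_mono2) auto
    also have "\<dots> = \<theta> m (fst Q) powr \<gamma> * \<theta> n (snd Q) powr \<gamma>"
      by (rule powr_mult)
    finally show "\<theta> (m + n) (g Q) powr \<gamma> \<le> \<theta> m (fst Q) powr \<gamma> * \<theta> n (snd Q) powr \<gamma>" .
  qed
  also have "\<dots> \<le> (\<Sum>Q\<in>branches \<I> T m \<times> branches \<I> T n. \<theta> m (fst Q) powr \<gamma> * \<theta> n (snd Q) powr \<gamma>)"
    by (rule sum_mono2[OF XF]) (auto simp: X_def)
  also have "\<dots> = Theta \<I> T m \<gamma> * Theta \<I> T n \<gamma>"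
    by (simp add: Theta_def sum_product sum.cartesian_product case_prod_beta)
  finally show ?thesis .
qed

text \<open>\<open>Theta_inf\<close> is defined through \<open>lim\<close>, which carries
  information only once convergence is known.\<close>

lemma Theta_inf_limit:
  assumes "0 \<le> \<gamma>"
  shows "(\<lambda>n. root n (Theta \<I> T n \<gamma>)) \<longlonglongrightarrow> Theta_inf \<I> T \<gamma>" "0 \<le> Theta_inf \<I> T \<gamma>"
proof -
  obtain L where L: "0 \<le> L" "(\<lambda>n. root n (Theta \<I> T n \<gamma>)) \<longlonglongrightarrow> L"
    by (rule submultiplicative_root_converges[OF Theta_nonneg Theta_submultiplicative[OF assms]])
  then have "Theta_inf \<I> T \<gamma> = L" unfolding Theta_inf_def by (intro limI)
  with L show "(\<lambda>n. root n (Theta \<I> T n \<gamma>)) \<longlonglongrightarrow> Theta_inf \<I> T \<gamma>" "0 \<le> Theta_inf \<I> T \<gamma>"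
    by auto
qed

lemma summable_Theta:
  assumes "0 \<le> \<gamma>" "0 < \<rho>" "\<rho> < 1 / Theta_inf \<I> T \<gamma>"
  shows "summable (\<lambda>n. \<rho> ^ n * Theta \<I> T n \<gamma>)"
proof -
  \<comment> \<open>Were the limit 0, the convention \<open>1 / 0 = 0\<close> would make the two
    bounds on \<open>\<rho>\<close> incompatible.\<close>
  have pos: "Theta_inf \<I> T \<gamma> > 0"
    using assms(2,3) Theta_inf_limit(2)[OF assms(1)] by (cases "Theta_inf \<I> T \<gamma> = 0") auto
  have "(\<lambda>n. \<rho> * root n (Theta \<I> T n \<gamma>)) \<longlonglongrightarrow> \<rho> * Theta_inf \<I> T \<gamma>"
    by (intro tendsto_mult tendsto_const Theta_inf_limit(1) assms(1))
  moreover have "\<forall>\<^sub>F n in sequentially. \<rho> * root n (Theta \<I> T n \<gamma>) = root n (norm (\<rho> ^ n * Theta \<I> T n \<gamma>))"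
    using eventually_ge_at_top[of 1]
  proof eventually_elim
    case (elim n)
    show ?case
      using elim assms(2) Theta_nonneg[of n \<gamma>] by (simp add: real_root_mult real_root_power_cancel abs_mult)
  qed
  ultimately have "(\<lambda>n. root n (norm (\<rho> ^ n * Theta \<I> T n \<gamma>))) \<longlonglongrightarrow> \<rho> * Theta_inf \<I> T \<gamma>"
    by (rule Lim_transform_eventually)
  moreover have "\<rho> * Theta_inf \<I> T \<gamma> < 1" using assms(3) pos by (simp add: field_simps)
  ultimately show ?thesis by (rule root_test_convergence)
qed

end

section \<open>Natural norms of intervals and the Besov space\<close>

text \<open>The affine map \<open>(x - p) / (q - p)\<close> carries the interval onto
  \<open>{0..1}\<close>. Its slope is the inverse of the length, so the degree \<open>t\<close>
  turns into the exponent \<open>- t\<close>; the constant is the one from naturality, the same for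
  all intervals.\<close>

lemma purely_natural_interval:
  assumes n: "purely_natural B n" and ind: "\<And>J. J \<in> subintervals \<Longrightarrow> indicator J \<in> B"
  shows "\<exists>t C. C > 0 \<and> (\<forall>P\<in>subintervals.
    1 / C * measure lebesgue P powr (- t) * n (indicator {0..1}) \<le> n (indicator P) \<and>
    n (indicator P) \<le> C * measure lebesgue P powr (- t) * n (indicator {0..1}))"
proof -
  have pn: "pseudo_norm_on B n" using n unfolding purely_natural_def by blast
  obtain t C where C: "C > 0" and tC: "\<forall>a b. \<forall>\<phi>\<in>B. a \<noteq> 0 \<and> (\<lambda>x. a * x + b) -` ess_supp \<phi> \<subseteq> {0..1} \<longrightarrow>
        (\<lambda>x. zero_ext \<phi> (a * x + b)) \<in> B \<and>
        1 / C * \<bar>a\<bar> powr t * n \<phi> \<le> n (\<lambda>x. zero_ext \<phi> (a * x + b)) \<and>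
        n (\<lambda>x. zero_ext \<phi> (a * x + b)) \<le> C * \<bar>a\<bar> powr t * n \<phi>"
    using n unfolding purely_natural_def by (elim conjE exE)
  let ?\<phi> = "indicator {0..1} :: real \<Rightarrow> complex"
  have I: "{0..1 :: real} \<in> subintervals" by (rule subintervalI[of 0 1]) auto
  have supp: "ess_supp ?\<phi> \<subseteq> {0..1}"
  proof -
    have "- {0..1 :: real} \<subseteq> \<Union>{U. open U \<and> (AE x in lebesgue. x \<in> U \<longrightarrow> zero_ext ?\<phi> x = 0)}"
      by (intro Union_upper) (auto simp: zero_ext_def)
    then show ?thesis unfolding ess_supp_def by blast
  qed
  have "1 / C * measure lebesgue P powr (- t) * n ?\<phi> \<le> n (indicator P) \<and>
    n (indicator P) \<le> C * measure lebesgue P powr (- t) * n ?\<phi>" if P: "P \<in> subintervals" for P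
  proof -
    obtain p q where pq: "0 \<le> p" "p < q" "q \<le> 1" "{p<..<q} \<subseteq> P" "P \<subseteq> {p..q}"
      by (rule subintervalE[OF P])
    have mP: "measure lebesgue P = q - p" using interval_lebesgue(2)[OF _ pq(4,5)] pq(2) by simp
    define a b where "a = 1 / (q - p)" and "b = - p / (q - p)"
    have iff: "0 \<le> a * x + b \<and> a * x + b \<le> 1 \<longleftrightarrow> p \<le> x \<and> x \<le> q" for x
    proof -
      have "a * x + b = (x - p) / (q - p)" unfolding a_def b_def by (simp add: diff_divide_distrib)
      then show ?thesis using pq(2) by (simp add: zero_le_divide_iff divide_le_eq)
    qed
    have "(\<lambda>x. zero_ext ?\<phi> (a * x + b)) = indicator {p..q}"
      using iff by (auto simp: zero_ext_def indicator_def fun_eq_iff)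
    moreover have "(\<lambda>x. a * x + b) -` ess_supp ?\<phi> \<subseteq> {0..1}"
    proof
      fix x assume "x \<in> (\<lambda>x. a * x + b) -` ess_supp ?\<phi>"
      then have "a * x + b \<in> {0..1}" using supp by blast
      then show "x \<in> {0..1}" using iff[of x] pq by simp
    qed
    moreover have "a \<noteq> 0" unfolding a_def using pq(2) by simp
    moreover have "\<bar>a\<bar> powr t = measure lebesgue P powr (- t)"
      unfolding mP a_def using pq(2) by (simp add: powr_divide powr_minus_divide)
    moreover have "n (indicator P) = n (indicator {p..q})"
      by (rule pseudo_norm_onD(4)[OF pn ind[OF P] ind indicator_ae_eq_Icc[OF pq(4,5)]])
        (rule subintervalI[OF pq(1-3)], auto)
    ultimately show ?thesis using tC[rule_format, OF ind[OF I], of a b] by simp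
  qed
  with C show ?thesis by blast
qed

lemma powr_unbounded_near_0:
  fixes \<alpha> M :: real
  assumes "\<alpha> < 0"
  obtains \<epsilon> where "0 < \<epsilon>" "\<epsilon> \<le> 1 / 4" "M < \<epsilon> powr \<alpha>"
proof -
  \<comment> \<open>\<open>y powr (1 / \<alpha>)\<close> will be the small number. The first
    argument of \<open>max\<close> makes its power exceed \<open>M\<close>; the second caps it at
    1/4, as \<open>1 / \<alpha>\<close> is negative.\<close>
  define y where "y = max (M + 1) ((1 / 4) powr \<alpha>)"
  have y: "M < y" "(1 / 4) powr \<alpha> \<le> y" unfolding y_def by auto
  have y0: "0 < y" using y(2) by (rule less_le_trans[rotated]) simp
  show thesis
  proof (rule that[of "y powr (1 / \<alpha>)"])
    show "0 < y powr (1 / \<alpha>)" using y0 by simp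
    have "y powr (1 / \<alpha>) \<le> ((1 / 4) powr \<alpha>) powr (1 / \<alpha>)"
      using y(2) assms by (intro powr_mono2') auto
    then show "y powr (1 / \<alpha>) \<le> 1 / 4" using assms by (simp add: powr_powr)
    show "M < (y powr (1 / \<alpha>)) powr \<alpha>" using y(1) y0 assms by (simp add: powr_powr)
  qed
qed

text \<open>Among the homogeneous parts that do not vanish on the unit interval, the one of largest degree
  dominates on small intervals. The exponent is nonnegative because a short initial interval is the
  difference of two long ones, and at most 1 because of the embedding into \<open>L\<^sup>1\<close>.\<close>

lemma natural_norm_interval:
  assumes banach: "banach_in_L1 B N" and nat: "natural_norm B N"
    and ind: "\<And>J. J \<in> subintervals \<Longrightarrow> indicator J \<in> B"
  obtains \<alpha> C where "0 \<le> \<alpha>" "\<alpha> \<le> 1" "C > 0"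
    "\<And>P. P \<in> subintervals \<Longrightarrow> 1 / C * measure lebesgue P powr \<alpha> \<le> N (indicator P)"
    "\<And>P. P \<in> subintervals \<Longrightarrow> N (indicator P) \<le> C * measure lebesgue P powr \<alpha>"
proof -
  interpret L1_banach B N using banach by unfold_locales
  obtain j :: nat and n where pn: "\<And>i. i \<le> j \<Longrightarrow> purely_natural B (n i)"
    and N: "\<And>\<phi>. \<phi> \<in> B \<Longrightarrow> N \<phi> = (\<Sum>i\<le>j. n i \<phi>)"
    using nat unfolding natural_norm_def by blast
  let ?I = "indicator {0..1} :: real \<Rightarrow> complex"
  have I: "{0..1 :: real} \<in> subintervals" by (rule subintervalI[of 0 1]) auto
  have "\<forall>i\<in>{..j}. \<exists>t C. C > 0 \<and> (\<forall>P\<in>subintervals.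
    1 / C * measure lebesgue P powr (- t) * n i ?I \<le> n i (indicator P) \<and>
    n i (indicator P) \<le> C * measure lebesgue P powr (- t) * n i ?I)"
    using purely_natural_interval[OF pn ind] by blast
  from bchoice[OF this] obtain t where "\<forall>i\<in>{..j}. \<exists>C. C > 0 \<and> (\<forall>P\<in>subintervals.
    1 / C * measure lebesgue P powr (- t i) * n i ?I \<le> n i (indicator P) \<and>
    n i (indicator P) \<le> C * measure lebesgue P powr (- t i) * n i ?I)" ..
  from bchoice[OF this] obtain C where tC: "\<forall>i\<in>{..j}. C i > 0 \<and> (\<forall>P\<in>subintervals.
    1 / C i * measure lebesgue P powr (- t i) * n i ?I \<le> n i (indicator P) \<and>
    n i (indicator P) \<le> C i * measure lebesgue P powr (- t i) * n i ?I)" ..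
  have C: "C i > 0" if "i \<le> j" for i using tC that by simp
  have lower: "1 / C i * measure lebesgue P powr (- t i) * n i ?I \<le> n i (indicator P)"
    and upper: "n i (indicator P) \<le> C i * measure lebesgue P powr (- t i) * n i ?I"
    if "i \<le> j" "P \<in> subintervals" for i P
    using tC that by auto
  have n0: "0 \<le> n i f" if "i \<le> j" "f \<in> B" for i f
    using pseudo_norm_onD(1)[of B "n i" f] pn[OF that(1)] that(2) unfolding purely_natural_def by blast
  have meas: "0 < measure lebesgue P \<and> measure lebesgue P \<le> 1" if P: "P \<in> subintervals" for P
  proof -
    obtain p q where pq: "0 \<le> p" "p < q" "q \<le> 1" "{p<..<q} \<subseteq> P" "P \<subseteq> {p..q}"
      by (rule subintervalE[OF P])
    then show ?thesis using interval_lebesgue(2)[OF _ pq(4,5)] by simp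
  qed
  have L1_ind: "L1_norm (indicator P) = measure lebesgue P" if "P \<in> subintervals" for P
    using L1_norm_indicator[OF subinterval_measurable[OF that]] that unfolding subintervals_def by blast
  obtain C\<^sub>1 where C1: "C\<^sub>1 > 0" "\<And>f. f \<in> B \<Longrightarrow> L1_norm f \<le> C\<^sub>1 * N f" using L1_norm_bound by blast
  have "0 < N ?I"
  proof -
    have "0 < C\<^sub>1 * N ?I" using C1(2)[OF ind[OF I]] L1_ind[OF I] by simp
    then show ?thesis using C1(1) by (simp add: zero_less_mult_iff)
  qed
  \<comment> \<open>By the two-sided bound, a part that vanishes on the unit interval vanishes on
    all intervals. Not all parts do, since the embedding into \<open>L1\<close> makes
    \<open>N ?I\<close> positive.\<close>
  define A where "A = {i. i \<le> j \<and> 0 < n i ?I}"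
  have finA: "finite A" unfolding A_def by simp
  have "A \<noteq> {}"
  proof
    assume "A = {}"
    then have "n i ?I = 0" if "i \<le> j" for i
      using n0[OF that ind[OF I]] that unfolding A_def by force
    then show False using N[OF ind[OF I]] \<open>0 < N ?I\<close> by simp
  qed
  define \<alpha> where "\<alpha> = - Max (t ` A)"
  have "Max (t ` A) \<in> t ` A" using finA \<open>A \<noteq> {}\<close> by (intro Max_in) auto
  then obtain i\<^sub>0 where i0: "i\<^sub>0 \<in> A" "t i\<^sub>0 = - \<alpha>" unfolding \<alpha>_def by auto
  have tA: "t i \<le> - \<alpha>" if "i \<in> A" for i unfolding \<alpha>_def using finA that by simp
  define K where "K = (\<Sum>i\<le>j. C i * n i ?I)"
  define k where "k = 1 / C i\<^sub>0 * n i\<^sub>0 ?I"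
  have k: "0 < k" using i0(1) C unfolding k_def A_def by simp
  have K: "0 \<le> K" unfolding K_def using C n0[OF _ ind[OF I]]
    by (intro sum_nonneg mult_nonneg_nonneg) (auto intro: less_imp_le)
  have up: "N (indicator P) \<le> K * measure lebesgue P powr \<alpha>" if P: "P \<in> subintervals" for P
  proof -
    have "n i (indicator P) \<le> C i * n i ?I * measure lebesgue P powr \<alpha>" if "i \<le> j" for i
    proof -
      have "C i * measure lebesgue P powr (- t i) * n i ?I \<le> C i * measure lebesgue P powr \<alpha> * n i ?I"
      proof (cases "i \<in> A")
        case True
        then have "measure lebesgue P powr (- t i) \<le> measure lebesgue P powr \<alpha>"
          using tA[OF True] meas[OF P] by (intro powr_mono') auto
        then show ?thesis using C[OF that] n0[OF that ind[OF I]]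
          by (intro mult_right_mono mult_left_mono) auto
      next
        case False
        then have "n i ?I = 0" using n0[OF that ind[OF I]] that unfolding A_def by force
        then show ?thesis by simp
      qed
      then show ?thesis using upper[OF that P] by (simp add: mult_ac)
    qed
    then have "(\<Sum>i\<le>j. n i (indicator P)) \<le> (\<Sum>i\<le>j. C i * n i ?I * measure lebesgue P powr \<alpha>)"
      by (intro sum_mono) simp
    then show ?thesis unfolding N[OF ind[OF P]] K_def sum_distrib_right .
  qed
  have low: "k * measure lebesgue P powr \<alpha> \<le> N (indicator P)" if P: "P \<in> subintervals" for P
  proof -
    have "i\<^sub>0 \<le> j" using i0(1) unfolding A_def by simp
    have "k * measure lebesgue P powr \<alpha> \<le> n i\<^sub>0 (indicator P)"
      using lower[OF \<open>i\<^sub>0 \<le> j\<close> P] i0(2) unfolding k_def by (simp add: mult_ac)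
    also have "\<dots> \<le> (\<Sum>i\<le>j. n i (indicator P))"
      using \<open>i\<^sub>0 \<le> j\<close> n0[OF _ ind[OF P]] by (intro member_le_sum) auto
    finally show ?thesis unfolding N[OF ind[OF P]] .
  qed
  have init: "{0..\<epsilon>} \<in> subintervals" "measure lebesgue {0..\<epsilon>} = \<epsilon>" if "0 < \<epsilon>" "\<epsilon> \<le> 1 / 4" for \<epsilon> :: real
    using that by (auto intro: subintervalI[of 0 \<epsilon>])
  have "0 \<le> \<alpha>"
  proof (rule ccontr)
    assume "\<not> 0 \<le> \<alpha>"
    then have neg: "\<alpha> < 0" by simp
    \<comment> \<open>The threshold, up to the factor \<open>k\<close>, bounds the norms of the two
      long intervals for every such \<open>\<epsilon>\<close>: the shorter one has length
      \<open>1 - \<epsilon> \<ge> 1 / 2\<close>, and the power decreases in the length.\<close>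
    obtain \<epsilon> where \<epsilon>: "0 < \<epsilon>" "\<epsilon> \<le> 1 / 4" "(K + K * (1 / 2) powr \<alpha>) / k < \<epsilon> powr \<alpha>"
      by (rule powr_unbounded_near_0[OF neg])
    have long: "{\<epsilon><..1} \<in> subintervals" using \<epsilon> by (intro subintervalI[of \<epsilon> 1]) auto
    have mlong: "measure lebesgue {\<epsilon><..1} = 1 - \<epsilon>"
      using \<epsilon> by (intro interval_lebesgue(2)) auto
    have "(indicator {0..\<epsilon>} :: real \<Rightarrow> complex) = (\<lambda>x. ?I x - indicator {\<epsilon><..1} x)"
      using \<epsilon> by (auto simp: indicator_def fun_eq_iff)
    then have "N (indicator {0..\<epsilon>}) \<le> N ?I + N (indicator {\<epsilon><..1})"
      using N_diff[OF ind[OF I] ind[OF long]] by simp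
    also have "\<dots> \<le> K + K * (1 - \<epsilon>) powr \<alpha>"
      using up[OF I] up[OF long] mlong by simp
    also have "\<dots> \<le> K + K * (1 / 2) powr \<alpha>"
      using K neg \<epsilon> by (intro add_left_mono mult_left_mono powr_mono2') auto
    also have "\<dots> < k * \<epsilon> powr \<alpha>" using \<epsilon>(3) k by (simp add: divide_less_eq mult.commute)
    finally show False using low[OF init(1)[OF \<epsilon>(1,2)]] init(2)[OF \<epsilon>(1,2)] by simp
  qed
  moreover have "\<alpha> \<le> 1"
  proof (rule ccontr)
    assume "\<not> \<alpha> \<le> 1"
    then have neg: "1 - \<alpha> < 0" by simp
    obtain \<epsilon> where \<epsilon>: "0 < \<epsilon>" "\<epsilon> \<le> 1 / 4" "C\<^sub>1 * K < \<epsilon> powr (1 - \<alpha>)"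
      by (rule powr_unbounded_near_0[OF neg])
    note P = init[OF \<epsilon>(1,2)]
    have "\<epsilon> \<le> C\<^sub>1 * N (indicator {0..\<epsilon>})"
      using C1(2)[OF ind[OF P(1)]] L1_ind[OF P(1)] P(2) by simp
    also have "\<dots> \<le> C\<^sub>1 * (K * \<epsilon> powr \<alpha>)"
      using up[OF P(1)] P(2) C1(1) by (intro mult_left_mono) auto
    also have "\<dots> = (C\<^sub>1 * K) * \<epsilon> powr \<alpha>" by simp
    also have "\<dots> < \<epsilon> powr (1 - \<alpha>) * \<epsilon> powr \<alpha>" using \<epsilon> by (intro mult_strict_right_mono) auto
    also have "\<dots> = \<epsilon>" using \<epsilon>(1) by (simp add: powr_add[symmetric])
    finally show False by simp
  qed
  \<comment> \<open>One constant for both directions: \<open>K + 1 / k\<close> is at least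
    \<open>K\<close>, and its reciprocal is at most \<open>k\<close>.\<close>
  moreover have "0 < K + 1 / k" using K k by (intro add_nonneg_pos) auto
  moreover have "1 / (K + 1 / k) * measure lebesgue P powr \<alpha> \<le> N (indicator P)"
    if P: "P \<in> subintervals" for P
  proof -
    have "1 / (K + 1 / k) \<le> 1 / (1 / k)" using K k
      by (intro divide_left_mono mult_pos_pos) (auto intro: add_nonneg_pos)
    then have "1 / (K + 1 / k) * measure lebesgue P powr \<alpha> \<le> k * measure lebesgue P powr \<alpha>"
      by (intro mult_right_mono) auto
    then show ?thesis using low[OF P] by linarith
  qed
  moreover have "N (indicator P) \<le> (K + 1 / k) * measure lebesgue P powr \<alpha>"
    if P: "P \<in> subintervals" for P
  proof -
    have "K * measure lebesgue P powr \<alpha> \<le> (K + 1 / k) * measure lebesgue P powr \<alpha>"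
      using k by (intro mult_right_mono) auto
    then show ?thesis using up[OF P] by linarith
  qed
  ultimately show thesis using that by blast
qed

section \<open>Embedding of the Besov space\<close>

lemma L1_norm_triangle:
  assumes "f \<in> L1" "g \<in> L1" "h \<in> L1"
  shows "L1_norm (\<lambda>x. f x - h x) \<le> L1_norm (\<lambda>x. f x - g x) + L1_norm (\<lambda>x. g x - h x)"
proof -
  have int: "integrable (lebesgue_on {0..1}) f" "integrable (lebesgue_on {0..1}) g"
    "integrable (lebesgue_on {0..1}) h"
    using assms unfolding L1_def by auto
  have i: "integrable (lebesgue_on {0..1}) (\<lambda>x. norm (f x - h x))"
    "integrable (lebesgue_on {0..1}) (\<lambda>x. norm (f x - g x))"
    "integrable (lebesgue_on {0..1}) (\<lambda>x. norm (g x - h x))"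
    by (intro integrable_norm Bochner_Integration.integrable_diff int)+
  have "(\<integral>x. norm (f x - h x) \<partial>lebesgue_on {0..1}) \<le>
      (\<integral>x. norm (f x - g x) + norm (g x - h x) \<partial>lebesgue_on {0..1})"
    by (intro integral_mono i Bochner_Integration.integrable_add norm_diff_triangle_le) auto
  also have "\<dots> = (\<integral>x. norm (f x - g x) \<partial>lebesgue_on {0..1}) + (\<integral>x. norm (g x - h x) \<partial>lebesgue_on {0..1})"
    by (rule Bochner_Integration.integral_add[OF i(2,3)])
  finally show ?thesis unfolding L1_norm_def .
qed

lemma L1_norm_eq_0:
  assumes "f \<in> L1" "g \<in> L1" "L1_norm (\<lambda>x. f x - g x) \<le> 0"
  shows "f \<approx> g"
proof -
  have i: "integrable (lebesgue_on {0..1}) (\<lambda>x. norm (f x - g x))"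
    using assms(1,2) unfolding L1_def by (intro integrable_norm Bochner_Integration.integrable_diff) auto
  have "(\<integral>x. norm (f x - g x) \<partial>lebesgue_on {0..1}) = 0"
    using assms(3) unfolding L1_norm_def by (intro antisym integral_nonneg_AE) auto
  then have "AE x in lebesgue_on {0..1}. norm (f x - g x) = 0"
    using integral_nonneg_eq_0_iff_AE[OF i] by simp
  then show ?thesis unfolding ae_eq_def by (rule eventually_mono) simp
qed

text \<open>By the upper bound every atom has norm at most \<open>C\<close>, so each representation
  converges absolutely in \<open>B\<close>. Its sum there is the given function because both are
  limits in \<open>L1\<close>; the infimum over representations then gives the norm bound.\<close>

lemma besov_embedding:
  assumes banach: "banach_in_L1 B N" and "C > 0"
    and ind: "\<And>J. J \<in> subintervals \<Longrightarrow> indicator J \<in> B"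
    and up: "\<And>P. P \<in> subintervals \<Longrightarrow> N (indicator P) \<le> C * measure lebesgue P powr (1 - s)"
  shows "besov s \<subseteq> B" "\<And>\<psi>. \<psi> \<in> besov s \<Longrightarrow> N \<psi> \<le> C * besov_norm s \<psi>"
proof -
  interpret L1_banach B N using banach by unfold_locales
  have rep: "\<psi> \<in> B \<and> N \<psi> \<le> C * (\<Sum>n. norm (c n))"
    if \<psi>: "\<psi> \<in> L1" and r: "besov_rep s \<psi> c Q" for \<psi> c Q
  proof -
    have Q: "Q n \<in> subintervals" for n using r unfolding besov_rep_def by blast
    have sm: "summable (\<lambda>n. norm (c n))" using r unfolding besov_rep_def by blast
    define f where "f n = (\<lambda>x. c n * of_real (measure lebesgue (Q n) powr (s - 1)) * indicator (Q n) x)" for n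
    define S where "S M = (\<lambda>x. \<Sum>n<M. f n x)" for M :: nat
    have lim: "(\<lambda>M. L1_norm (\<lambda>x. \<psi> x - S M x)) \<longlonglongrightarrow> 0"
      using r unfolding besov_rep_def S_def f_def by blast
    have fB: "f n \<in> B" for n unfolding f_def by (intro mem_scale ind Q)
    have SB: "S M \<in> B" for M unfolding S_def by (intro mem_sum fB)
    have Nf: "N (f n) \<le> C * norm (c n)" for n
    proof -
      obtain p q where pq: "0 \<le> p" "p < q" "q \<le> 1" "{p<..<q} \<subseteq> Q n" "Q n \<subseteq> {p..q}"
        by (rule subintervalE[OF Q])
      have pos: "0 < measure lebesgue (Q n)" using interval_lebesgue(2)[OF _ pq(4,5)] pq(2) by simp
      have "N (f n) = norm (c n) * measure lebesgue (Q n) powr (s - 1) * N (indicator (Q n))"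
        unfolding f_def N_scale[OF ind[OF Q]] by (simp add: norm_mult)
      also have "\<dots> \<le> norm (c n) * measure lebesgue (Q n) powr (s - 1) *
          (C * measure lebesgue (Q n) powr (1 - s))"
        by (intro mult_left_mono up Q) auto
      also have "\<dots> = C * norm (c n) * (measure lebesgue (Q n) powr (s - 1) * measure lebesgue (Q n) powr (1 - s))"
        by simp
      also have "\<dots> = C * norm (c n)" using pos by (simp add: powr_add[symmetric])
      finally show ?thesis .
    qed
    have "summable (\<lambda>n. N (f n))"
      by (rule summable_comparison_test'[OF summable_mult[OF sm, of C], of 0])
        (use Nf N_nonneg[OF fB] in simp)
    then obtain g where g: "g \<in> B" "(\<lambda>M. N (\<lambda>x. S M x - g x)) \<longlonglongrightarrow> 0"
      using series_converges[of f] fB unfolding S_def by metis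
    obtain C\<^sub>1 where C1: "C\<^sub>1 > 0" "\<And>f. f \<in> B \<Longrightarrow> L1_norm f \<le> C\<^sub>1 * N f" using L1_norm_bound by blast
    have BL: "h \<in> L1" if "h \<in> B" for h using function_spaceD(1)[OF space] that by blast
    have "L1_norm (\<lambda>x. \<psi> x - g x) \<le> 0"
    proof (rule LIMSEQ_le_const)
      show "(\<lambda>M. L1_norm (\<lambda>x. \<psi> x - S M x) + C\<^sub>1 * N (\<lambda>x. S M x - g x)) \<longlonglongrightarrow> 0"
        using tendsto_add[OF lim tendsto_mult_right_zero[OF g(2), of C\<^sub>1]] by simp
      have "L1_norm (\<lambda>x. \<psi> x - g x) \<le> L1_norm (\<lambda>x. \<psi> x - S M x) + C\<^sub>1 * N (\<lambda>x. S M x - g x)" for M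
        using L1_norm_triangle[OF \<psi> BL[OF SB[of M]] BL[OF g(1)]] C1(2)[OF mem_diff[OF SB[of M] g(1)]]
        by linarith
      then show "\<exists>M. \<forall>n\<ge>M. L1_norm (\<lambda>x. \<psi> x - g x) \<le>
          L1_norm (\<lambda>x. \<psi> x - S n x) + C\<^sub>1 * N (\<lambda>x. S n x - g x)" by blast
    qed
    then have eq: "\<psi> \<approx> g" by (rule L1_norm_eq_0[OF \<psi> BL[OF g(1)]])
    have \<psi>B: "\<psi> \<in> B" by (rule mem_cong[OF g(1) ae_eq_sym[OF eq]])
    have "N g \<le> C * (\<Sum>n. norm (c n))"
    proof (rule LIMSEQ_le_const)
      show "(\<lambda>M. C * (\<Sum>n. norm (c n)) + N (\<lambda>x. S M x - g x)) \<longlonglongrightarrow> C * (\<Sum>n. norm (c n))"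
        using tendsto_add[OF tendsto_const g(2)] by simp
      have "N g \<le> C * (\<Sum>n. norm (c n)) + N (\<lambda>x. S M x - g x)" for M
      proof -
        have "N (S M) \<le> (\<Sum>n<M. N (f n))" unfolding S_def by (rule N_sum[OF fB])
        also have "\<dots> \<le> C * (\<Sum>n<M. norm (c n))"
          unfolding sum_distrib_left by (rule sum_mono) (rule Nf)
        also have "\<dots> \<le> C * (\<Sum>n. norm (c n))"
          using sm \<open>C > 0\<close> by (intro mult_left_mono sum_le_suminf) auto
        finally have "N (S M) \<le> C * (\<Sum>n. norm (c n))" .
        moreover have "N (\<lambda>x. S M x - (S M x - g x)) \<le> N (S M) + N (\<lambda>x. S M x - g x)"
          by (rule N_diff[OF SB mem_diff[OF SB g(1)]])
        ultimately show ?thesis by simp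
      qed
      then show "\<exists>M. \<forall>n\<ge>M. N g \<le> C * (\<Sum>n. norm (c n)) + N (\<lambda>x. S n x - g x)" by blast
    qed
    then show ?thesis using \<psi>B N_cong[OF \<psi>B eq] by simp
  qed
  show "besov s \<subseteq> B" using rep unfolding besov_def by blast
  show "N \<psi> \<le> C * besov_norm s \<psi>" if \<psi>: "\<psi> \<in> besov s" for \<psi>
  proof -
    have "N \<psi> / C \<le> besov_norm s \<psi>"
      unfolding besov_norm_def
    proof (rule cInf_greatest)
      show "{\<Sum>n. norm (c n) | c. \<exists>Q. besov_rep s \<psi> c Q} \<noteq> {}" using \<psi> unfolding besov_def by blast
      fix x assume "x \<in> {\<Sum>n. norm (c n) | c. \<exists>Q. besov_rep s \<psi> c Q}"
      then obtain c Q where "x = (\<Sum>n. norm (c n))" "besov_rep s \<psi> c Q" by blast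
      moreover have "\<psi> \<in> L1" using \<psi> unfolding besov_def by blast
      ultimately show "N \<psi> / C \<le> x" using rep[of \<psi> c Q] \<open>C > 0\<close> by (simp add: divide_le_eq mult.commute)
    qed
    then show ?thesis using \<open>C > 0\<close> by (simp add: divide_le_eq mult.commute)
  qed
qed

section \<open>The dichotomy\<close>

text \<open>The infimum of an empty set would carry no information. The spectral gap supplies the
  member 1, since it puts the spectrum into the closed unit disc.\<close>

lemma r_ess_greatest:
  assumes "spectral_gap B N A"
    and "\<And>r'. 0 \<le> r' \<Longrightarrow> (\<And>z. z \<in> spectrum B N A \<Longrightarrow> norm z > r' \<Longrightarrow>
      \<exists>d. isolated_eigenvalue_of_mult B N A z d) \<Longrightarrow> x \<le> r'"
  shows "x \<le> r_ess B N A"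
  unfolding r_ess_def
proof (rule cInf_greatest)
  obtain \<rho> where \<rho>: "\<rho> < 1" "spectrum B N A - {1} \<subseteq> cball 0 \<rho>"
    using assms(1) unfolding spectral_gap_def by blast
  have "norm z \<le> 1" if "z \<in> spectrum B N A" for z
    using \<rho> that by (cases "z = 1") (auto simp: subset_iff)
  then have "1 \<in> {r'. r' \<ge> 0 \<and> (\<forall>z \<in> spectrum B N A. norm z > r' \<longrightarrow>
      (\<exists>d. isolated_eigenvalue_of_mult B N A z d))}" by force
  then show "{r'. r' \<ge> 0 \<and> (\<forall>z \<in> spectrum B N A. norm z > r' \<longrightarrow>
      (\<exists>d. isolated_eigenvalue_of_mult B N A z d))} \<noteq> {}" by blast
  fix r' assume "r' \<in> {r'. r' \<ge> 0 \<and> (\<forall>z \<in> spectrum B N A. norm z > r' \<longrightarrow>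
      (\<exists>d. isolated_eigenvalue_of_mult B N A z d))}"
  then show "x \<le> r'" using assms(2) by simp
qed

text \<open>Outside the disc of the gap the only possible point of the spectrum is 1, an isolated
  eigenvalue of finite multiplicity. The maximum with 0 covers a negative radius.\<close>

lemma r_ess_less_1:
  assumes "spectral_gap B N A"
  shows "r_ess B N A < 1"
proof -
  obtain \<rho> where \<rho>: "\<rho> < 1" "spectrum B N A - {1} \<subseteq> cball 0 \<rho>"
    using assms(1) unfolding spectral_gap_def by blast
  have "isolated_eigenvalue_of_mult B N A z 1" if "z \<in> spectrum B N A" "norm z > max 0 \<rho>" for z
  proof -
    have "z = 1" using \<rho>(2) that by (auto simp: subset_iff)
    then show ?thesis using assms unfolding spectral_gap_def by blast
  qed
  then have "r_ess B N A \<le> max 0 \<rho>"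
    unfolding r_ess_def by (intro cInf_lower bdd_belowI[of _ 0]) auto
  then show ?thesis using \<rho>(1) by simp
qed

lemma subinterval_interior:
  assumes "J \<in> subintervals"
  shows "J \<inter> {0<..<1} \<in> subintervals"
proof -
  obtain p q where pq: "0 \<le> p" "p < q" "q \<le> 1" "{p<..<q} \<subseteq> J" "J \<subseteq> {p..q}"
    by (rule subintervalE[OF assms])
  show ?thesis by (rule subintervalI[OF pq(1-3)]) (use pq in auto)
qed

context full_branch_map
begin

abbreviation piece :: "real set \<Rightarrow> nat \<Rightarrow> real set \<Rightarrow> real set" where
  "piece J n P \<equiv> {x \<in> P. (T ^^ n) x \<in> J \<inter> {0<..<1}}"

lemma piece:
  assumes "J \<in> subintervals" "P \<in> branches \<I> T n"
  shows "piece J n P \<in> subintervals" "measure lebesgue (piece J n P) \<le> \<theta> n P"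
  using branch_piece[OF assms(2) subinterval_interior[OF assms(1)]] by auto

text \<open>For the exponent 1, where norms of pieces are comparable to lengths: disjointness bounds
  their total uniformly in \<open>n\<close>, which is what rules this exponent out.\<close>

lemma sum_measure_piece:
  assumes J: "J \<in> subintervals"
  shows "(\<Sum>P\<in>branches \<I> T n. measure lebesgue (piece J n P)) \<le> 1"
proof -
  have sub: "piece J n P \<subseteq> {0..1}" if "P \<in> branches \<I> T n" for P
    using piece(1)[OF J that] unfolding subintervals_def by blast
  have sets: "piece J n P \<in> sets lebesgue" if "P \<in> branches \<I> T n" for P
    by (rule subinterval_measurable[OF piece(1)[OF J that]])
  have "(\<Sum>P\<in>branches \<I> T n. measure lebesgue (piece J n P)) =
      measure lebesgue (\<Union>P\<in>branches \<I> T n. piece J n P)"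
  proof (rule measure_finite_Union[symmetric, OF finite_branches])
    show "piece J n ` branches \<I> T n \<subseteq> sets lebesgue" using sets by blast
    show "disjoint_family_on (piece J n) (branches \<I> T n)"
      unfolding disjoint_family_on_def using branch_unique by blast
    show "emeasure lebesgue (piece J n P) \<noteq> \<infinity>" if P: "P \<in> branches \<I> T n" for P
    proof -
      have "emeasure lebesgue (piece J n P) \<le> emeasure lebesgue {0..1::real}"
        by (rule emeasure_mono[OF sub[OF P]]) simp
      then show ?thesis by (auto simp: top_unique)
    qed
  qed
  also have "\<dots> \<le> measure lebesgue {0..1::real}"
    using sub sets finite_branches by (intro measure_mono_fmeasurable sets.finite_UN) auto
  finally show ?thesis by simp
qed

lemma pullback_norm:
  assumes banach: "banach_in_L1 B N" and ind: "\<And>J. J \<in> subintervals \<Longrightarrow> indicator J \<in> B"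
    and J: "J \<in> subintervals"
  shows "indicator (pullback J n) \<in> B"
    "N (indicator (pullback J n)) \<le> (\<Sum>P\<in>branches \<I> T n. N (indicator (piece J n P)))"
proof -
  interpret L1_banach B N using banach by unfold_locales
  have eq: "indicator (pullback J n) =
      (\<lambda>x. \<Sum>P\<in>branches \<I> T n. indicator (piece J n P) x :: complex)"
    by (rule ext) (rule indicator_pullback)
  have mem: "indicator (piece J n P) \<in> B" if "P \<in> branches \<I> T n" for P
    by (rule ind[OF piece(1)[OF J that]])
  show "indicator (pullback J n) \<in> B" unfolding eq by (rule mem_sum[OF mem])
  show "N (indicator (pullback J n)) \<le> (\<Sum>P\<in>branches \<I> T n. N (indicator (piece J n P)))"
    unfolding eq by (rule N_sum[OF mem])
qed

text \<open>Common form of the three exponents: each contributes only a bound \<open>a n\<close>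
  whose power series converges below the radius \<open>x\<close>. Summability may fail at
  \<open>x\<close> itself, so \<open>x\<close> is approached by smaller radii.\<close>

lemma r_ess_transfer_op_ge:
  assumes banach: "banach_in_L1 B N" and ind: "\<And>J. J \<in> subintervals \<Longrightarrow> indicator J \<in> B"
    and op: "bounded_op B N (transfer_op \<I> T)" and gap: "spectral_gap B N (transfer_op \<I> T)"
    and a: "\<And>J n. J \<in> subintervals \<Longrightarrow>
      (\<Sum>P\<in>branches \<I> T n. N (indicator (piece J n P))) \<le> a n"
    and sm: "\<And>\<rho>. 0 < \<rho> \<Longrightarrow> \<rho> < x \<Longrightarrow> summable (\<lambda>n. \<rho> ^ n * a n)"
  shows "x \<le> r_ess B N (transfer_op \<I> T)"
proof (rule r_ess_greatest[OF gap])
  fix r' :: real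
  assume r': "0 \<le> r'" and spec: "\<And>z. z \<in> spectrum B N (transfer_op \<I> T) \<Longrightarrow> norm z > r' \<Longrightarrow>
      \<exists>d. isolated_eigenvalue_of_mult B N (transfer_op \<I> T) z d"
  show "x \<le> r'"
  proof (rule ccontr)
    assume "\<not> x \<le> r'"
    then obtain \<rho> where \<rho>: "r' < \<rho>" "\<rho> < x" using dense[of r' x] by auto
    have "\<rho> \<le> r'"
    proof (rule essential_spectrum_bound[OF banach op, where V = "\<lambda>J n. indicator (pullback J n)" and a = a])
      fix J n assume J: "J \<in> subintervals"
      show "indicator (pullback J n) \<in> B" by (rule pullback_norm(1)[OF banach ind J])
      show "indicator (pullback J 0) \<approx> indicator J"
        by (rule ae_eq_interior) (simp add: pullback_def indicator_def)
      show "transfer_op \<I> T (indicator (pullback J (Suc n))) \<approx> indicator (pullback J n)"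
        by (rule transfer_op_pullback)
      show "N (indicator (pullback J n)) \<le> a n"
        by (rule order_trans[OF pullback_norm(2)[OF banach ind J] a[OF J]])
    next
      show "summable (\<lambda>n. \<rho> ^ n * a n)" using \<rho> r' by (intro sm) auto
    qed (use r' spec in auto)
    with \<rho>(1) show False by simp
  qed
qed

end

theorem theorem4:
  fixes \<I> :: "real set set" and T :: "real \<Rightarrow> real" and r :: real and k :: nat
    and B :: "(real \<Rightarrow> complex) set" and N :: "(real \<Rightarrow> complex) \<Rightarrow> real"
  assumes "interval_partition \<I>"
    and "T ` (\<Union>\<I>) \<subseteq> {0..1}"
    and "r > 0"
    and "card \<I> = k"
    and "piecewise_C_full_branches (r + 1) \<I> T"
    and "expanding \<I> T"
    and "exp (P_top \<I> T (\<lambda>x. - (r + 1) * ln \<bar>deriv T x\<bar>)) < 1 / real k"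
    and "lebesgue_invariant \<I> T"
    and "banach_in_L1 B N"
    and "natural_norm B N"
    and "bounded_op B N (transfer_op \<I> T)"
    and "spectral_gap B N (transfer_op \<I> T)"
    and "\<forall>J\<in>subintervals. indicator J \<in> B"
  shows
    "((\<exists>C>0. \<forall>P\<in>subintervals. 1 / C \<le> N (indicator P) \<and> N (indicator P) \<le> C) \<and>
      r_ess B N (transfer_op \<I> T) \<ge> 1 / real k)
     \<or>
     (\<exists>s. 0 < s \<and> s < 1 \<and>
       (\<exists>C>0. \<forall>P\<in>subintervals.
          1 / C * measure lebesgue P powr (1 - s) \<le> N (indicator P) \<and>
          N (indicator P) \<le> C * measure lebesgue P powr (1 - s)) \<and>
       besov s \<subseteq> B \<and> (\<exists>C. \<forall>\<psi>\<in>besov s. N \<psi> \<le> C * besov_norm s \<psi>) \<and>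
       r_ess B N (transfer_op \<I> T) \<ge> 1 / Theta_inf \<I> T (1 - s))"
proof -
  interpret full_branch_map \<I> T "r + 1" using assms by unfold_locales auto
  have ind: "indicator J \<in> B" if "J \<in> subintervals" for J using assms(13) that by blast
  obtain \<alpha> C where \<alpha>: "0 \<le> \<alpha>" "\<alpha> \<le> 1" and C: "C > 0"
    and lower: "\<And>P. P \<in> subintervals \<Longrightarrow> 1 / C * measure lebesgue P powr \<alpha> \<le> N (indicator P)"
    and upper: "\<And>P. P \<in> subintervals \<Longrightarrow> N (indicator P) \<le> C * measure lebesgue P powr \<alpha>"
    using natural_norm_interval[OF assms(9,10) ind] by blast
  note r_ess_ge = r_ess_transfer_op_ge[OF assms(9) ind assms(11,12)]
  have pos: "0 < measure lebesgue P" if P: "P \<in> subintervals" for P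
  proof -
    obtain p q where pq: "0 \<le> p" "p < q" "q \<le> 1" "{p<..<q} \<subseteq> P" "P \<subseteq> {p..q}"
      by (rule subintervalE[OF P])
    then show ?thesis using interval_lebesgue(2)[OF _ pq(4,5)] by simp
  qed
  consider "\<alpha> = 1" | "\<alpha> = 0" | "0 < \<alpha>" "\<alpha> < 1" using \<alpha> by linarith
  then show ?thesis
  proof cases
    case 1
    have "1 \<le> r_ess B N (transfer_op \<I> T)"
    proof (rule r_ess_ge)
      fix J n assume J: "J \<in> subintervals"
      have "(\<Sum>P\<in>branches \<I> T n. N (indicator (piece J n P))) \<le>
          (\<Sum>P\<in>branches \<I> T n. C * measure lebesgue (piece J n P))"
        using upper[OF piece(1)[OF J]] pos[OF piece(1)[OF J]] unfolding 1
        by (intro sum_mono) (simp del: Int_iff)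
      also have "\<dots> \<le> C * 1"
        unfolding sum_distrib_left[symmetric] using sum_measure_piece[OF J] C by (intro mult_left_mono) auto
      finally show "(\<Sum>P\<in>branches \<I> T n. N (indicator (piece J n P))) \<le> C" by simp
    next
      fix \<rho> :: real assume "0 < \<rho>" "\<rho> < 1"
      then show "summable (\<lambda>n. \<rho> ^ n * C)" by (intro summable_mult2 summable_geometric) auto
    qed
    with r_ess_less_1[OF assms(12)] show ?thesis by simp
  next
    case 2
    have bounds: "1 / C \<le> N (indicator P)" "N (indicator P) \<le> C" if "P \<in> subintervals" for P
      using lower[OF that] upper[OF that] pos[OF that] unfolding 2 by auto
    have "1 / real k \<le> r_ess B N (transfer_op \<I> T)"
    proof (rule r_ess_ge)
      fix J n assume J: "J \<in> subintervals"
      have "(\<Sum>P\<in>branches \<I> T n. N (indicator (piece J n P))) \<le> (\<Sum>P\<in>branches \<I> T n. C)"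
        using bounds(2)[OF piece(1)[OF J]] by (intro sum_mono)
      also have "\<dots> \<le> C * real k ^ n"
        using card_branches[of n] C unfolding assms(4)
        by (simp add: mult.commute of_nat_power[symmetric] del: of_nat_power)
      finally show "(\<Sum>P\<in>branches \<I> T n. N (indicator (piece J n P))) \<le> C * real k ^ n" .
    next
      fix \<rho> :: real assume \<rho>: "0 < \<rho>" "\<rho> < 1 / real k"
      \<comment> \<open>For \<open>k = 0\<close> the bound \<open>1 / real k\<close> would be 0,
        against \<open>0 < \<rho>\<close>.\<close>
      then have "k \<noteq> 0" by (cases "k = 0") auto
      then have "summable (\<lambda>n. C * (\<rho> * real k) ^ n)"
        using \<rho> by (intro summable_mult summable_geometric) (auto simp: field_simps)
      then show "summable (\<lambda>n. \<rho> ^ n * (C * real k ^ n))" by (simp add: power_mult_distrib mult_ac)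
    qed
    with bounds C show ?thesis by blast
  next
    case 3
    have "1 / Theta_inf \<I> T \<alpha> \<le> r_ess B N (transfer_op \<I> T)"
    proof (rule r_ess_ge)
      fix J n assume J: "J \<in> subintervals"
      have "N (indicator (piece J n P)) \<le> C * \<theta> n P powr \<alpha>" if P: "P \<in> branches \<I> T n" for P
      proof -
        have "measure lebesgue (piece J n P) powr \<alpha> \<le> \<theta> n P powr \<alpha>"
          using piece(2)[OF J P] \<alpha>(1) by (intro powr_mono2) auto
        then show ?thesis using upper[OF piece(1)[OF J P]] C
          by (meson mult_left_mono less_imp_le order_trans)
      qed
      then show "(\<Sum>P\<in>branches \<I> T n. N (indicator (piece J n P))) \<le> C * Theta \<I> T n \<alpha>"
        unfolding Theta_def sum_distrib_left by (rule sum_mono)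
    next
      fix \<rho> :: real assume "0 < \<rho>" "\<rho> < 1 / Theta_inf \<I> T \<alpha>"
      then have "summable (\<lambda>n. C * (\<rho> ^ n * Theta \<I> T n \<alpha>))"
        by (intro summable_mult summable_Theta \<alpha>(1))
      then show "summable (\<lambda>n. \<rho> ^ n * (C * Theta \<I> T n \<alpha>))" by (simp add: mult_ac)
    qed
    \<comment> \<open>With \<open>s = 1 - \<alpha>\<close> the weight
      \<open>s - 1 = - \<alpha>\<close> of an atom exactly cancels the growth exponent of the norms
      of intervals.\<close>
    moreover have "besov (1 - \<alpha>) \<subseteq> B" "\<forall>\<psi>\<in>besov (1 - \<alpha>). N \<psi> \<le> C * besov_norm (1 - \<alpha>) \<psi>"
      using besov_embedding[OF assms(9) C ind, of "1 - \<alpha>"] upper by auto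
    ultimately have "0 < 1 - \<alpha> \<and> 1 - \<alpha> < 1 \<and>
       (\<exists>C>0. \<forall>P\<in>subintervals.
          1 / C * measure lebesgue P powr (1 - (1 - \<alpha>)) \<le> N (indicator P) \<and>
          N (indicator P) \<le> C * measure lebesgue P powr (1 - (1 - \<alpha>))) \<and>
       besov (1 - \<alpha>) \<subseteq> B \<and> (\<exists>C. \<forall>\<psi>\<in>besov (1 - \<alpha>). N \<psi> \<le> C * besov_norm (1 - \<alpha>) \<psi>) \<and>
       r_ess B N (transfer_op \<I> T) \<ge> 1 / Theta_inf \<I> T (1 - (1 - \<alpha>))"
      using 3 lower upper C by auto
    then show ?thesis by (intro disjI2 exI[of _ "1 - \<alpha>"])
  qed
qed

end
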